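(* Assume the rank condition $$\operatorname{rank}\overline{Q}_{k}=\operatorname{rank}\overline{Q}_{k+l}=m_k\quad\text{for all }k=1,\dots,l$$ if the eigenvalues $\{-\mu_j^\pm\}_{j=1}^N$ of $P_{2N}$ are semisimple, and the rank condition $$\operatorname{rank}\overline{\overline{Q}}_{k}=\operatorname{rank}\overline{\overline{Q}}_{k+l}=m_k\quad\text{for all }k=1,\dots,l$$ if they are non-semisimple. Then there is a controller $u$ of the form $$u(t)=\sum_{i=1}^{M}\Phi_i v_i(t),\qquad t\ge 0,$$ which exponentially stabilizes the system $$\frac{dy}{dt}(t)+Ay(t)+\int_0^t \beta(t-s)Ay(s)\,ds=Bu(t)\quad(t>0),\qquad y(0)=y_0\in H,$$ where $\beta'(t)+\delta\beta(t)=0$ for $t>0$ and $\beta(0)=1$ (so $\beta(t)=e^{-\delta t}$). In other words, the solution $y\in C^1([0,\infty);\tilde H)$ of this system with this control satisfies $$|y(t)|_{\tilde H}\le C e^{-\gamma t}|y_0|_{\tilde H},\qquad t\ge 0 .$$ Moreover, for any $T>0$ the controller $v=\{v_i\}_{i=1}^M$ can be chosen in $C([0,T);\mathbb C^M)$ such that, with $w_i=v_i'+\delta v_i$, $$v_i(t)=-\int_t^T \beta(t-s)w_i(s)\,ds,\qquad \int_0^T|w_i(t)|^2\,dt\le C|y_0|_{\tilde H}^2,\qquad v_i(t)=0=w_i(t)\ \text{ for } t\ge T,$$ and $\{\Phi_i\}_{i=1}^M\subset D(A)$ is a system of eigenfunctions, made precise as follows: $\Phi_i=\phi_i^*$ in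 the semisimple case, and $\Phi_i=\sum_{k=1}^N c_{ik}P_u^*\phi_k$ with suitable coefficients $c_{ik}$ in the general case. In addition, the controller $v=\{v_i\}_{i=1}^M$ can also be found as a $C^2([0,\infty);\mathbb C^M)$ function such that $$|v_j(t)|+|v_j'(t)|+|v_j''(t)|\le C e^{-\gamma t}|y_0|_{\tilde H}\qquad\forall\, t>0,\ j=1,\dots,M .$$
   Context: $H$ is a real Hilbert space with norm $|\cdot|$ and inner product $(\cdot,\cdot)$; $\tilde H=H+iH$ is its complexification, with norm $|\cdot|_{\tilde H}$. $A:D(A)\subset H\to H$ is a closed, densely defined, linear, self-adjoint, positive definite operator with compact resolvent. $U$ is a Hilbert space (control space) and $B:U\to H$ is a bounded linear operator. $\delta>0$ is a constant. $C$ denotes a generic constant. Let $\lambda_1,\lambda_2,\dots$ be the eigenvalues of $A$ repeated according to multiplicity (equal ones listed consecutively, $\lambda_j\to\infty$), and $\{\phi_n\}_{n\ge1}$ a corresponding orthonormal basis of $H$ of eigenvectors. Set $$\mu_n^{\pm}=\tfrac12\Big(\lambda_n+\delta\pm\sqrt{(\lambda_n-\delta)^2-4\lambda_n}\Big),\qquad \omega_0=1+\delta .$$ Then $\mu_n^+\to\infty$ and $\mu_n^-\to\omega_0$. Standing assumptions: $\delta\ne\lambda_j\pm2\sqrt{\lambda_j}$ for all $j$, and $\mu_j^+\neq\mu_m^-$ for all $j\ne m$. Fix $0<\gamma<\omega_0$. Let $N_1=\sup\{j:\operatorname{Re}\mu_j^+\le\gamma\}$, $N_2=\sup\{j:\operatorname{Re}\mu_j^-\le\gamma\}$,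 $N=\max\{N_1,N_2\}<\infty$. Among $\lambda_1,\dots,\lambda_N$ there are $l$ distinct values with multiplicities $m_1,\dots,m_l$, so $m_1+\dots+m_l=N$ (the first $m_1$ are equal, the next $m_2$ are equal, and so on). Let $M=\max\{m_1,\dots,m_l\}$. $P_u$ is the orthogonal projection of $\tilde H$ onto $\operatorname{span}\{\phi_1,\dots,\phi_N\}$ and $P_u^*$ its adjoint. Let $\{\phi_j^*\}_{j=1}^N$ be the system biorthogonal to $\{\phi_j\}_{j=1}^N$, i.e. $(\phi_i,\phi_j^* )=\delta_{ij}$ (Kronecker delta). Matrices: $A_N=\operatorname{diag}\{\lambda_j+\delta\}_{j=1}^N$, $B_N=\operatorname{diag}\{\lambda_j(1+\delta)\}_{j=1}^N$, $C_{NM}$ is the $N\times M$ matrix with $(j,i)$ entry $(B\phi_i^*,\phi_j^* )$, and $$P_{2N}=\begin{pmatrix}0_N&I_N\\-B_N&-A_N\end{pmatrix},\qquad Q_{2NM}=\begin{pmatrix}0\\ C_{NM}\end{pmatrix}\ (2N\times M).$$ The eigenvalues of $P_{2N}$ are $-\mu_j^{+},-\mu_j^-$, $j=1,\dots,N$. Semisimple case: $R_{2N}$ is an invertible $2N\times2N$ matrix with $P_{2N}=R_{2N}^{-1}D_{2N}R_{2N}$, $D_{2N}=\operatorname{diag}(-\mu_1^+,\dots,-\mu_N^+,-\mu_1^-,\dots,-\mu_N^-)$, and $\overline Q_{2NM}=R_{2N}Q_{2NM}$. For $k=1,\dots,l$, $\overline Q_k$ is the $M\times m_k$ submatrix of the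 $M\times 2N$ matrix $\overline Q_{2NM}^*$ (adjoint) consisting of columns $m_1+\dots+m_{k-1}+1,\dots,m_1+\dots+m_k$, and $\overline Q_{l+k}$ is the $M\times m_k$ submatrix consisting of columns $N+m_1+\dots+m_{k-1}+1,\dots,N+m_1+\dots+m_k$. Non-semisimple case: $\overline R_{2N}$ is a non-singular $2N\times 2N$ matrix with $P_{2N}=\overline R_{2N}^{-1}J_{2N}\overline R_{2N}$, where $J_{2N}=\begin{pmatrix}J^+&0\\0&J^-\end{pmatrix}$ is the Jordan matrix of $P_{2N}$, with $J^\pm$ block diagonal, its $k$-th block being the Jordan block for the eigenvalue $-\mu^\pm_{m_1+\dots+m_k}$, $k=1,\dots,l$ (taken for simplicity to be of size $m_k$; in general of size at most $m_k$). Put $\overline{\overline Q}_{2NM}=\overline R_{2N}Q_{2NM}$. The matrices $\overline{\overline Q}_k$, $k=1,\dots,2l$, are the submatrices of $\overline{\overline Q}_{2NM}^*$ consisting of the same columns as those defining $\overline Q_k$ from $\overline Q_{2NM}^*$.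
   Formalization: y in C^1([0,∞)) fails unless y_0 is in D(A); it is proved for such y_0, otherwise y is continuous on [0,∞) and C^1 on (0,∞), the memory integral being improper at 0. As B acts on U, Φ_i and φ_i^* enter B through an arbitrary linear map H→U (the identity if U=H). *)

theory Defs
  imports
    "HOL-Analysis.Analysis"
    "Jordan_Normal_Form.Jordan_Normal_Form"
    "Jordan_Normal_Form.Schur_Decomposition"
    "Jordan_Normal_Form.Matrix_Kernel"
    "Jordan_Normal_Form.DL_Rank"
    "Jordan_Normal_Form.DL_Submatrix"
begin

section \<open>Complexification of a real Hilbert space\<close>

text \<open>
  The complexification \<open>H + iH\<close> is carried by the product type: \<open>(a, b)\<close> stands for \<open>a + ib\<close>.
  The product norm of the library, \<open>sqrt (norm a ^ 2 + norm b ^ 2)\<close>, is the norm of the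
  complexification, and limits, derivatives and integrals are those of the product space.
  A real linear operator \<open>A\<close> with domain \<open>D\<close> is extended to \<open>map_prod A A\<close> with
  domain \<open>D \<times> D\<close>.
\<close>

definition cscale :: "complex \<Rightarrow> 'a::real_vector \<times> 'a \<Rightarrow> 'a \<times> 'a" (infixr \<open>*\<^sub>C\<close> 75) where
  "c *\<^sub>C z = (Re c *\<^sub>R fst z - Im c *\<^sub>R snd z, Re c *\<^sub>R snd z + Im c *\<^sub>R fst z)"

text \<open>Complex linear in the first and conjugate linear in the second argument.\<close>

definition cinner :: "'a::real_inner \<times> 'a \<Rightarrow> 'a \<times> 'a \<Rightarrow> complex" where
  "cinner z z' =
     Complex (inner (fst z) (fst z') + inner (snd z) (snd z'))
             (inner (snd z) (fst z') - inner (fst z) (snd z'))"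

definition real_part_embed :: "'a::real_vector \<Rightarrow> 'a \<times> 'a" where
  "real_part_embed x = (x, 0)"

definition cspan_upto :: "nat \<Rightarrow> (nat \<Rightarrow> 'a::real_vector) \<Rightarrow> ('a \<times> 'a) set" where
  "cspan_upto N \<phi> = {\<Sum>j=1..N. c j *\<^sub>C real_part_embed (\<phi> j) | c. True}"

definition orthogonal_projection_onto ::
    "('a::real_inner \<times> 'a) set \<Rightarrow> ('a \<times> 'a \<Rightarrow> 'a \<times> 'a) \<Rightarrow> bool" where
  "orthogonal_projection_onto S P \<longleftrightarrow>
     (\<forall>z. P z \<in> S \<and> (\<forall>s\<in>S. cinner (z - P z) s = 0))"

definition adjoint_operators ::
    "('a::real_inner \<times> 'a \<Rightarrow> 'a \<times> 'a) \<Rightarrow> ('a \<times> 'a \<Rightarrow> 'a \<times> 'a) \<Rightarrow> bool" where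
  "adjoint_operators P P' \<longleftrightarrow> (\<forall>z z'. cinner (P z) z' = cinner z (P' z'))"


section \<open>The unbounded operator and its spectral data\<close>

text \<open>
  An unbounded operator is a total function together with its domain \<open>D\<close>; its values outside
  \<open>D\<close> are irrelevant.
\<close>

definition linear_operator_on :: "'a::real_vector set \<Rightarrow> ('a \<Rightarrow> 'a) \<Rightarrow> bool" where
  "linear_operator_on D A \<longleftrightarrow> Real_Vector_Spaces.subspace D \<and>
     (\<forall>x\<in>D. \<forall>y\<in>D. A (x + y) = A x + A y) \<and> (\<forall>c. \<forall>x\<in>D. A (c *\<^sub>R x) = c *\<^sub>R A x)"

definition closed_operator :: "'a::real_normed_vector set \<Rightarrow> ('a \<Rightarrow> 'a) \<Rightarrow> bool" where
  "closed_operator D A \<longleftrightarrow> closed {(x, A x) | x. x \<in> D}"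

text \<open>The right-hand conjunction says that \<open>y\<close> is in the domain of the adjoint, with value \<open>z\<close>.\<close>

definition self_adjoint_operator :: "'a::real_inner set \<Rightarrow> ('a \<Rightarrow> 'a) \<Rightarrow> bool" where
  "self_adjoint_operator D A \<longleftrightarrow>
     (\<forall>y z. y \<in> D \<and> A y = z \<longleftrightarrow> (\<forall>x\<in>D. inner (A x) y = inner x z))"

definition positive_definite_operator :: "'a::real_inner set \<Rightarrow> ('a \<Rightarrow> 'a) \<Rightarrow> bool" where
  "positive_definite_operator D A \<longleftrightarrow> (\<forall>x\<in>D. x \<noteq> 0 \<longrightarrow> inner (A x) x > 0)"

definition compact_operator :: "('a::real_normed_vector \<Rightarrow> 'a) \<Rightarrow> bool" where
  "compact_operator R \<longleftrightarrow> bounded_linear R \<and> (\<forall>S. bounded S \<longrightarrow> compact (closure (R ` S)))"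

definition compact_resolvent :: "'a::real_normed_vector set \<Rightarrow> ('a \<Rightarrow> 'a) \<Rightarrow> bool" where
  "compact_resolvent D A \<longleftrightarrow> (\<exists>\<zeta>::real. \<exists>R. compact_operator R \<and>
     (\<forall>x. R x \<in> D \<and> A (R x) - \<zeta> *\<^sub>R R x = x) \<and> (\<forall>x\<in>D. R (A x - \<zeta> *\<^sub>R x) = x))"

text \<open>
  Sequences are indexed from 1. Multiplicities need not be mentioned: an orthonormal basis of
  eigenvectors lists every eigenvalue as often as its multiplicity.
\<close>

definition orthonormal_eigenbasis ::
    "'a::real_inner set \<Rightarrow> ('a \<Rightarrow> 'a) \<Rightarrow> (nat \<Rightarrow> real) \<Rightarrow> (nat \<Rightarrow> 'a) \<Rightarrow> bool" where
  "orthonormal_eigenbasis D A lam \<phi> \<longleftrightarrow>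
     (\<forall>n\<ge>1. \<phi> n \<in> D \<and> A (\<phi> n) = lam n *\<^sub>R \<phi> n) \<and>
     (\<forall>i\<ge>1. \<forall>j\<ge>1. inner (\<phi> i) (\<phi> j) = (if i = j then 1 else 0)) \<and>
     closure (Real_Vector_Spaces.span (\<phi> ` {1..})) = UNIV"

definition equal_ones_consecutive :: "(nat \<Rightarrow> real) \<Rightarrow> bool" where
  "equal_ones_consecutive lam \<longleftrightarrow>
     (\<forall>i\<ge>1. \<forall>j k. i \<le> j \<longrightarrow> j \<le> k \<longrightarrow> lam i = lam k \<longrightarrow> lam j = lam i)"

text \<open>The principal root of a negative discriminant is \<open>\<i>\<close> times a positive number.\<close>

definition mu_plus :: "real \<Rightarrow> real \<Rightarrow> complex" where
  "mu_plus \<delta> x =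
     (complex_of_real (x + \<delta>) + csqrt (complex_of_real ((x - \<delta>)\<^sup>2 - 4 * x))) / 2"

definition mu_minus :: "real \<Rightarrow> real \<Rightarrow> complex" where
  "mu_minus \<delta> x =
     (complex_of_real (x + \<delta>) - csqrt (complex_of_real ((x - \<delta>)\<^sup>2 - 4 * x))) / 2"

text \<open>
  Suprema of sets of naturals: the supremum of the empty set is 0, so that \<open>N = 0\<close> (and below
  \<open>l = M = 0\<close>) if there is no unstable mode. The sets here are finite for
  \<open>\<gamma> < 1 + \<delta>\<close> and \<open>lam\<close> tending to infinity.
\<close>

definition unstable_dim :: "real \<Rightarrow> (nat \<Rightarrow> real) \<Rightarrow> real \<Rightarrow> nat" where
  "unstable_dim \<delta> lam \<gamma> =
     max (Sup {j. 1 \<le> j \<and> Re (mu_plus \<delta> (lam j)) \<le> \<gamma>})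
         (Sup {j. 1 \<le> j \<and> Re (mu_minus \<delta> (lam j)) \<le> \<gamma>})"

definition partial_sum :: "(nat \<Rightarrow> nat) \<Rightarrow> nat \<Rightarrow> nat" where
  "partial_sum m k = (\<Sum>i=1..k. m i)"

text \<open>
  Among \<open>lam 1, \<dots>, lam N\<close> there are \<open>l\<close> distinct values; the first \<open>m 1\<close> entries are equal, the
  next \<open>m 2\<close> are equal, and so on.
\<close>

definition has_multiplicities :: "(nat \<Rightarrow> real) \<Rightarrow> nat \<Rightarrow> nat \<Rightarrow> (nat \<Rightarrow> nat) \<Rightarrow> bool" where
  "has_multiplicities lam N l m \<longleftrightarrow>
     l = card (lam ` {1..N}) \<and> partial_sum m l = N \<and> (\<forall>k\<in>{1..l}. 1 \<le> m k) \<and>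
     (\<forall>k\<in>{1..l}. \<forall>i\<in>{partial_sum m (k - 1) + 1..partial_sum m k}. \<forall>j\<in>{1..N}.
        lam j = lam i \<longleftrightarrow> j \<in> {partial_sum m (k - 1) + 1..partial_sum m k})"


section \<open>Matrices\<close>

text \<open>
  Matrix indices start at 0, hence the shifts by one. \<open>emb\<close> is the map by which vectors of \<open>H\<close>
  are used as controls (the argument of \<open>B\<close>); it is the identity if \<open>U = H\<close>.
\<close>

definition C_mat ::
    "('u::real_inner \<Rightarrow> 'h::real_inner) \<Rightarrow> ('h \<Rightarrow> 'u) \<Rightarrow> (nat \<Rightarrow> 'h \<times> 'h) \<Rightarrow> nat \<Rightarrow> nat \<Rightarrow> complex mat"
  where
  "C_mat B emb \<phi>s N M = Matrix.mat N M
     (\<lambda>(j, i). cinner (map_prod B B (map_prod emb emb (\<phi>s (i + 1)))) (\<phi>s (j + 1)))"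

definition P_mat :: "real \<Rightarrow> (nat \<Rightarrow> real) \<Rightarrow> nat \<Rightarrow> complex mat" where
  "P_mat \<delta> lam N = four_block_mat
     (0\<^sub>m N N) (1\<^sub>m N)
     (- mat_diag N (\<lambda>j. complex_of_real (lam (j + 1) * (1 + \<delta>))))
     (- mat_diag N (\<lambda>j. complex_of_real (lam (j + 1) + \<delta>)))"

definition Q_mat ::
    "('u::real_inner \<Rightarrow> 'h::real_inner) \<Rightarrow> ('h \<Rightarrow> 'u) \<Rightarrow> (nat \<Rightarrow> 'h \<times> 'h) \<Rightarrow> nat \<Rightarrow> nat \<Rightarrow> complex mat"
  where
  "Q_mat B emb \<phi>s N M = 0\<^sub>m N M @\<^sub>r C_mat B emb \<phi>s N M"

definition D_mat :: "real \<Rightarrow> (nat \<Rightarrow> real) \<Rightarrow> nat \<Rightarrow> complex mat" where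
  "D_mat \<delta> lam N = mat_diag (2 * N)
     (\<lambda>i. if i < N then - mu_plus \<delta> (lam (i + 1)) else - mu_minus \<delta> (lam (i - N + 1)))"

text \<open>
  \<open>p k\<close> and \<open>q k\<close> list the sizes of the Jordan blocks that make up the \<open>k\<close>-th diagonal block (of
  size \<open>m k\<close>) of the two halves of the Jordan matrix; \<open>p k = q k = [m k]\<close> means that each
  of these is a single Jordan block.
\<close>

definition jordan_sizes :: "nat \<Rightarrow> (nat \<Rightarrow> nat) \<Rightarrow> (nat \<Rightarrow> nat list) \<Rightarrow> bool" where
  "jordan_sizes l m p \<longleftrightarrow> (\<forall>k\<in>{1..l}. sum_list (p k) = m k \<and> 0 \<notin> set (p k))"

definition jordan_half ::
    "(nat \<Rightarrow> complex) \<Rightarrow> nat \<Rightarrow> (nat \<Rightarrow> nat) \<Rightarrow> (nat \<Rightarrow> nat list) \<Rightarrow> complex mat" where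
  "jordan_half \<mu> l m p = jordan_matrix
     (concat (map (\<lambda>k. map (\<lambda>s. (s, - \<mu> (partial_sum m k))) (p k)) [1..<Suc l]))"

definition J_mat ::
    "real \<Rightarrow> (nat \<Rightarrow> real) \<Rightarrow> nat \<Rightarrow> nat \<Rightarrow> (nat \<Rightarrow> nat) \<Rightarrow> (nat \<Rightarrow> nat list) \<Rightarrow> (nat \<Rightarrow> nat list)
      \<Rightarrow> complex mat" where
  "J_mat \<delta> lam N l m p q = four_block_mat
     (jordan_half (\<lambda>j. mu_plus \<delta> (lam j)) l m p) (0\<^sub>m N N)
     (0\<^sub>m N N) (jordan_half (\<lambda>j. mu_minus \<delta> (lam j)) l m q)"

text \<open>Algebraic and geometric multiplicity agree.\<close>

definition semisimple_eigenvalue :: "complex mat \<Rightarrow> complex \<Rightarrow> bool" where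
  "semisimple_eigenvalue X e \<longleftrightarrow>
     eigenvalue X e \<and> Polynomial.order e (char_poly X) = kernel_dim (char_matrix X e)"

definition semisimple_case :: "real \<Rightarrow> (nat \<Rightarrow> real) \<Rightarrow> nat \<Rightarrow> bool" where
  "semisimple_case \<delta> lam N \<longleftrightarrow> (\<forall>j\<in>{1..N}.
     semisimple_eigenvalue (P_mat \<delta> lam N) (- mu_plus \<delta> (lam j)) \<and>
     semisimple_eigenvalue (P_mat \<delta> lam N) (- mu_minus \<delta> (lam j)))"

definition column_block :: "complex mat \<Rightarrow> nat \<Rightarrow> nat \<Rightarrow> complex mat" where
  "column_block X a b = submatrix X UNIV {a..<b}"

text \<open>
  To be applied to \<open>X = R * Q\<close> with \<open>R\<close> the transformation to diagonal or Jordan form; the two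
  blocks are those with indices \<open>k\<close> and \<open>k + l\<close>.
\<close>

definition rank_condition :: "complex mat \<Rightarrow> nat \<Rightarrow> nat \<Rightarrow> nat \<Rightarrow> (nat \<Rightarrow> nat) \<Rightarrow> bool" where
  "rank_condition X N M l m \<longleftrightarrow> (\<forall>k\<in>{1..l}.
     vec_space.rank M (column_block (mat_adjoint X)
       (partial_sum m (k - 1)) (partial_sum m k)) = m k \<and>
     vec_space.rank M (column_block (mat_adjoint X)
       (N + partial_sum m (k - 1)) (N + partial_sum m k)) = m k)"


section \<open>The controlled equation with memory\<close>

definition memory_kernel :: "real \<Rightarrow> real \<Rightarrow> real" where
  "memory_kernel \<delta> t = exp (- (\<delta> * t))"

lemma memory_kernel_ode:
  "memory_kernel \<delta> 0 = 1"
  "(memory_kernel \<delta> has_real_derivative - \<delta> * memory_kernel \<delta> t) (at t)"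
  unfolding memory_kernel_def by (auto intro!: derivative_eq_intros)

definition has_C1_derivative_on ::
    "(real \<Rightarrow> 'a::real_normed_vector) \<Rightarrow> (real \<Rightarrow> 'a) \<Rightarrow> real set \<Rightarrow> bool" where
  "has_C1_derivative_on f f' S \<longleftrightarrow>
     continuous_on S f' \<and> (\<forall>t\<in>S. (f has_vector_derivative f' t) (at t within S))"

definition control ::
    "('h::real_inner \<Rightarrow> 'u::real_inner) \<Rightarrow> nat \<Rightarrow> (nat \<Rightarrow> 'h \<times> 'h) \<Rightarrow> (nat \<Rightarrow> real \<Rightarrow> complex)
      \<Rightarrow> real \<Rightarrow> 'u \<times> 'u" where
  "control emb M \<Phi> v t = (\<Sum>i=1..M. v i t *\<^sub>C map_prod emb emb (\<Phi> i))"

text \<open>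
  For \<open>y0\<close> outside \<open>D\<close> the solution is continuous at 0 but not differentiable there (the derivative
  would have to be \<open>B (u 0) - A y0\<close>), and \<open>A (y s)\<close> need not be absolutely integrable near
  \<open>s = 0\<close>. Hence differentiability is asked for on the open half-line, and the memory term is a
  Henstock--Kurzweil integral, which includes improper integrals at 0 and does not depend on the
  value of the integrand at \<open>s = 0\<close>.
\<close>

definition memory_solution ::
    "'h::real_inner set \<Rightarrow> ('h \<Rightarrow> 'h) \<Rightarrow> ('u::real_inner \<Rightarrow> 'h) \<Rightarrow> real \<Rightarrow> (real \<Rightarrow> 'u \<times> 'u) \<Rightarrow> 'h
      \<Rightarrow> (real \<Rightarrow> 'h \<times> 'h) \<Rightarrow> bool" where
  "memory_solution D A B \<delta> u y0 y \<longleftrightarrow>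
     y 0 = real_part_embed y0 \<and> continuous_on {0..} y \<and>
     (\<exists>y'. has_C1_derivative_on y y' {0<..} \<and>
       (\<forall>t>0. y t \<in> D \<times> D \<and>
          (\<lambda>s. memory_kernel \<delta> (t - s) *\<^sub>R map_prod A A (y s)) integrable_on {0..t} \<and>
          y' t + map_prod A A (y t)
            + integral {0..t} (\<lambda>s. memory_kernel \<delta> (t - s) *\<^sub>R map_prod A A (y s))
          = map_prod B B (u t)))"

text \<open>
  Existence, uniqueness, regularity and decay of the solution under the control \<open>u\<close>.
\<close>

definition stabilized_by ::
    "'h::real_inner set \<Rightarrow> ('h \<Rightarrow> 'h) \<Rightarrow> ('u::real_inner \<Rightarrow> 'h) \<Rightarrow> real \<Rightarrow> real \<Rightarrow> real
      \<Rightarrow> 'h \<Rightarrow> (real \<Rightarrow> 'u \<times> 'u) \<Rightarrow> bool" where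
  "stabilized_by D A B \<delta> \<gamma> C y0 u \<longleftrightarrow>
     (\<exists>y. memory_solution D A B \<delta> u y0 y \<and>
       (\<forall>z. memory_solution D A B \<delta> u y0 z \<longrightarrow> (\<forall>t\<ge>0. z t = y t)) \<and>
       (y0 \<in> D \<longrightarrow> (\<exists>y'. has_C1_derivative_on y y' {0..})) \<and>
       (\<forall>t\<ge>0. norm (y t) \<le> C * exp (- (\<gamma> * t)) * norm (real_part_embed y0)))"

end

theory Submission
  imports Defs "Jordan_Normal_Form.Jordan_Normal_Form_Uniqueness"
begin

text \<open>
  With \<open>z(t) = \<integral>\<^sub>0\<^sup>t exp(-\<delta> (t - s)) y(s) ds\<close> the equation becomes the system
  \<open>y' = -A(y+z) + Bu\<close>, \<open>z' = y - \<delta> z\<close>, which an eigenbasis of \<open>A\<close> splits into planar systems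
  with eigenvalues \<open>-\<mu>\<^sub>n\<^sup>\<plusminus>\<close>. In the coordinates \<open>\<xi>\<^sub>\<mu> = y\<^sub>n + (\<lambda>\<^sub>n - \<mu>) z\<^sub>n\<close>,
  \<open>\<mu> = \<mu>\<^sub>n\<^sup>\<plusminus>\<close>, such a system is diagonal: \<open>\<xi>\<^sub>\<mu>' = -\<mu> \<xi>\<^sub>\<mu> + b\<^sub>n\<close> with
  \<open>b\<^sub>n = (Bu, \<phi>\<^sub>n)\<close> and \<open>\<xi>\<^sub>\<mu>(0) = (y\<^sub>0, \<phi>\<^sub>n)\<close>. This is \<open>duhamel\<close>, from which \<open>mode_y\<close> and
  \<open>mode_z\<close> recover the mode.

  For \<open>n > N\<close> both roots have real part above \<open>\<gamma>\<close>, so once the control is switched off these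
  modes decay by themselves at the rate \<open>\<gamma>\<close>. It therefore suffices to steer the first \<open>N\<close> modes
  to rest at time \<open>T\<close> by a control that is \<open>C\<^sup>2\<close> and vanishes after \<open>T\<close>. Such a control serves
  both as the finite-time control \<open>v\<close> (with \<open>w = v' + \<delta> v\<close>) and as the smooth
  exponentially decaying one. Steering to rest means
  \<open>\<integral>\<^sub>0\<^sup>T exp(\<mu> s) b\<^sub>n(s) ds = - (y\<^sub>0, \<phi>\<^sub>n)\<close> for \<open>n \<le> N\<close> and \<open>\<mu> = \<mu>\<^sub>n\<^sup>\<plusminus>\<close>.

  These moment conditions are solvable for two reasons. The equation for \<open>\<mu>\<^sub>n\<^sup>\<plusminus>\<close> determines
  \<open>\<lambda>\<^sub>n\<close> from either root, and the two roots of one eigenvalue differ; hence the exponentials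
  for all distinct roots are linearly independent and there is a function whose moment is \<open>1\<close> at
  the roots of one prescribed eigenvalue and \<open>0\<close> at all others (\<open>real_exponential_moments\<close>).
  Moreover, the rows of the transformation matrix \<open>R\<close> are left eigenvectors of \<open>P\<^sub>2\<^sub>N\<close>, so they
  only mix modes with the same eigenvalue, and the rank condition forces the rows of \<open>C\<^sub>N\<^sub>M\<close>
  that belong to one eigenvalue to be linearly independent (\<open>eigenspace_rows_independent\<close>); thus
  the input can address these modes separately. \<open>null_control_functions\<close> combines both. As
  \<open>\<mu>\<^sub>n\<^sup>+ \<noteq> \<mu>\<^sub>n\<^sup>-\<close>, the matrix \<open>P\<^sub>2\<^sub>N\<close> is diagonalizable, so the eigenvalues are semisimple
  and the controls act through \<open>\<Phi>\<^sub>i = \<phi>\<^sub>i\<^sup>* = \<phi>\<^sub>i\<close>.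

  All data of the modes are real, so the control functions can be taken real and the solution lives
  in the real space \<open>H\<close>; only the exponents \<open>\<mu>\<close> are complex. What remains is to sum the modes. Since
  \<open>|\<mu>\<^sub>n\<^sup>+ - \<mu>\<^sub>n\<^sup>-|\<close> grows like \<open>\<lambda>\<^sub>n\<close>, the numbers \<open>y\<^sub>n\<close> and \<open>\<lambda>\<^sub>n z\<^sub>n\<close>
  are bounded by the square-summable coefficients of the data uniformly in time, and \<open>\<lambda>\<^sub>n y\<^sub>n\<close>
  is so for \<open>t \<ge> \<epsilon> > 0\<close>. Hence the series for \<open>y\<close>, \<open>y'\<close> and \<open>Ay\<close>
  converge (\<open>series_solution\<close>), the memory integral being recovered by the fundamental theorem of
  calculus from \<open>Az\<close>, which is continuous up to \<open>t = 0\<close>. Uniqueness follows from the energy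
  \<open>y\<^sub>n\<^sup>2 + \<lambda>\<^sub>n z\<^sub>n\<^sup>2\<close> of a single mode.
\<close>

section \<open>Expansions in an orthonormal basis and diagonal operators\<close>

locale orthonormal_basis =
  fixes e :: "nat \<Rightarrow> 'h::{real_inner, complete_space}"
  assumes orthonormal: "inner (e i) (e j) = (if i = j then 1 else 0)"
    and total: "closure (Real_Vector_Spaces.span (range e)) = UNIV"
begin

lemma inner_finite_sum:
  assumes "finite I"
  shows "inner (\<Sum>i\<in>I. a i *\<^sub>R e i) (e j) = (if j \<in> I then a j else 0)"
  using assms by (simp add: inner_sum_left orthonormal if_distrib sum.delta cong: if_cong)

lemma norm_finite_sum:
  assumes "finite I"
  shows "(norm (\<Sum>i\<in>I. a i *\<^sub>R e i))\<^sup>2 = (\<Sum>i\<in>I. (a i)\<^sup>2)"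
proof -
  have "(norm (\<Sum>i\<in>I. a i *\<^sub>R e i))\<^sup>2
      = (\<Sum>j\<in>I. a j * inner (\<Sum>i\<in>I. a i *\<^sub>R e i) (e j))"
    unfolding power2_norm_eq_inner
    using inner_sum_right[of "\<Sum>i\<in>I. a i *\<^sub>R e i" "\<lambda>i. a i *\<^sub>R e i" I]
    by (simp only: inner_scaleR_right)
  also have "\<dots> = (\<Sum>j\<in>I. (a j)\<^sup>2)"
    by (rule sum.cong) (auto simp: inner_finite_sum[OF assms] power2_eq_square)
  finally show ?thesis .
qed

lemma bessel_finite: "(\<Sum>n<k. (inner x (e n))\<^sup>2) \<le> (norm x)\<^sup>2"
proof -
  define s where "s = (\<Sum>n<k. inner x (e n) *\<^sub>R e n)"
  have s: "(norm s)\<^sup>2 = (\<Sum>n<k. (inner x (e n))\<^sup>2)"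
    unfolding s_def by (rule norm_finite_sum) simp
  have xs: "inner x s = (\<Sum>n<k. (inner x (e n))\<^sup>2)"
    unfolding s_def by (simp add: inner_sum_right power2_eq_square)
  have "0 \<le> (norm (x - s))\<^sup>2" by simp
  also have "\<dots> = (norm x)\<^sup>2 - 2 * inner x s + (norm s)\<^sup>2"
    by (simp add: power2_norm_eq_inner inner_diff_left inner_diff_right inner_commute)
  finally show ?thesis using s xs by simp
qed

lemma bessel_summable: "summable (\<lambda>n. (inner x (e n))\<^sup>2)"
  by (rule summableI_nonneg_bounded[where x = "(norm x)\<^sup>2"]) (auto simp: bessel_finite)

lemma bessel: "(\<Sum>n. (inner x (e n))\<^sup>2) \<le> (norm x)\<^sup>2"
  by (rule suminf_le_const[OF bessel_summable]) (rule bessel_finite)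

text \<open>
  A square-summable bound on the coefficients controls all tails at once, by Pythagoras. This is
  the source of every exchange of a limit with an expansion below.
\<close>

lemma series_uniformly_Cauchy:
  assumes g: "summable (\<lambda>n. (g n)\<^sup>2)"
    and a: "\<And>n t. t \<in> S \<Longrightarrow> \<bar>a n t\<bar> \<le> g n"
  shows "uniformly_Cauchy_on S (\<lambda>k t. \<Sum>n<k. a n t *\<^sub>R e n)"
proof (rule uniformly_Cauchy_onI')
  fix \<epsilon> :: real assume \<epsilon>: "\<epsilon> > 0"
  obtain M where M: "\<And>m n. m \<ge> M \<Longrightarrow> norm (\<Sum>i=m..<n. (g i)\<^sup>2) < \<epsilon>\<^sup>2"
    using g \<epsilon> unfolding summable_Cauchy by (metis zero_less_power)
  have "dist (\<Sum>i<m. a i t *\<^sub>R e i) (\<Sum>i<n. a i t *\<^sub>R e i) < \<epsilon>"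
    if t: "t \<in> S" and mn: "m \<ge> M" "n > m" for t m n
  proof -
    have split: "{..<n} = {..<m} \<union> {m..<n}" using mn by auto
    have "dist (\<Sum>i<m. a i t *\<^sub>R e i) (\<Sum>i<n. a i t *\<^sub>R e i)
        = norm (\<Sum>i=m..<n. a i t *\<^sub>R e i)"
      unfolding dist_norm split
      by (subst sum.union_disjoint) auto
    moreover have "(norm (\<Sum>i=m..<n. a i t *\<^sub>R e i))\<^sup>2 = (\<Sum>i=m..<n. (a i t)\<^sup>2)"
      by (rule norm_finite_sum) simp
    moreover have "(\<Sum>i=m..<n. (a i t)\<^sup>2) \<le> (\<Sum>i=m..<n. (g i)\<^sup>2)"
    proof (rule sum_mono)
      fix i
      show "(a i t)\<^sup>2 \<le> (g i)\<^sup>2" using a[OF t, of i] by (simp add: abs_le_square_iff[symmetric])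
    qed
    moreover have "(\<Sum>i=m..<n. (g i)\<^sup>2) < \<epsilon>\<^sup>2" using M[OF mn(1), of n] by auto
    ultimately show ?thesis using \<epsilon> by (simp add: power2_less_imp_less)
  qed
  then show "\<exists>M. \<forall>x\<in>S. \<forall>m\<ge>M. \<forall>n>m.
      dist (\<Sum>i<m. a i x *\<^sub>R e i) (\<Sum>i<n. a i x *\<^sub>R e i) < \<epsilon>" by blast
qed

lemma series_uniform_limit:
  assumes g: "summable (\<lambda>n. (g n)\<^sup>2)"
    and a: "\<And>n t. t \<in> S \<Longrightarrow> \<bar>a n t\<bar> \<le> g n"
  shows "uniform_limit S (\<lambda>k t. \<Sum>n<k. a n t *\<^sub>R e n) (\<lambda>t. \<Sum>n. a n t *\<^sub>R e n) sequentially"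
  using Cauchy_uniformly_convergent[OF series_uniformly_Cauchy[where g = g and S = S and a = a, OF g a]]
  unfolding uniformly_convergent_uniform_limit_iff suminf_eq_lim by simp

lemma series_summable:
  assumes "summable (\<lambda>n. (a n)\<^sup>2)"
  shows "summable (\<lambda>n. a n *\<^sub>R e n)"
proof -
  have "summable (\<lambda>n. \<bar>a n\<bar>\<^sup>2)" using assms by simp
  from series_uniform_limit[OF this, of UNIV "\<lambda>n _. a n"]
  have "(\<lambda>k. \<Sum>n<k. a n *\<^sub>R e n) \<longlonglongrightarrow> (\<Sum>n. a n *\<^sub>R e n)"
    by (auto dest: tendsto_uniform_limitI)
  then show ?thesis by (auto simp: summable_def sums_def)
qed

lemma series_inner:
  assumes "summable (\<lambda>n. (a n)\<^sup>2)"
  shows "inner (\<Sum>n. a n *\<^sub>R e n) (e j) = a j"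
proof -
  have "(\<lambda>n. inner (a n *\<^sub>R e n) (e j)) sums inner (\<Sum>n. a n *\<^sub>R e n) (e j)"
    by (rule bounded_linear.sums[OF bounded_linear_inner_left summable_sums[OF series_summable[OF assms]]])
  moreover have "(\<lambda>n. inner (a n *\<^sub>R e n) (e j)) sums a j"
    using sums_single[of j a] by (simp add: orthonormal if_distrib eq_commute cong: if_cong)
  ultimately show ?thesis by (rule sums_unique2)
qed

lemma series_norm:
  assumes "summable (\<lambda>n. (a n)\<^sup>2)"
  shows "(norm (\<Sum>n. a n *\<^sub>R e n))\<^sup>2 = (\<Sum>n. (a n)\<^sup>2)"
proof -
  have "(\<lambda>k. (norm (\<Sum>n<k. a n *\<^sub>R e n))\<^sup>2) \<longlonglongrightarrow> (norm (\<Sum>n. a n *\<^sub>R e n))\<^sup>2"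
    using summable_sums[OF series_summable[OF assms]] unfolding sums_def
    by (intro tendsto_power tendsto_norm)
  moreover have "(\<lambda>k. (norm (\<Sum>n<k. a n *\<^sub>R e n))\<^sup>2) \<longlonglongrightarrow> (\<Sum>n. (a n)\<^sup>2)"
    using summable_sums[OF assms] unfolding sums_def by (simp add: norm_finite_sum)
  ultimately show ?thesis by (rule LIMSEQ_unique)
qed

text \<open>
  The closed hyperplane orthogonal to \<open>w\<close> contains the basis, hence everything.
\<close>

lemma orthogonal_to_basis_zero:
  assumes "\<And>n. inner w (e n) = 0"
  shows "w = 0"
proof -
  have "Real_Vector_Spaces.span (range e) \<subseteq> {y. inner w y = 0}"
    by (rule span_minimal) (use assms in \<open>auto intro: subspace_hyperplane\<close>)
  then have "closure (Real_Vector_Spaces.span (range e)) \<subseteq> {y. inner w y = 0}"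
    by (rule closure_minimal) (rule closed_hyperplane)
  then have "w \<in> {y. inner w y = 0}" unfolding total by blast
  then show ?thesis by simp
qed

lemma expansion: "(\<Sum>n. inner x (e n) *\<^sub>R e n) = x"
proof -
  have "(\<Sum>n. inner x (e n) *\<^sub>R e n) - x = 0"
    by (rule orthogonal_to_basis_zero) (simp add: inner_diff_left series_inner[OF bessel_summable])
  then show ?thesis by simp
qed

lemma series_of_coefficients:
  assumes "\<And>n. inner x (e n) = a n"
  shows "(\<Sum>n. a n *\<^sub>R e n) = x"
  using expansion[of x] unfolding assms .

lemma dominated_summable:
  assumes g: "summable (\<lambda>n. (g n)\<^sup>2)" and a: "\<And>n. \<bar>a n\<bar> \<le> g n"
  shows "summable (\<lambda>n. (a n :: real)\<^sup>2)"
  by (rule summable_comparison_test'[OF g, of 0])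
    (simp add: abs_le_square_iff[symmetric] order_trans[OF a abs_ge_self])

lemma series_continuous:
  assumes g: "summable (\<lambda>n. (g n)\<^sup>2)"
    and a: "\<And>n t. t \<in> S \<Longrightarrow> \<bar>a n t\<bar> \<le> g n"
    and c: "\<And>n. continuous_on S (a n)"
  shows "continuous_on S (\<lambda>t. \<Sum>n. a n t *\<^sub>R e n)"
proof (rule uniform_limit_theorem)
  show "uniform_limit S (\<lambda>k t. \<Sum>n<k. a n t *\<^sub>R e n) (\<lambda>t. \<Sum>n. a n t *\<^sub>R e n) sequentially"
    by (rule series_uniform_limit[OF g a])
  show "\<forall>\<^sub>F k in sequentially. continuous_on S (\<lambda>t. \<Sum>n<k. a n t *\<^sub>R e n)"
    by (intro always_eventually allI continuous_on_sum continuous_on_scaleR continuous_on_const c)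
qed simp

text \<open>
  By the mean value theorem the difference quotients of the coefficients obey the same bound as
  their derivatives, so they can be summed to a function that is continuous in \<open>s\<close>; its value at
  \<open>t\<close> is the derivative.
\<close>

lemma series_vector_derivative:
  fixes S :: "real set"
  assumes S: "convex S" "t \<in> S"
    and g: "summable (\<lambda>n. (g n)\<^sup>2)" and a: "\<And>n t. t \<in> S \<Longrightarrow> \<bar>a n t\<bar> \<le> g n"
    and g': "summable (\<lambda>n. (g' n)\<^sup>2)" and a': "\<And>n t. t \<in> S \<Longrightarrow> \<bar>a' n t\<bar> \<le> g' n"
    and deriv: "\<And>n t. t \<in> S \<Longrightarrow> (a n has_real_derivative a' n t) (at t within S)"
  shows "((\<lambda>t. \<Sum>n. a n t *\<^sub>R e n) has_vector_derivative (\<Sum>n. a' n t *\<^sub>R e n)) (at t within S)"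
proof -
  define r where "r n s = (if s = t then a' n t else (a n s - a n t) / (s - t))" for n s
  have a_summable: "summable (\<lambda>n. a n s *\<^sub>R e n)" if "s \<in> S" for s
    by (rule series_summable[OF dominated_summable[OF g a[OF that]]])
  have r_bound: "\<bar>r n s\<bar> \<le> g' n" if s: "s \<in> S" for n s
  proof (cases "s = t")
    case False
    have "\<bar>a n s - a n t\<bar> \<le> g' n * \<bar>s - t\<bar>"
      using field_differentiable_bound[OF S(1) deriv _ s S(2), of n "g' n"] a' by simp
    then show ?thesis using False by (simp add: r_def abs_divide divide_le_eq)
  qed (use a'[OF S(2)] in \<open>simp add: r_def\<close>)
  have r_cont: "continuous_on S (r n)" for n
    unfolding continuous_on_def
  proof
    fix s assume s: "s \<in> S"
    have q: "((\<lambda>u. (a n u - a n t) / (u - t)) \<longlongrightarrow> a' n t) (at t within S)"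
      using deriv[OF S(2), of n] by (simp add: has_field_derivative_iff)
    show "(r n \<longlongrightarrow> r n s) (at s within S)"
    proof (cases "s = t")
      case True
      have "((\<lambda>u. r n u) \<longlongrightarrow> a' n t) (at t within S)"
        by (rule Lim_transform_eventually[OF q]) (auto simp: r_def eventually_at_filter)
      then show ?thesis using True by (simp add: r_def[abs_def])
    next
      case False
      have "(a n \<longlongrightarrow> a n s) (at s within S)"
        using deriv[OF s, of n] DERIV_continuous continuous_within by blast
      then have "((\<lambda>u. (a n u - a n t) / (u - t)) \<longlongrightarrow> (a n s - a n t) / (s - t)) (at s within S)"
        using False by (intro tendsto_intros) auto
      moreover have "\<forall>\<^sub>F u in at s within S. (a n u - a n t) / (u - t) = r n u"
        using tendsto_imp_eventually_ne[OF tendsto_ident_at False[simplified]]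
        by (rule eventually_mono) (simp add: r_def)
      ultimately have "(r n \<longlongrightarrow> (a n s - a n t) / (s - t)) (at s within S)"
        by (rule Lim_transform_eventually)
      then show ?thesis using False by (simp add: r_def)
    qed
  qed
  define Q where "Q s = (\<Sum>n. r n s *\<^sub>R e n)" for s
  have "continuous_on S Q" unfolding Q_def by (rule series_continuous[OF g' r_bound r_cont])
  then have Q_cont: "\<exists>d>0. \<forall>s\<in>S. dist s t < d \<longrightarrow> dist (Q s) (Q t) < \<epsilon>" if "\<epsilon> > 0" for \<epsilon>
    using S(2) that unfolding continuous_on_iff by blast
  have Q: "(\<Sum>n. a n s *\<^sub>R e n) - (\<Sum>n. a n t *\<^sub>R e n) = (s - t) *\<^sub>R Q s" if s: "s \<in> S" for s
  proof -
    have "summable (\<lambda>n. r n s *\<^sub>R e n)"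
      by (rule series_summable[OF dominated_summable[OF g' r_bound[OF s]]])
    then have "(s - t) *\<^sub>R Q s = (\<Sum>n. (s - t) *\<^sub>R (r n s *\<^sub>R e n))"
      unfolding Q_def by (rule bounded_linear.suminf[OF bounded_linear_scaleR_right])
    also have "\<dots> = (\<Sum>n. a n s *\<^sub>R e n - a n t *\<^sub>R e n)"
      by (rule suminf_cong) (auto simp: r_def scaleR_diff_left[symmetric])
    finally show ?thesis by (simp add: suminf_diff[OF a_summable[OF s] a_summable[OF S(2)]])
  qed
  have Qt: "Q t = (\<Sum>n. a' n t *\<^sub>R e n)" by (simp add: Q_def r_def)
  show ?thesis
    unfolding has_vector_derivative_def has_derivative_within_alt Qt[symmetric]
  proof (intro conjI allI impI)
    show "bounded_linear (\<lambda>h. h *\<^sub>R Q t)" by (rule bounded_linear_scaleR_left)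
    fix \<epsilon> :: real assume "\<epsilon> > 0"
    then obtain d where d: "d > 0" "\<And>s. s \<in> S \<Longrightarrow> dist s t < d \<Longrightarrow> dist (Q s) (Q t) < \<epsilon>"
      using Q_cont by blast
    have "norm ((\<Sum>n. a n s *\<^sub>R e n) - (\<Sum>n. a n t *\<^sub>R e n) - (s - t) *\<^sub>R Q t) \<le> \<epsilon> * norm (s - t)"
      if "s \<in> S" "norm (s - t) < d" for s
    proof -
      have "norm ((s - t) *\<^sub>R Q s - (s - t) *\<^sub>R Q t) = norm (s - t) * norm (Q s - Q t)"
        unfolding scaleR_diff_right[symmetric] by simp
      also have "\<dots> \<le> norm (s - t) * \<epsilon>"
        using d(2)[OF that(1)] that(2) by (intro mult_left_mono) (auto simp: dist_norm less_imp_le)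
      finally show ?thesis unfolding Q[OF that(1)] by (simp add: mult.commute)
    qed
    with d(1) show "\<exists>d>0. \<forall>s\<in>S. norm (s - t) < d \<longrightarrow>
        norm ((\<Sum>n. a n s *\<^sub>R e n) - (\<Sum>n. a n t *\<^sub>R e n) - (s - t) *\<^sub>R Q t) \<le> \<epsilon> * norm (s - t)"
      by blast
  qed
qed

end

text \<open>
  The operator of the control system in terms of its eigenbasis, numbered from 0.
\<close>

locale diagonal_operator = orthonormal_basis e
  for e :: "nat \<Rightarrow> 'h::{real_inner, complete_space}" +
  fixes D :: "'h set" and A :: "'h \<Rightarrow> 'h" and L :: "nat \<Rightarrow> real"
  assumes lin: "linear_operator_on D A"
    and closed_graph: "closed_operator D A"
    and self_adjoint: "self_adjoint_operator D A"
    and eigen: "e n \<in> D" "A (e n) = L n *\<^sub>R e n"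
    and L_pos: "L n > 0"
begin

lemma zero_in_domain: "0 \<in> D" "A 0 = 0"
proof -
  show "0 \<in> D" using lin unfolding linear_operator_on_def by (auto intro: subspace_0)
  then have "A (0 *\<^sub>R 0) = 0 *\<^sub>R A 0" using lin unfolding linear_operator_on_def by blast
  then show "A 0 = 0" by simp
qed

lemma domain_finite_sum:
  "(\<Sum>n<k. a n *\<^sub>R e n) \<in> D" "A (\<Sum>n<k. a n *\<^sub>R e n) = (\<Sum>n<k. (L n * a n) *\<^sub>R e n)"
proof -
  have "(\<Sum>n<k. a n *\<^sub>R e n) \<in> D \<and> A (\<Sum>n<k. a n *\<^sub>R e n) = (\<Sum>n<k. (L n * a n) *\<^sub>R e n)"
  proof (induction k)
    case 0
    show ?case using zero_in_domain by simp
  next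
    case (Suc k)
    have s: "Real_Vector_Spaces.subspace D" using lin by (simp add: linear_operator_on_def)
    have "a k *\<^sub>R e k \<in> D" by (rule subspace_scale[OF s eigen(1)])
    moreover have "A (a k *\<^sub>R e k) = (L k * a k) *\<^sub>R e k"
      using lin eigen[of k] by (simp add: linear_operator_on_def mult.commute)
    ultimately show ?case
      using lin Suc subspace_add[OF s] by (simp add: linear_operator_on_def)
  qed
  then show "(\<Sum>n<k. a n *\<^sub>R e n) \<in> D"
    "A (\<Sum>n<k. a n *\<^sub>R e n) = (\<Sum>n<k. (L n * a n) *\<^sub>R e n)" by auto
qed

text \<open>
  The graph of the operator is closed and contains the partial sums.
\<close>

lemma domain_series:
  assumes a: "summable (\<lambda>n. (a n)\<^sup>2)" and La: "summable (\<lambda>n. (L n * a n)\<^sup>2)"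
  shows "(\<Sum>n. a n *\<^sub>R e n) \<in> D" "A (\<Sum>n. a n *\<^sub>R e n) = (\<Sum>n. (L n * a n) *\<^sub>R e n)"
proof -
  have "(\<lambda>k. (\<Sum>n<k. a n *\<^sub>R e n, \<Sum>n<k. (L n * a n) *\<^sub>R e n))
      \<longlonglongrightarrow> (\<Sum>n. a n *\<^sub>R e n, \<Sum>n. (L n * a n) *\<^sub>R e n)"
    using summable_sums[OF series_summable[OF a]] summable_sums[OF series_summable[OF La]]
    unfolding sums_def by (rule tendsto_Pair)
  moreover have "(\<Sum>n<k. a n *\<^sub>R e n, \<Sum>n<k. (L n * a n) *\<^sub>R e n) \<in> {(x, A x) | x. x \<in> D}" for k
    using domain_finite_sum[where a = a and k = k] by auto
  ultimately have "(\<Sum>n. a n *\<^sub>R e n, \<Sum>n. (L n * a n) *\<^sub>R e n) \<in> {(x, A x) | x. x \<in> D}"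
    using closed_sequentially[OF closed_graph[unfolded closed_operator_def],
        of "\<lambda>k. (\<Sum>n<k. a n *\<^sub>R e n, \<Sum>n<k. (L n * a n) *\<^sub>R e n)"] by (simp only:)
  then show "(\<Sum>n. a n *\<^sub>R e n) \<in> D" "A (\<Sum>n. a n *\<^sub>R e n) = (\<Sum>n. (L n * a n) *\<^sub>R e n)" by auto
qed

lemma inner_operator:
  assumes "x \<in> D"
  shows "inner (A x) (e n) = L n * inner x (e n)"
  using self_adjoint[unfolded self_adjoint_operator_def, rule_format, of "e n" "A (e n)"] eigen[of n] assms
  by simp

end

section \<open>The roots of the characteristic equation of a mode\<close>

lemma mu_sum: "mu_plus \<delta> x + mu_minus \<delta> x = complex_of_real (x + \<delta>)"
  by (simp add: mu_plus_def mu_minus_def field_simps)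

lemma mu_diff: "mu_plus \<delta> x - mu_minus \<delta> x = csqrt (complex_of_real ((x - \<delta>)\<^sup>2 - 4 * x))"
  by (simp add: mu_plus_def mu_minus_def field_simps)

lemma mu_prod: "mu_plus \<delta> x * mu_minus \<delta> x = complex_of_real (x * (1 + \<delta>))"
proof -
  have *: "4 * (mu_plus \<delta> x * mu_minus \<delta> x)
     = (complex_of_real (x + \<delta>))\<^sup>2 - (csqrt (complex_of_real ((x - \<delta>)\<^sup>2 - 4 * x)))\<^sup>2"
    unfolding mu_plus_def mu_minus_def by (simp add: field_simps power2_eq_square)
  have "\<dots> = complex_of_real ((x + \<delta>)\<^sup>2 - ((x - \<delta>)\<^sup>2 - 4 * x))" by simp
  also have "(x + \<delta>)\<^sup>2 - ((x - \<delta>)\<^sup>2 - 4 * x) = 4 * (x * (1 + \<delta>))"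
    by (simp add: power2_eq_square algebra_simps)
  finally show ?thesis using * by simp
qed

lemma mu_distinct:
  assumes "x > 0" "\<delta> \<noteq> x + 2 * sqrt x" "\<delta> \<noteq> x - 2 * sqrt x"
  shows "mu_plus \<delta> x \<noteq> mu_minus \<delta> x"
proof
  assume "mu_plus \<delta> x = mu_minus \<delta> x"
  then have "csqrt (complex_of_real ((x - \<delta>)\<^sup>2 - 4 * x)) = 0" using mu_diff[of \<delta> x] by simp
  then have "complex_of_real ((x - \<delta>)\<^sup>2 - 4 * x) = 0" by (simp only: csqrt_eq_0)
  then have "(x - \<delta>)\<^sup>2 - 4 * x = 0" by (simp only: of_real_eq_0_iff)
  then have "(x - \<delta>)\<^sup>2 = (2 * sqrt x)\<^sup>2" using assms(1) by (simp add: power_mult_distrib)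
  then have "x - \<delta> = 2 * sqrt x \<or> x - \<delta> = - (2 * sqrt x)" by (simp only: power2_eq_iff)
  then show False using assms by auto
qed

lemma mu_root:
  assumes "\<mu> = mu_plus \<delta> x \<or> \<mu> = mu_minus \<delta> x"
  shows "\<mu>\<^sup>2 + complex_of_real (x * (1 + \<delta>)) = complex_of_real (x + \<delta>) * \<mu>"
  using assms unfolding mu_sum[symmetric] mu_prod[symmetric]
  by (auto simp: algebra_simps power2_eq_square)

lemma root_is_mu:
  assumes "\<mu>\<^sup>2 + complex_of_real (x * (1 + \<delta>)) = complex_of_real (x + \<delta>) * \<mu>"
  shows "\<mu> = mu_plus \<delta> x \<or> \<mu> = mu_minus \<delta> x"
proof -
  have "(\<mu> - mu_plus \<delta> x) * (\<mu> - mu_minus \<delta> x) = 0"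
    using assms unfolding mu_sum[symmetric] mu_prod[symmetric]
    by (simp add: algebra_simps power2_eq_square)
  then show ?thesis by simp
qed

text \<open>
  The roots of a mode form a conjugation-invariant set, which allows real control functions.
\<close>

lemma cnj_mu:
  assumes "\<mu> = mu_plus \<delta> x \<or> \<mu> = mu_minus \<delta> x"
  shows "cnj \<mu> = mu_plus \<delta> x \<or> cnj \<mu> = mu_minus \<delta> x"
proof (rule root_is_mu)
  have "cnj (\<mu>\<^sup>2 + complex_of_real (x * (1 + \<delta>))) = cnj (complex_of_real (x + \<delta>) * \<mu>)"
    using mu_root[OF assms] by simp
  then show "(cnj \<mu>)\<^sup>2 + complex_of_real (x * (1 + \<delta>)) = complex_of_real (x + \<delta>) * cnj \<mu>"
    by simp
qed

text \<open>
  The equation for the roots can be solved for \<open>x\<close>: it reads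
  \<open>\<mu>\<^sup>2 - \<delta>\<mu> = x (\<mu> - (1+\<delta>))\<close>, and \<open>\<mu> = 1 + \<delta>\<close> would make its left-hand side
  equal to \<open>1 + \<delta> \<noteq> 0\<close>. So modes with different eigenvalues share no exponent.
\<close>

lemma mu_determines_eigenvalue:
  assumes "\<delta> > 0" "\<mu> = mu_plus \<delta> x \<or> \<mu> = mu_minus \<delta> x" "\<mu> = mu_plus \<delta> x' \<or> \<mu> = mu_minus \<delta> x'"
  shows "x = x'"
proof -
  have r: "\<mu>\<^sup>2 + complex_of_real (x * (1 + \<delta>)) = complex_of_real (x + \<delta>) * \<mu>"
     "\<mu>\<^sup>2 + complex_of_real (x' * (1 + \<delta>)) = complex_of_real (x' + \<delta>) * \<mu>"
    using mu_root assms by blast+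
  have "complex_of_real (x - x') * (\<mu> - complex_of_real (1 + \<delta>))
      = (complex_of_real (x + \<delta>) * \<mu> - complex_of_real (x * (1 + \<delta>)))
      - (complex_of_real (x' + \<delta>) * \<mu> - complex_of_real (x' * (1 + \<delta>)))"
    by (simp add: algebra_simps)
  also have "\<dots> = 0" unfolding r[symmetric] by simp
  finally have "complex_of_real (x - x') * (\<mu> - complex_of_real (1 + \<delta>)) = 0" .
  moreover have "\<mu> \<noteq> complex_of_real (1 + \<delta>)"
  proof
    assume "\<mu> = complex_of_real (1 + \<delta>)"
    then have "complex_of_real ((1 + \<delta>)\<^sup>2 + x * (1 + \<delta>)) = complex_of_real ((x + \<delta>) * (1 + \<delta>))"
      using r(1) by simp
    then have "(1 + \<delta>)\<^sup>2 + x * (1 + \<delta>) = (x + \<delta>) * (1 + \<delta>)" by (simp only: of_real_eq_iff)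
    then show False using assms(1) by (simp add: algebra_simps power2_eq_square)
  qed
  ultimately show ?thesis by simp
qed

lemma Re_mu_plus_ge: "Re (mu_plus \<delta> x) \<ge> (x + \<delta>) / 2"
  unfolding mu_plus_def using Re_csqrt[of "complex_of_real ((x - \<delta>)\<^sup>2 - 4 * x)"] by simp

lemma mu_minus_eq:
  assumes "\<delta> > 0" "x > 0"
  shows "mu_plus \<delta> x \<noteq> 0" "mu_minus \<delta> x = complex_of_real (x * (1 + \<delta>)) / mu_plus \<delta> x"
proof -
  show "mu_plus \<delta> x \<noteq> 0" using Re_mu_plus_ge[of x \<delta>] assms by auto
  then show "mu_minus \<delta> x = complex_of_real (x * (1 + \<delta>)) / mu_plus \<delta> x"
    using mu_prod[of \<delta> x] by (simp add: field_simps)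
qed

lemma Re_mu_minus_pos:
  assumes "\<delta> > 0" "x > 0"
  shows "Re (mu_minus \<delta> x) > 0"
proof -
  have "Re (mu_plus \<delta> x) > 0" using Re_mu_plus_ge[of x \<delta>] assms by simp
  moreover have "(Re (mu_plus \<delta> x))\<^sup>2 + (Im (mu_plus \<delta> x))\<^sup>2 > 0"
    using calculation by (intro add_pos_nonneg) auto
  ultimately show ?thesis unfolding mu_minus_eq(2)[OF assms] using assms
    by (simp add: Re_divide)
qed

lemma cmod_mu_minus_le:
  assumes "\<delta> > 0" "x > 0"
  shows "cmod (mu_minus \<delta> x) \<le> 2 * (1 + \<delta>)"
proof -
  have p: "cmod (mu_plus \<delta> x) \<ge> x / 2"
    using Re_mu_plus_ge[of x \<delta>] complex_Re_le_cmod[of "mu_plus \<delta> x"] assms by simp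
  have "cmod (mu_plus \<delta> x) * cmod (mu_minus \<delta> x) = x * (1 + \<delta>)"
    unfolding norm_mult[symmetric] mu_prod norm_of_real using assms by simp
  moreover have "x / 2 * cmod (mu_minus \<delta> x) \<le> cmod (mu_plus \<delta> x) * cmod (mu_minus \<delta> x)"
    using p by (rule mult_right_mono) simp
  ultimately have "x * cmod (mu_minus \<delta> x) \<le> x * (2 * (1 + \<delta>))" by (simp add: algebra_simps)
  then show ?thesis using assms(2) by (simp only: mult_le_cancel_left_pos)
qed

text \<open>
  Linear growth of the gap between the two roots, for all but finitely many modes. The threshold is
  chosen to make \<open>3/4 x \<ge> 2\<delta> + 4\<close>.
\<close>

lemma large_discriminant:
  fixes x \<delta> :: real
  assumes "\<delta> > 0" "x \<ge> 4 * \<delta> + 8"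
  shows "(x - \<delta>)\<^sup>2 - 4 * x \<ge> (x / 2)\<^sup>2"
proof -
  have "(x - \<delta>)\<^sup>2 - 4 * x - (x / 2)\<^sup>2 = x * (3 / 4 * x - 2 * \<delta> - 4) + \<delta>\<^sup>2"
    by (simp add: power2_eq_square algebra_simps)
  moreover have "x * (3 / 4 * x - 2 * \<delta> - 4) \<ge> 0" using assms by (intro mult_nonneg_nonneg) auto
  ultimately show ?thesis by (metis add_nonneg_nonneg diff_ge_0_iff_ge zero_le_power2)
qed

lemma cmod_mu_diff_ge:
  assumes "\<delta> > 0" "x \<ge> 4 * \<delta> + 8"
  shows "cmod (mu_plus \<delta> x - mu_minus \<delta> x) \<ge> x / 2"
proof -
  have "(x / 2)\<^sup>2 \<le> (cmod (mu_plus \<delta> x - mu_minus \<delta> x))\<^sup>2"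
    unfolding mu_diff norm_power[symmetric] power2_csqrt norm_of_real
    using large_discriminant[OF assms] by linarith
  then show ?thesis by (rule power2_le_imp_le) simp
qed

text \<open>
  For large eigenvalues the root \<open>\<mu>\<^sup>-\<close> is real and approaches \<open>1 + \<delta>\<close> from above.
\<close>

lemma Re_mu_minus_ge:
  assumes "\<delta> > 0" "x \<ge> 4 * \<delta> + 8"
  shows "Re (mu_minus \<delta> x) \<ge> 1 + \<delta>"
proof -
  let ?d = "(x - \<delta>)\<^sup>2 - 4 * x"
  have d: "?d \<ge> 0" using large_discriminant[OF assms] by (meson order_trans zero_le_power2)
  have "?d \<le> (x - \<delta> - 2)\<^sup>2" using assms by (simp add: power2_eq_square algebra_simps)
  then have "sqrt ?d \<le> x - \<delta> - 2" using assms by (intro real_le_lsqrt) auto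
  moreover have "csqrt (complex_of_real ?d) = complex_of_real (sqrt ?d)"
    using csqrt_of_real_nonneg[of "complex_of_real ?d"] d by simp
  ultimately show ?thesis unfolding mu_minus_def by simp
qed

section \<open>A single mode\<close>

text \<open>
  The solution of \<open>\<xi>' = -\<mu> \<xi> + b\<close>, \<open>\<xi>(0) = a\<close>.
\<close>

definition duhamel :: "complex \<Rightarrow> real \<Rightarrow> (real \<Rightarrow> real) \<Rightarrow> real \<Rightarrow> complex" where
  "duhamel \<mu> a b t = exp (- (\<mu> * of_real t)) *
     (of_real a + integral {0..t} (\<lambda>s. exp (\<mu> * of_real s) * of_real (b s)))"

lemma duhamel_0 [simp]: "duhamel \<mu> a b 0 = of_real a"
  by (simp add: duhamel_def)

lemma duhamel_integrand_continuous:
  assumes "continuous_on S b"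
  shows "continuous_on S (\<lambda>s. exp (\<mu> * complex_of_real s) * of_real (b s))"
  using assms by (intro continuous_intros)

lemma duhamel_deriv:
  assumes b: "continuous_on {0..} b" and t: "t \<ge> 0"
  shows "(duhamel \<mu> a b has_vector_derivative (- \<mu> * duhamel \<mu> a b t + of_real (b t))) (at t within {0..})"
proof -
  let ?f = "\<lambda>s. exp (\<mu> * complex_of_real s) * of_real (b s)"
  have "((\<lambda>u. integral {0..u} ?f) has_vector_derivative ?f t) (at t within {0..t + 1})"
    using t by (intro integral_has_vector_derivative duhamel_integrand_continuous
        continuous_on_subset[OF b]) auto
  also have "at t within {0..t + 1} = at t within {0..}"
    by (rule at_within_nhd[of _ "{..<t + 1}"]) auto
  finally have I: "((\<lambda>u. integral {0..u} ?f) has_vector_derivative ?f t) (at t within {0..})" .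
  have E: "((\<lambda>u. exp (- (\<mu> * complex_of_real u))) has_vector_derivative
      - \<mu> * exp (- (\<mu> * complex_of_real t))) (at t within {0..})"
    by (rule has_vector_derivative_real_field) (auto intro!: derivative_eq_intros)
  have "((\<lambda>u. exp (- (\<mu> * of_real u)) * (of_real a + integral {0..u} ?f)) has_vector_derivative
      (exp (- (\<mu> * of_real t)) * (0 + ?f t) +
       (- \<mu> * exp (- (\<mu> * of_real t))) * (of_real a + integral {0..t} ?f))) (at t within {0..})"
    by (intro has_vector_derivative_mult E has_vector_derivative_add has_vector_derivative_const I)
  moreover have "exp (- (\<mu> * of_real t)) * (0 + ?f t) = of_real (b t)"
    by (simp add: exp_minus field_simps)
  moreover have "(- \<mu> * exp (- (\<mu> * of_real t))) * (of_real a + integral {0..t} ?f) = - \<mu> * duhamel \<mu> a b t"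
    by (simp add: duhamel_def)
  ultimately show ?thesis unfolding duhamel_def[abs_def] by (simp only: add.commute)
qed

lemma duhamel_alt:
  "duhamel \<mu> a b t = exp (- (\<mu> * of_real t)) * of_real a
     + integral {0..t} (\<lambda>s. exp (- (\<mu> * of_real (t - s))) * of_real (b s))"
proof -
  have "exp (- (\<mu> * of_real t)) * integral {0..t} (\<lambda>s. exp (\<mu> * of_real s) * of_real (b s))
      = integral {0..t} (\<lambda>s. exp (- (\<mu> * of_real t)) * (exp (\<mu> * of_real s) * of_real (b s)))"
    by (rule integral_mult_right[symmetric])
  also have "\<dots> = integral {0..t} (\<lambda>s. exp (- (\<mu> * of_real (t - s))) * of_real (b s))"
  proof (rule integral_cong)
    fix s
    have "exp (- (\<mu> * of_real t)) * exp (\<mu> * of_real s) = exp (- (\<mu> * complex_of_real (t - s)))"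
      unfolding exp_add[symmetric] by (simp add: right_diff_distrib)
    then show "exp (- (\<mu> * of_real t)) * (exp (\<mu> * of_real s) * of_real (b s))
        = exp (- (\<mu> * complex_of_real (t - s))) * of_real (b s)"
      by (simp only: mult.assoc[symmetric])
  qed
  finally show ?thesis unfolding duhamel_def by (simp add: distrib_left)
qed

text \<open>
  Used for \<open>\<mu> = \<mu>\<^sub>n\<^sup>+\<close>, whose real part is at least \<open>\<lambda>\<^sub>n/2\<close>: multiplication by
  \<open>\<lambda>\<^sub>n\<close> then costs nothing on the forcing term.
\<close>

lemma duhamel_bound_parabolic:
  assumes b: "continuous_on {0..} b" and t: "t \<ge> 0" and r: "0 < r" "r \<le> Re \<mu>"
    and \<beta>: "\<And>s. s \<ge> 0 \<Longrightarrow> \<bar>b s\<bar> \<le> \<beta>"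
  shows "cmod (duhamel \<mu> a b t) \<le> exp (- (r * t)) * \<bar>a\<bar> + \<beta> / r"
proof -
  have \<beta>0: "\<beta> \<ge> 0" using \<beta>[of 0] by simp
  have I: "((\<lambda>s. exp (- (r * (t - s))) * \<beta>) has_integral
      (exp (- (r * (t - t))) * \<beta> / r - exp (- (r * (t - 0))) * \<beta> / r)) {0..t}"
    by (rule fundamental_theorem_of_calculus[OF t])
      (use r in \<open>auto intro!: derivative_eq_intros
        simp: has_real_derivative_iff_has_vector_derivative[symmetric]\<close>)
  have "norm (integral {0..t} (\<lambda>s. exp (- (\<mu> * of_real (t - s))) * of_real (b s)))
     \<le> integral {0..t} (\<lambda>s. exp (- (r * (t - s))) * \<beta>)"
  proof (rule integral_norm_bound_integral)
    show "(\<lambda>s. exp (- (\<mu> * of_real (t - s))) * of_real (b s)) integrable_on {0..t}"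
      by (intro integrable_continuous_real continuous_intros continuous_on_subset[OF b]) auto
    show "(\<lambda>s. exp (- (r * (t - s))) * \<beta>) integrable_on {0..t}" using I by blast
    fix s assume s: "s \<in> {0..t}"
    have "r * (t - s) \<le> Re \<mu> * (t - s)" using r s by (intro mult_right_mono) auto
    then show "norm (exp (- (\<mu> * of_real (t - s))) * of_real (b s)) \<le> exp (- (r * (t - s))) * \<beta>"
      unfolding norm_mult norm_exp_eq_Re norm_of_real using s by (intro mult_mono \<beta>) auto
  qed
  also have "\<dots> \<le> \<beta> / r" using integral_unique[OF I] r \<beta>0 by simp
  finally have 1: "norm (integral {0..t} (\<lambda>s. exp (- (\<mu> * of_real (t - s))) * of_real (b s))) \<le> \<beta> / r" .
  have "r * t \<le> Re \<mu> * t" using r t by (intro mult_right_mono) auto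
  then have 2: "norm (exp (- (\<mu> * of_real t)) * complex_of_real a) \<le> exp (- (r * t)) * \<bar>a\<bar>"
    unfolding norm_mult norm_exp_eq_Re norm_of_real by (intro mult_right_mono) auto
  show ?thesis unfolding duhamel_alt by (rule norm_triangle_le) (use 1 2 in linarith)
qed

text \<open>
  Once the forcing has stopped, the solution decays at any rate up to \<open>Re \<mu>\<close>; what the forcing has
  contributed before is paid for by the factor \<open>exp(c T)\<close>. With \<open>c = 0\<close> this is the bound on the
  modes that need not decay by themselves.
\<close>

lemma duhamel_bound_decay:
  assumes b: "continuous_on {0..} b" and t: "t \<ge> 0" and c: "0 \<le> c" "c \<le> Re \<mu>"
    and \<beta>: "\<And>s. s \<ge> 0 \<Longrightarrow> \<bar>b s\<bar> \<le> \<beta>" and T: "T \<ge> 0" "\<And>s. s \<ge> T \<Longrightarrow> b s = 0"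
  shows "cmod (duhamel \<mu> a b t) \<le> exp (- (c * t)) * (\<bar>a\<bar> + exp (c * T) * T * \<beta>)"
proof -
  have \<beta>0: "\<beta> \<ge> 0" using \<beta>[of 0] by simp
  let ?F = "\<lambda>s. exp (- (\<mu> * of_real (t - s))) * complex_of_real (b s)"
  have int: "?F integrable_on {0..u}" for u
    by (intro integrable_continuous_real continuous_intros continuous_on_subset[OF b]) auto
  \<comment> \<open>The forcing acts only up to time \<open>u\<close>.\<close>
  define u where "u = min t T"
  have u: "0 \<le> u" "u \<le> t" "u \<le> T" using t T by (auto simp: u_def)
  have "integral {u..t} ?F = 0"
  proof (cases "t \<le> T")
    case False
    then have "integral {u..t} ?F = integral {u..t} (\<lambda>s. 0)"
      by (intro integral_cong) (use T in \<open>auto simp: u_def\<close>)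
    then show ?thesis by simp
  qed (simp add: u_def)
  then have "integral {0..t} ?F = integral {0..u} ?F"
    using Henstock_Kurzweil_Integration.integral_combine[OF u(1,2) int] by simp
  also have "norm \<dots> \<le> integral {0..u} (\<lambda>s. exp (- (c * t)) * exp (c * T) * \<beta>)"
  proof (rule integral_norm_bound_integral[OF int])
    fix s assume s: "s \<in> {0..u}"
    have "c * (t - s) \<le> Re \<mu> * (t - s)" using c s u by (intro mult_right_mono) auto
    moreover have "c * s \<le> c * T" using c s u by (intro mult_left_mono) auto
    ultimately have "exp (- (Re \<mu> * (t - s))) \<le> exp (- (c * t)) * exp (c * T)"
      unfolding exp_add[symmetric] by (simp add: algebra_simps)
    then show "norm (?F s) \<le> exp (- (c * t)) * exp (c * T) * \<beta>"
      unfolding norm_mult norm_exp_eq_Re norm_of_real using s by (intro mult_mono \<beta>) auto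
  qed auto
  also have "\<dots> \<le> exp (- (c * t)) * exp (c * T) * \<beta> * T"
    using mult_left_mono[OF u(3), of "exp (- (c * t)) * exp (c * T) * \<beta>"] u \<beta>0
    by (simp add: mult.commute mult.left_commute)
  finally have 1: "norm (integral {0..t} ?F) \<le> exp (- (c * t)) * exp (c * T) * \<beta> * T" .
  have "c * t \<le> Re \<mu> * t" using c t by (intro mult_right_mono) auto
  then have 2: "norm (exp (- (\<mu> * of_real t)) * complex_of_real a) \<le> exp (- (c * t)) * \<bar>a\<bar>"
    unfolding norm_mult norm_exp_eq_Re norm_of_real by (intro mult_right_mono) auto
  show ?thesis unfolding duhamel_alt
    by (rule norm_triangle_le) (use 1 2 in \<open>simp add: algebra_simps\<close>)
qed

text \<open>
  The moment condition says that the solution vanishes at time \<open>T\<close>, and afterwards it is not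
  forced any more.
\<close>

lemma duhamel_null:
  assumes b: "continuous_on {0..} b" and T: "0 \<le> T" "T \<le> t" "\<And>s. s \<ge> T \<Longrightarrow> b s = 0"
    and moment: "integral {0..T} (\<lambda>s. exp (\<mu> * of_real s) * of_real (b s)) = - complex_of_real a"
  shows "duhamel \<mu> a b t = 0"
proof -
  let ?F = "\<lambda>s. exp (\<mu> * of_real s) * complex_of_real (b s)"
  have int: "?F integrable_on {0..t}"
    by (intro integrable_continuous_real duhamel_integrand_continuous continuous_on_subset[OF b]) auto
  have "integral {T..t} ?F = integral {T..t} (\<lambda>s. 0)"
    by (rule integral_cong) (use T in auto)
  then have "integral {0..t} ?F = - complex_of_real a"
    using Henstock_Kurzweil_Integration.integral_combine[OF T(1,2) int] moment by simp
  then show ?thesis by (simp add: duhamel_def)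
qed

text \<open>
  Inverting \<open>\<xi>\<^sub>\<plusminus> = y + (x - \<mu>\<^sup>\<plusminus>) z\<close> gives
  \<open>z = (\<xi>\<^sub>- - \<xi>\<^sub>+)/(\<mu>\<^sup>+ - \<mu>\<^sup>-)\<close> and
  \<open>y = ((x - \<mu>\<^sup>-)\<xi>\<^sub>+ - (x - \<mu>\<^sup>+)\<xi>\<^sub>-)/(\<mu>\<^sup>+ - \<mu>\<^sup>-)\<close>, where \<open>x - \<mu>\<^sup>+ = \<mu>\<^sup>- - \<delta>\<close>.
  The real part is a solution as well because the system has real coefficients and data.
\<close>

definition mode_y :: "real \<Rightarrow> real \<Rightarrow> real \<Rightarrow> (real \<Rightarrow> real) \<Rightarrow> real \<Rightarrow> real" where
  "mode_y \<delta> x a b t = Re (((of_real x - mu_minus \<delta> x) * duhamel (mu_plus \<delta> x) a b t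
      + (of_real \<delta> - mu_minus \<delta> x) * duhamel (mu_minus \<delta> x) a b t) / (mu_plus \<delta> x - mu_minus \<delta> x))"

definition mode_z :: "real \<Rightarrow> real \<Rightarrow> real \<Rightarrow> (real \<Rightarrow> real) \<Rightarrow> real \<Rightarrow> real" where
  "mode_z \<delta> x a b t = Re ((duhamel (mu_minus \<delta> x) a b t - duhamel (mu_plus \<delta> x) a b t)
      / (mu_plus \<delta> x - mu_minus \<delta> x))"

lemma mode_initial:
  assumes "mu_plus \<delta> x \<noteq> mu_minus \<delta> x"
  shows "mode_y \<delta> x a b 0 = a" "mode_z \<delta> x a b 0 = 0"
proof -
  let ?p = "mu_plus \<delta> x" and ?m = "mu_minus \<delta> x"
  have "(of_real x - ?m) * of_real a + (of_real \<delta> - ?m) * of_real a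
      = (complex_of_real (x + \<delta>) - 2 * ?m) * of_real a" by (simp add: algebra_simps)
  also have "\<dots> = (?p - ?m) * complex_of_real a" unfolding mu_sum[symmetric] by (simp add: algebra_simps)
  finally have "(of_real x - ?m) * of_real a + (of_real \<delta> - ?m) * of_real a = (?p - ?m) * complex_of_real a" .
  then show "mode_y \<delta> x a b 0 = a" unfolding mode_y_def using assms by simp
  show "mode_z \<delta> x a b 0 = 0" by (simp add: mode_z_def)
qed

lemma mode_deriv:
  assumes ne: "mu_plus \<delta> x \<noteq> mu_minus \<delta> x" and b: "continuous_on {0..} b" and t: "t \<ge> 0"
  shows "(mode_y \<delta> x a b has_real_derivative (b t - x * (mode_y \<delta> x a b t + mode_z \<delta> x a b t)))
           (at t within {0..})"
    and "(mode_z \<delta> x a b has_real_derivative (mode_y \<delta> x a b t - \<delta> * mode_z \<delta> x a b t))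
           (at t within {0..})"
proof -
  define p m where pm: "p = mu_plus \<delta> x" "m = mu_minus \<delta> x"
  define P Q where PQ: "P = duhamel p a b" "Q = duhamel m a b"
  have ne': "p - m \<noteq> 0" using ne pm by simp
  have sum: "p = of_real x + of_real \<delta> - m" using mu_sum[of \<delta> x] pm by (simp add: algebra_simps)
  have prod: "p * m = of_real x + of_real x * of_real \<delta>"
    using mu_prod[of \<delta> x] pm by (simp add: algebra_simps)
  have dP: "(P has_vector_derivative (- p * P t + of_real (b t))) (at t within {0..})"
    and dQ: "(Q has_vector_derivative (- m * Q t + of_real (b t))) (at t within {0..})"
    unfolding PQ by (rule duhamel_deriv[OF b t])+
  let ?Y = "((of_real x - m) * P t + (of_real \<delta> - m) * Q t) / (p - m)"
  let ?Z = "(Q t - P t) / (p - m)"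
  have dY: "((\<lambda>u. ((of_real x - m) * P u + (of_real \<delta> - m) * Q u) / (p - m)) has_vector_derivative
      (((of_real x - m) * (- p * P t + of_real (b t)) + (of_real \<delta> - m) * (- m * Q t + of_real (b t))) / (p - m)))
      (at t within {0..})"
    by (intro has_vector_derivative_divide has_vector_derivative_add has_vector_derivative_mult_right dP dQ)
  have dZ: "((\<lambda>u. (Q u - P u) / (p - m)) has_vector_derivative
      (((- m * Q t + of_real (b t)) - (- p * P t + of_real (b t))) / (p - m))) (at t within {0..})"
    by (intro has_vector_derivative_divide has_vector_derivative_diff dP dQ)
  have eY: "((of_real x - m) * (- p * P t + of_real (b t)) + (of_real \<delta> - m) * (- m * Q t + of_real (b t))) / (p - m)
      = of_real (b t) - of_real x * (?Y + ?Z)"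
  proof -
    have "(of_real x - m) * (- p * P t + of_real (b t)) + (of_real \<delta> - m) * (- m * Q t + of_real (b t))
       - (of_real (b t) * (p - m) - of_real x * (((of_real x - m) * P t + (of_real \<delta> - m) * Q t) + (Q t - P t)))
       = (P t - Q t) * (p * m - (of_real x + of_real x * of_real \<delta>))"
      unfolding sum by (simp add: algebra_simps)
    then have "(of_real x - m) * (- p * P t + of_real (b t)) + (of_real \<delta> - m) * (- m * Q t + of_real (b t))
       = of_real (b t) * (p - m) - of_real x * (((of_real x - m) * P t + (of_real \<delta> - m) * Q t) + (Q t - P t))"
      unfolding prod by simp
    then show ?thesis using ne' by (simp add: divide_simps)
  qed
  have eZ: "((- m * Q t + of_real (b t)) - (- p * P t + of_real (b t))) / (p - m) = ?Y - of_real \<delta> * ?Z"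
  proof -
    have "(- m * Q t + of_real (b t)) - (- p * P t + of_real (b t))
       = ((of_real x - m) * P t + (of_real \<delta> - m) * Q t) - of_real \<delta> * (Q t - P t)"
      unfolding sum by (simp add: algebra_simps)
    then show ?thesis using ne' by (simp add: divide_simps)
  qed
  have y: "mode_y \<delta> x a b = (\<lambda>u. Re (((of_real x - m) * P u + (of_real \<delta> - m) * Q u) / (p - m)))"
    and z: "mode_z \<delta> x a b = (\<lambda>u. Re ((Q u - P u) / (p - m)))"
    unfolding pm PQ by (simp_all add: mode_y_def[abs_def] mode_z_def[abs_def])
  have "(mode_y \<delta> x a b has_vector_derivative Re (of_real (b t) - of_real x * (?Y + ?Z))) (at t within {0..})"
    unfolding y by (rule bounded_linear.has_vector_derivative[OF bounded_linear_Re dY[unfolded eY]])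
  moreover have "Re (of_real (b t) - of_real x * (?Y + ?Z)) = b t - x * (Re ?Y + Re ?Z)"
    by (simp del: times_divide_eq_right)
  ultimately have "(mode_y \<delta> x a b has_vector_derivative b t - x * (Re ?Y + Re ?Z)) (at t within {0..})"
    by (simp only:)
  then show "(mode_y \<delta> x a b has_real_derivative (b t - x * (mode_y \<delta> x a b t + mode_z \<delta> x a b t)))
           (at t within {0..})"
    unfolding has_real_derivative_iff_has_vector_derivative by (simp add: y z)
  have "(mode_z \<delta> x a b has_vector_derivative Re (?Y - of_real \<delta> * ?Z)) (at t within {0..})"
    unfolding z by (rule bounded_linear.has_vector_derivative[OF bounded_linear_Re dZ[unfolded eZ]])
  moreover have "Re (?Y - of_real \<delta> * ?Z) = Re ?Y - \<delta> * Re ?Z"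
    by (simp del: times_divide_eq_right)
  ultimately have "(mode_z \<delta> x a b has_vector_derivative Re ?Y - \<delta> * Re ?Z) (at t within {0..})"
    by (simp only:)
  then show "(mode_z \<delta> x a b has_real_derivative (mode_y \<delta> x a b t - \<delta> * mode_z \<delta> x a b t))
           (at t within {0..})"
    unfolding has_real_derivative_iff_has_vector_derivative by (simp add: y z)
qed

section \<open>Moment problems for exponentials\<close>

text \<open>
  A square linear system over an arbitrary finite index set, transported to matrices.
\<close>

lemma injective_system_solvable:
  fixes G :: "'i \<Rightarrow> 'i \<Rightarrow> complex"
  assumes I: "finite I"
    and inj: "\<And>c i. (\<And>a. a \<in> I \<Longrightarrow> (\<Sum>b\<in>I. G a b * c b) = 0) \<Longrightarrow> i \<in> I \<Longrightarrow> c i = 0"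
  shows "\<exists>c. \<forall>a\<in>I. (\<Sum>b\<in>I. G a b * c b) = d a"
proof -
  obtain f where f: "bij_betw f {0..<card I} I" using ex_bij_betw_nat_finite[OF I] by blast
  define n where "n = card I"
  define g where "g = inv_into {0..<n} f"
  have gf: "g (f i) = i" if "i < n" for i
    unfolding g_def using f that by (intro inv_into_f_f) (auto simp: bij_betw_def n_def)
  have fI: "f i \<in> I" if "i < n" for i using f that by (auto simp: bij_betw_def n_def)
  have ex: "\<exists>i<n. a = f i" if "a \<in> I" for a using f that by (fastforce simp: bij_betw_def n_def)
  have sum_f: "(\<Sum>b\<in>I. h b) = (\<Sum>j=0..<n. h (f j))" for h :: "'i \<Rightarrow> complex"
    unfolding n_def by (rule sum.reindex_bij_betw[OF f, symmetric])
  define X where "X = Matrix.mat n n (\<lambda>(i, j). G (f i) (f j))"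
  have X: "X \<in> carrier_mat n n" by (simp add: X_def)
  have Xv: "(X *\<^sub>v v) $ i = (\<Sum>j=0..<n. G (f i) (f j) * v $ j)"
    if "i < n" "v \<in> carrier_vec n" for i v
    using that by (simp add: X_def scalar_prod_def)
  have "Determinant.det X \<noteq> 0"
  proof
    assume "Determinant.det X = 0"
    then obtain v where v: "v \<in> carrier_vec n" "v \<noteq> 0\<^sub>v n" "X *\<^sub>v v = 0\<^sub>v n"
      using det_0_iff_vec_prod_zero[OF X] by blast
    have "v $ i = 0" if "i < n" for i
    proof -
      have "(\<lambda>b. v $ g b) (f i) = 0"
      proof (rule inj)
        fix a assume "a \<in> I"
        then obtain k where k: "k < n" "a = f k" using ex by blast
        have "(X *\<^sub>v v) $ k = 0" using v k by simp
        then show "(\<Sum>b\<in>I. G a b * v $ g b) = 0"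
          unfolding sum_f Xv[OF k(1) v(1)] by (simp add: k gf)
      qed (rule fI[OF that])
      then show ?thesis using gf[OF that] by simp
    qed
    then show False using v by auto
  qed
  then have "X \<in> Units (ring_mat TYPE(complex) n ())" by (rule det_non_zero_imp_unit[OF X])
  then obtain Y where Y: "Y \<in> carrier_mat n n" "X * Y = 1\<^sub>m n"
    unfolding Units_def ring_mat_def by auto
  define v where "v = Y *\<^sub>v Matrix.vec n (\<lambda>i. d (f i))"
  have v: "v \<in> carrier_vec n" using Y by (simp add: v_def)
  have "X *\<^sub>v v = Matrix.vec n (\<lambda>i. d (f i))"
    unfolding v_def using assoc_mult_mat_vec[OF X Y(1), symmetric] Y(2) by simp
  then have "(\<Sum>j=0..<n. G (f i) (f j) * v $ j) = d (f i)" if "i < n" for i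
    using Xv[OF that v] that by simp
  then have "\<forall>a\<in>I. (\<Sum>b\<in>I. G a b * v $ g b) = d a"
    unfolding sum_f using ex gf by force
  then show ?thesis by (rule exI[where x = "\<lambda>b. v $ g b"])
qed

text \<open>
  Differentiating a vanishing combination multiplies each coefficient by its exponent, so every
  polynomial in the exponents may be inserted; one that vanishes at all exponents but \<open>\<nu>\<close>
  isolates the coefficient of \<open>\<nu>\<close>.
\<close>

lemma exponentials_independent:
  assumes S: "finite S" and ab: "a < b"
    and zero: "\<And>s. a < s \<Longrightarrow> s < b \<Longrightarrow> (\<Sum>\<mu>\<in>S. c \<mu> * exp (\<mu> * complex_of_real s)) = 0"
    and \<nu>: "\<nu> \<in> S"
  shows "c \<nu> = 0"
proof -
  have *: "(\<Sum>\<mu>\<in>S. c \<mu> * poly p \<mu> * exp (\<mu> * complex_of_real s)) = 0" if "a < s" "s < b" for p s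
    using that
  proof (induction p arbitrary: s)
    case 0
    show ?case by simp
  next
    case (pCons k p)
    let ?F = "\<lambda>s. \<Sum>\<mu>\<in>S. c \<mu> * poly p \<mu> * exp (\<mu> * complex_of_real s)"
    let ?F' = "\<Sum>\<mu>\<in>S. c \<mu> * poly p \<mu> * (\<mu> * exp (\<mu> * complex_of_real s))"
    have "((\<lambda>z. \<Sum>\<mu>\<in>S. c \<mu> * poly p \<mu> * exp (\<mu> * z)) has_field_derivative ?F') (at (complex_of_real s))"
      by (auto intro!: derivative_eq_intros sum.cong)
    then have "(?F has_vector_derivative ?F') (at s)"
      by (rule has_vector_derivative_real_field)
    then have "((\<lambda>_. 0) has_vector_derivative ?F') (at s)"
      by (rule has_vector_derivative_transform_within_open[where S = "{a<..<b}"])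
        (use pCons in auto)
    then have "?F' = 0" using vector_derivative_unique_at has_vector_derivative_const by blast
    moreover have "(\<Sum>\<mu>\<in>S. c \<mu> * poly (pCons k p) \<mu> * exp (\<mu> * complex_of_real s))
        = k * (\<Sum>\<mu>\<in>S. c \<mu> * exp (\<mu> * complex_of_real s)) + ?F'"
    proof -
      have "c \<mu> * poly (pCons k p) \<mu> * exp (\<mu> * complex_of_real s)
          = k * (c \<mu> * exp (\<mu> * complex_of_real s)) + c \<mu> * poly p \<mu> * (\<mu> * exp (\<mu> * complex_of_real s))" for \<mu>
        by (simp add: algebra_simps)
      then show ?thesis by (simp only: sum.distrib sum_distrib_left)
    qed
    ultimately show ?case using zero pCons.prems by simp
  qed
  define p where "p = (\<Prod>\<mu>\<in>S - {\<nu>}. [:- \<mu>, 1:])"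
  have p: "poly p \<nu> \<noteq> 0" "\<And>\<mu>. \<mu> \<in> S - {\<nu>} \<Longrightarrow> poly p \<mu> = 0"
    using S by (auto simp: p_def poly_prod)
  let ?s = "(a + b) / 2"
  have "(\<Sum>\<mu>\<in>S. c \<mu> * poly p \<mu> * exp (\<mu> * complex_of_real ?s))
      = c \<nu> * poly p \<nu> * exp (\<nu> * complex_of_real ?s)"
    using S \<nu> p(2) by (subst sum.remove[of _ \<nu>]) auto
  then have "c \<nu> * poly p \<nu> * exp (\<nu> * complex_of_real ?s) = 0"
    using *[of ?s p] ab by simp
  then show ?thesis using p(1) by simp
qed

text \<open>
  The ansatz leads to the Gram matrix of the exponentials for the weight \<open>\<eta>\<close>, which is
  injective: a vector in its kernel gives a combination of exponentials whose weighted square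
  integral vanishes. The weight makes it possible to prescribe how the solution vanishes at \<open>T\<close>.
\<close>

lemma exponential_moments:
  fixes \<eta> :: "real \<Rightarrow> real"
  assumes S: "finite S" and T: "T > 0"
    and \<eta>: "continuous_on {0..T} \<eta>" "\<And>s. 0 \<le> s \<Longrightarrow> s \<le> T \<Longrightarrow> \<eta> s \<ge> 0" "\<And>s. 0 < s \<Longrightarrow> s < T \<Longrightarrow> \<eta> s > 0"
  shows "\<exists>c. \<forall>\<mu>\<in>S. integral {0..T} (\<lambda>s. exp (\<mu> * of_real s) *
      (of_real (\<eta> s) * (\<Sum>\<nu>\<in>S. c \<nu> * exp (cnj \<nu> * of_real s)))) = d \<mu>"
proof -
  define G where "G \<mu> \<nu> = integral {0..T} (\<lambda>s. exp (\<mu> * of_real s) *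
      (of_real (\<eta> s) * exp (cnj \<nu> * of_real s)))" for \<mu> \<nu>
  have int: "(\<lambda>s. exp (\<mu> * of_real s) * (of_real (\<eta> s) * exp (cnj \<nu> * of_real s))) integrable_on {0..T}" for \<mu> \<nu>
    by (intro integrable_continuous_real continuous_intros \<eta>)
  have sum_G: "integral {0..T} (\<lambda>s. exp (\<mu> * of_real s) *
      (of_real (\<eta> s) * (\<Sum>\<nu>\<in>S. c \<nu> * exp (cnj \<nu> * of_real s)))) = (\<Sum>\<nu>\<in>S. G \<mu> \<nu> * c \<nu>)" for \<mu> c
  proof -
    have "integral {0..T} (\<lambda>s. exp (\<mu> * of_real s) *
      (of_real (\<eta> s) * (\<Sum>\<nu>\<in>S. c \<nu> * exp (cnj \<nu> * of_real s))))
      = integral {0..T} (\<lambda>s. \<Sum>\<nu>\<in>S. exp (\<mu> * of_real s) * (of_real (\<eta> s) * exp (cnj \<nu> * of_real s)) * c \<nu>)"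
      by (rule integral_cong) (simp add: sum_distrib_left algebra_simps)
    also have "\<dots> = (\<Sum>\<nu>\<in>S. integral {0..T} (\<lambda>s. exp (\<mu> * of_real s) *
        (of_real (\<eta> s) * exp (cnj \<nu> * of_real s)) * c \<nu>))"
      by (rule integral_sum[OF S]) (intro integrable_on_mult_left int)
    also have "\<dots> = (\<Sum>\<nu>\<in>S. G \<mu> \<nu> * c \<nu>)" unfolding G_def by simp
    finally show ?thesis .
  qed
  have "\<exists>c. \<forall>\<mu>\<in>S. (\<Sum>\<nu>\<in>S. G \<mu> \<nu> * c \<nu>) = d \<mu>"
  proof (rule injective_system_solvable[OF S])
    fix c \<nu>0
    assume z: "\<And>\<mu>. \<mu> \<in> S \<Longrightarrow> (\<Sum>\<nu>\<in>S. G \<mu> \<nu> * c \<nu>) = 0" and \<nu>0: "\<nu>0 \<in> S"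
    define F where "F s = (\<Sum>\<nu>\<in>S. c \<nu> * exp (cnj \<nu> * complex_of_real s))" for s
    have F: "continuous_on X F" for X unfolding F_def by (intro continuous_intros)
    have cnjF: "cnj (F s) = (\<Sum>\<mu>\<in>S. cnj (c \<mu>) * exp (\<mu> * complex_of_real s))" for s
      unfolding F_def by (simp add: exp_cnj)
    \<comment> \<open>Multiplying the system by the conjugate coefficients turns it into the weighted square integral of \<open>F\<close>.\<close>
    have "0 = (\<Sum>\<mu>\<in>S. cnj (c \<mu>) * integral {0..T} (\<lambda>s. exp (\<mu> * of_real s) * (of_real (\<eta> s) * F s)))"
      using z unfolding F_def sum_G by simp
    also have "\<dots> = (\<Sum>\<mu>\<in>S. integral {0..T} (\<lambda>s. cnj (c \<mu>) * (exp (\<mu> * of_real s) * (of_real (\<eta> s) * F s))))"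
      by simp
    also have "\<dots> = integral {0..T} (\<lambda>s. \<Sum>\<mu>\<in>S. cnj (c \<mu>) * (exp (\<mu> * of_real s) * (of_real (\<eta> s) * F s)))"
      by (rule integral_sum[OF S, symmetric])
        (intro integrable_continuous_real continuous_intros \<eta> F)
    also have "\<dots> = integral {0..T} (\<lambda>s. complex_of_real (\<eta> s * (cmod (F s))\<^sup>2))"
    proof (rule integral_cong)
      fix s
      have "(\<Sum>\<mu>\<in>S. cnj (c \<mu>) * (exp (\<mu> * of_real s) * (of_real (\<eta> s) * F s)))
         = cnj (F s) * (of_real (\<eta> s) * F s)"
        unfolding cnjF sum_distrib_right by (simp add: mult.assoc)
      also have "\<dots> = complex_of_real (\<eta> s * (cmod (F s))\<^sup>2)"
        by (simp add: complex_norm_square[symmetric] mult.commute mult.left_commute flip: of_real_power)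
      finally show "(\<Sum>\<mu>\<in>S. cnj (c \<mu>) * (exp (\<mu> * of_real s) * (of_real (\<eta> s) * F s)))
          = complex_of_real (\<eta> s * (cmod (F s))\<^sup>2)" .
    qed
    also have "\<dots> = complex_of_real (integral {0..T} (\<lambda>s. \<eta> s * (cmod (F s))\<^sup>2))"
      by (rule integral_unique, rule has_integral_of_real, rule integrable_integral)
        (intro integrable_continuous_real continuous_intros \<eta> F)
    finally have I0: "integral {0..T} (\<lambda>s. \<eta> s * (cmod (F s))\<^sup>2) = 0" by simp
    have "(\<lambda>s. \<eta> s * (cmod (F s))\<^sup>2) integrable_on {0..T}"
      by (intro integrable_continuous_real continuous_intros \<eta> F)
    then have HI: "((\<lambda>s. \<eta> s * (cmod (F s))\<^sup>2) has_integral 0) (cbox 0 T)"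
      using I0 by (simp add: has_integral_integral)
    have Fz: "\<eta> s * (cmod (F s))\<^sup>2 = 0" if "0 < s" "s < T" for s
      by (rule has_integral_0_cbox_imp_0[OF _ _ HI])
        (use that T \<eta> in \<open>auto intro!: continuous_intros F mult_nonneg_nonneg simp: box_ne_empty\<close>)
    have "cnj (c \<nu>0) = 0"
    proof (rule exponentials_independent[OF S T _ \<nu>0, where c = "\<lambda>\<nu>. cnj (c \<nu>)"])
      fix s assume s: "0 < s" "s < T"
      then have "F s = 0" using Fz[OF s] \<eta>(3)[OF s] by simp
      then show "(\<Sum>\<mu>\<in>S. cnj (c \<mu>) * exp (\<mu> * complex_of_real s)) = 0" using cnjF[of s] by simp
    qed
    then show "c \<nu>0 = 0" by simp
  qed
  then show ?thesis unfolding sum_G .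
qed

lemma pos_part_power_deriv:
  "((\<lambda>x::real. (max 0 x) ^ Suc (Suc n)) has_real_derivative real (Suc (Suc n)) * (max 0 x) ^ Suc n) (at x)"
proof (cases "x = 0")
  case False
  consider "x > 0" | "x < 0" using False by linarith
  then show ?thesis
  proof cases
    case 1
    have "((\<lambda>x. x ^ Suc (Suc n)) has_real_derivative real (Suc (Suc n)) * x ^ Suc n) (at x)"
      by (rule derivative_eq_intros refl | simp)+
    then have "((\<lambda>x::real. (max 0 x) ^ Suc (Suc n)) has_real_derivative real (Suc (Suc n)) * x ^ Suc n) (at x)"
      by (rule has_field_derivative_transform_within_open[where S = "{0<..}"]) (use 1 in auto)
    then show ?thesis using 1 by simp
  next
    case 2
    have "((\<lambda>x::real. (max 0 x) ^ Suc (Suc n)) has_real_derivative 0) (at x)"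
      by (rule has_field_derivative_transform_within_open[where S = "{..<0}" and f = "\<lambda>_. 0"]) (use 2 in auto)
    then show ?thesis using 2 by simp
  qed
next
  case True
  have "((\<lambda>h::real. (max 0 h) ^ Suc n) \<longlongrightarrow> (max 0 0) ^ Suc n) (at 0)"
    by (intro tendsto_intros)
  moreover have "(max 0 h) ^ Suc (Suc n) / h = (max 0 h) ^ Suc n" for h :: real
    by (cases "h > 0") (auto simp: max_def)
  ultimately show ?thesis unfolding True DERIV_def by simp
qed

text \<open>
  The weight \<open>(max 0 (T - s))\<^sup>3\<close> makes the solution \<open>C\<^sup>2\<close> across \<open>T\<close>. For a conjugation-invariant
  problem the real part of a solution is again one.
\<close>

lemma real_exponential_moments:
  assumes S: "finite S" and T: "T > 0"
    and cnj_S: "\<And>\<mu>. \<mu> \<in> S \<Longrightarrow> cnj \<mu> \<in> S" and cnj_d: "\<And>\<mu>. \<mu> \<in> S \<Longrightarrow> d (cnj \<mu>) = cnj (d \<mu>)"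
  shows "\<exists>h h' h'' :: real \<Rightarrow> real.
     (\<forall>s. (h has_real_derivative h' s) (at s)) \<and> (\<forall>s. (h' has_real_derivative h'' s) (at s)) \<and>
     continuous_on UNIV h'' \<and> (\<forall>s\<ge>T. h s = 0 \<and> h' s = 0 \<and> h'' s = 0) \<and>
     (\<forall>\<mu>\<in>S. integral {0..T} (\<lambda>s. exp (\<mu> * of_real s) * of_real (h s)) = d \<mu>)"
proof -
  define q where "q k s = (max 0 (T - s)) ^ k" for k :: nat and s :: real
  have dq: "(q (Suc (Suc n)) has_real_derivative - (real (Suc (Suc n)) * q (Suc n) s)) (at s)" for n s
  proof -
    have "((\<lambda>s. T - s) has_real_derivative -1) (at s)" by (auto intro!: derivative_eq_intros)
    from DERIV_chain2[OF pos_part_power_deriv this]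
    show ?thesis unfolding q_def[abs_def] by simp
  qed
  have q_cont: "continuous_on X (q k)" for X k unfolding q_def[abs_def] by (intro continuous_intros)
  obtain c where c: "\<And>\<mu>. \<mu> \<in> S \<Longrightarrow> integral {0..T} (\<lambda>s. exp (\<mu> * of_real s) *
      (of_real (q 3 s) * (\<Sum>\<nu>\<in>S. c \<nu> * exp (cnj \<nu> * of_real s)))) = d \<mu>"
    using exponential_moments[OF S T, of "q 3" d] q_cont by (auto simp: q_def)
  define E where "E k s = (\<Sum>\<nu>\<in>S. c \<nu> * cnj \<nu> ^ k * exp (cnj \<nu> * complex_of_real s))" for k :: nat and s
  have E_cont: "continuous_on X (E k)" for X k unfolding E_def[abs_def] by (intro continuous_intros)
  have dE: "((\<lambda>s. Re (E k s)) has_real_derivative Re (E (Suc k) s)) (at s)" for k s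
  proof -
    have "((\<lambda>z. \<Sum>\<nu>\<in>S. c \<nu> * cnj \<nu> ^ k * exp (cnj \<nu> * z)) has_field_derivative E (Suc k) s) (at (complex_of_real s))"
      unfolding E_def by (auto intro!: derivative_eq_intros sum.cong)
    from has_vector_derivative_real_field[OF this]
    have "(E k has_vector_derivative E (Suc k) s) (at s)" unfolding E_def[abs_def] .
    from bounded_linear.has_vector_derivative[OF bounded_linear_Re this]
    show ?thesis unfolding has_real_derivative_iff_has_vector_derivative .
  qed
  define h where "h s = q 3 s * Re (E 0 s)" for s
  define h' where "h' s = q 3 s * Re (E 1 s) - 3 * q 2 s * Re (E 0 s)" for s
  define h'' where "h'' s = q 3 s * Re (E 2 s) - 6 * q 2 s * Re (E 1 s) + 6 * q 1 s * Re (E 0 s)" for s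
  have dq3: "(q 3 has_real_derivative - (3 * q 2 s)) (at s)"
    and dq2: "(q 2 has_real_derivative - (2 * q 1 s)) (at s)" for s
    using dq[of 1 s] dq[of 0 s] by (simp_all add: numeral_2_eq_2 numeral_3_eq_3)
  have dE': "((\<lambda>s. Re (E 0 s)) has_real_derivative Re (E 1 s)) (at s)"
    "((\<lambda>s. Re (E 1 s)) has_real_derivative Re (E 2 s)) (at s)" for s
    using dE[of 0 s] dE[of 1 s] by (simp_all add: numeral_2_eq_2)
  have "(h has_real_derivative h' s) (at s)" for s
    unfolding h_def[abs_def] h'_def
    by (rule DERIV_cong[OF DERIV_mult[OF dq3 dE'(1)]]) (simp add: algebra_simps)
  moreover have "(h' has_real_derivative h'' s) (at s)" for s
    unfolding h'_def[abs_def] h''_def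
    by (rule DERIV_cong[OF DERIV_diff[OF DERIV_mult[OF dq3 dE'(2)]
          DERIV_mult[OF DERIV_cmult[OF dq2] dE'(1)]]]) (simp add: algebra_simps)
  moreover have "continuous_on UNIV h''"
    unfolding h''_def[abs_def] by (intro continuous_intros q_cont E_cont)
  moreover have "h s = 0 \<and> h' s = 0 \<and> h'' s = 0" if "s \<ge> T" for s
    using that by (simp add: h_def h'_def h''_def q_def)
  moreover have "integral {0..T} (\<lambda>s. exp (\<mu> * of_real s) * of_real (h s)) = d \<mu>" if \<mu>: "\<mu> \<in> S" for \<mu>
  proof -
    let ?f = "\<lambda>\<mu> s. exp (\<mu> * of_real s) * (of_real (q 3 s) * E 0 s)"
    have E0: "E 0 s = (\<Sum>\<nu>\<in>S. c \<nu> * exp (cnj \<nu> * of_real s))" for s by (simp add: E_def)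
    have hi: "(?f \<nu> has_integral d \<nu>) {0..T}" if "\<nu> \<in> S" for \<nu>
      unfolding c[OF that, symmetric] E0[symmetric]
      by (intro integrable_integral integrable_continuous_real continuous_intros q_cont E_cont)
    have "((\<lambda>s. cnj (?f (cnj \<mu>) s)) has_integral cnj (d (cnj \<mu>))) {0..T}"
      using has_integral_linear[OF hi[OF cnj_S[OF \<mu>]] bounded_linear_cnj] by (simp add: o_def)
    from has_integral_add[OF hi[OF \<mu>] this]
    have "((\<lambda>s. ?f \<mu> s + cnj (?f (cnj \<mu>) s)) has_integral 2 * d \<mu>) {0..T}"
      using cnj_d[OF \<mu>] by simp
    from has_integral_mult_right[OF this, of "1/2"]
    have *: "((\<lambda>s. 1/2 * (?f \<mu> s + cnj (?f (cnj \<mu>) s))) has_integral d \<mu>) {0..T}" by simp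
    have "1/2 * (?f \<mu> s + cnj (?f (cnj \<mu>) s)) = exp (\<mu> * of_real s) * of_real (h s)" for s
    proof -
      have "cnj (?f (cnj \<mu>) s) = exp (\<mu> * of_real s) * (of_real (q 3 s) * cnj (E 0 s))"
        using exp_cnj[of "cnj \<mu> * complex_of_real s"] by simp
      moreover have "E 0 s + cnj (E 0 s) = 2 * of_real (Re (E 0 s))" by (simp add: complex_add_cnj)
      ultimately have "?f \<mu> s + cnj (?f (cnj \<mu>) s)
          = exp (\<mu> * of_real s) * (of_real (q 3 s) * (2 * of_real (Re (E 0 s))))"
        by (simp only: distrib_left[symmetric])
      then show ?thesis unfolding h_def by simp
    qed
    then show ?thesis using * by (simp add: integral_unique)
  qed
  ultimately show ?thesis by blast
qed

section \<open>The rank condition\<close>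

text \<open>
  A \<open>2\<times>2\<close> block matrix of diagonal blocks is a family of \<open>2\<times>2\<close> matrices, and
  multiplies like one. \<open>P_mat\<close> and \<open>D_mat\<close> are of this form.
\<close>

definition diag_blocks :: "nat \<Rightarrow> (nat \<Rightarrow> complex) \<Rightarrow> (nat \<Rightarrow> complex) \<Rightarrow> (nat \<Rightarrow> complex) \<Rightarrow> (nat \<Rightarrow> complex) \<Rightarrow> complex mat" where
  "diag_blocks n a b c d = four_block_mat (mat_diag n a) (mat_diag n b) (mat_diag n c) (mat_diag n d)"

lemma diag_blocks_carrier [simp]: "diag_blocks n a b c d \<in> carrier_mat (2 * n) (2 * n)"
  unfolding diag_blocks_def mult_2 by (rule four_block_carrier_mat) simp_all

lemma mat_diag_cong: "(\<And>i. i < n \<Longrightarrow> f i = g i) \<Longrightarrow> mat_diag n f = mat_diag n g"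
  unfolding mat_diag_def by (rule eq_matI) auto

lemma mat_diag_add: "mat_diag n f + mat_diag n g = mat_diag n (\<lambda>i. f i + g i :: complex)"
  unfolding mat_diag_def by (rule eq_matI) auto

lemma mat_diag_uminus: "- mat_diag n f = mat_diag n (\<lambda>i. - f i :: complex)"
  unfolding mat_diag_def by (rule eq_matI) auto

lemma mat_diag_zero: "mat_diag n (\<lambda>i. 0 :: complex) = 0\<^sub>m n n"
  unfolding mat_diag_def by (rule eq_matI) auto

lemma diag_blocks_mult:
  "diag_blocks n a b c d * diag_blocks n a' b' c' d'
    = diag_blocks n (\<lambda>i. a i * a' i + b i * c' i) (\<lambda>i. a i * b' i + b i * d' i)
        (\<lambda>i. c i * a' i + d i * c' i) (\<lambda>i. c i * b' i + d i * d' i)"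
  unfolding diag_blocks_def
  by (subst mult_four_block_mat[of _ n n _ n _ n _ _ n _ n]) (simp_all add: mat_diag_add)

lemma diag_blocks_cong:
  assumes "\<And>i. i < n \<Longrightarrow> a i = a' i" "\<And>i. i < n \<Longrightarrow> b i = b' i"
    "\<And>i. i < n \<Longrightarrow> c i = c' i" "\<And>i. i < n \<Longrightarrow> d i = d' i"
  shows "diag_blocks n a b c d = diag_blocks n a' b' c' d'"
  unfolding diag_blocks_def
  using mat_diag_cong[OF assms(1)] mat_diag_cong[OF assms(2)] mat_diag_cong[OF assms(3)]
    mat_diag_cong[OF assms(4)] by simp

lemma diag_blocks_one: "diag_blocks n (\<lambda>_. 1) (\<lambda>_. 0) (\<lambda>_. 0) (\<lambda>_. 1) = 1\<^sub>m (2 * n)"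
  unfolding diag_blocks_def mat_diag_zero mat_diag_one mult_2 by (rule four_block_one_mat)

lemma P_mat_diag_blocks:
  "P_mat \<delta> lam N = diag_blocks N (\<lambda>_. 0) (\<lambda>_. 1)
     (\<lambda>j. - complex_of_real (lam (j + 1) * (1 + \<delta>))) (\<lambda>j. - complex_of_real (lam (j + 1) + \<delta>))"
  unfolding P_mat_def diag_blocks_def mat_diag_zero mat_diag_one mat_diag_uminus ..

lemma D_mat_diag_blocks:
  "D_mat \<delta> lam N = diag_blocks N (\<lambda>j. - mu_plus \<delta> (lam (j + 1))) (\<lambda>_. 0)
     (\<lambda>_. 0) (\<lambda>j. - mu_minus \<delta> (lam (j + 1)))"
  unfolding D_mat_def diag_blocks_def mat_diag_def
  by (rule eq_matI) auto

text \<open>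
  A mode contributes the \<open>2\<times>2\<close> matrix with rows \<open>(0, 1)\<close> and \<open>(-\<mu>\<^sup>+\<mu>\<^sup>-, -\<mu>\<^sup>+ - \<mu>\<^sup>-)\<close>. Its
  left eigenvectors for \<open>-\<mu>\<^sup>+\<close> and \<open>-\<mu>\<^sup>-\<close> are \<open>(\<mu>\<^sup>-, 1)\<close> and \<open>(\<mu>\<^sup>+, 1)\<close>, which are
  independent.
\<close>

lemma P_mat_similar_D_mat:
  assumes ne: "\<And>j. j < N \<Longrightarrow> mu_plus \<delta> (lam (j + 1)) \<noteq> mu_minus \<delta> (lam (j + 1))"
  shows "similar_mat (P_mat \<delta> lam N) (D_mat \<delta> lam N)"
proof -
  define p where "p j = mu_plus \<delta> (lam (j + 1))" for j
  define m where "m j = mu_minus \<delta> (lam (j + 1))" for j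
  have d: "m j \<noteq> p j" if "j < N" for j using ne[OF that] by (simp add: p_def m_def)
  have sum: "complex_of_real (lam (j + 1) + \<delta>) = p j + m j" for j
    unfolding p_def m_def by (rule mu_sum[symmetric])
  have prod: "complex_of_real (lam (j + 1) * (1 + \<delta>)) = p j * m j" for j
    unfolding p_def m_def by (rule mu_prod[symmetric])
  define V where "V = diag_blocks N m (\<lambda>_. 1) p (\<lambda>_. 1)"
  define e where "e j = 1 / (m j - p j)" for j
  have e: "e j * (m j - p j) = 1" if "j < N" for j using d[OF that] by (simp add: e_def)
  define W where "W = diag_blocks N e (\<lambda>j. - e j) (\<lambda>j. - (p j * e j)) (\<lambda>j. m j * e j)"
  have P: "P_mat \<delta> lam N = diag_blocks N (\<lambda>_. 0) (\<lambda>_. 1) (\<lambda>j. - (p j * m j)) (\<lambda>j. - (p j + m j))"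
    unfolding P_mat_diag_blocks sum prod ..
  have D: "D_mat \<delta> lam N = diag_blocks N (\<lambda>j. - p j) (\<lambda>_. 0) (\<lambda>_. 0) (\<lambda>j. - m j)"
    unfolding D_mat_diag_blocks p_def m_def ..
  show ?thesis
  proof (rule similar_matI)
    show "{P_mat \<delta> lam N, D_mat \<delta> lam N, W, V} \<subseteq> carrier_mat (2 * N) (2 * N)"
      unfolding P D V_def W_def by simp
    show "W * V = 1\<^sub>m (2 * N)"
      unfolding V_def W_def diag_blocks_mult diag_blocks_one[symmetric]
      by (rule diag_blocks_cong)
        ((simp add: algebra_simps; fail) | (use e in \<open>simp add: algebra_simps\<close>))+
    show "V * W = 1\<^sub>m (2 * N)"
      unfolding V_def W_def diag_blocks_mult diag_blocks_one[symmetric]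
      by (rule diag_blocks_cong)
        ((simp add: algebra_simps; fail) | (use e in \<open>simp add: algebra_simps\<close>))+
    show "P_mat \<delta> lam N = W * D_mat \<delta> lam N * V"
      unfolding V_def W_def P D diag_blocks_mult
    proof (rule diag_blocks_cong)
      fix i assume i: "i < N"
      show "0 = (e i * - p i + - e i * 0) * m i + (e i * 0 + - e i * - m i) * p i"
        by (simp add: algebra_simps)
      show "1 = (e i * - p i + - e i * 0) * 1 + (e i * 0 + - e i * - m i) * 1"
        using e[OF i] by (simp add: algebra_simps)
      show "- (p i * m i) = (- (p i * e i) * - p i + m i * e i * 0) * m i
          + (- (p i * e i) * 0 + m i * e i * - m i) * p i"
        using arg_cong[OF e[OF i], of "\<lambda>u. u * - (p i * m i)"] by (simp add: algebra_simps)
      show "- (p i + m i) = (- (p i * e i) * - p i + m i * e i * 0) * 1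
          + (- (p i * e i) * 0 + m i * e i * - m i) * 1"
        using arg_cong[OF e[OF i], of "\<lambda>u. u * - (p i + m i)"] by (simp add: algebra_simps)
    qed
  qed
qed

lemma jordan_matrix_singletons:
  "jordan_matrix (map (Pair 1) xs) = mat_diag (length xs) (\<lambda>i. xs ! i :: complex)"
proof (induction xs)
  case Nil
  show ?case by (rule eq_matI) (auto simp: jordan_matrix_def mat_diag_def)
next
  case (Cons x xs)
  have s: "sum_list (map fst (map (Pair (1::nat)) xs)) = length xs" by (induction xs) auto
  show ?case
    unfolding list.map jordan_matrix_Cons s Cons.IH
    by (rule eq_matI) (auto simp: mat_diag_def jordan_block_def nth_Cons')
qed

text \<open>
  A diagonal matrix is a Jordan matrix with blocks of size 1; both multiplicities count the
  diagonal entries equal to \<open>e\<close>.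
\<close>

lemma semisimple_eigenvalue_of_diagonalizable:
  assumes X: "X \<in> carrier_mat n n" and sim: "similar_mat X (mat_diag n f)" and e: "i < n" "e = f i"
  shows "semisimple_eigenvalue X e"
proof -
  define xs where "xs = map f [0..<n]"
  have "mat_diag n f = jordan_matrix (map (Pair 1) xs)"
    unfolding jordan_matrix_singletons xs_def by (simp, rule mat_diag_cong, simp)
  then have jnf: "jordan_nf X (map (Pair 1) xs)"
    using sim by (auto simp: jordan_nf_def)
  have o: "Polynomial.order e (char_poly X) = length (filter (\<lambda>a. a = e) xs)"
    unfolding jordan_nf_order[OF jnf] by (induction xs) auto
  have "dim_gen_eigenspace X e 1 = length (filter (\<lambda>a. a = e) xs)"
    unfolding dim_gen_eigenspace[OF jnf] by (induction xs) auto
  moreover have "dim_gen_eigenspace X e 1 = kernel_dim (char_matrix X e)"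
    using X by (simp add: dim_gen_eigenspace_def char_matrix_def)
  moreover have "e \<in> set xs" using e by (auto simp: xs_def)
  then have "filter (\<lambda>a. a = e) xs \<noteq> []" by (auto simp: filter_empty_conv)
  then have "Polynomial.order e (char_poly X) \<noteq> 0" using o by simp
  then have "eigenvalue X e"
    unfolding eigenvalue_root_char_poly[OF X] using order_root by blast
  ultimately show ?thesis using o by (simp add: semisimple_eigenvalue_def)
qed

lemma semisimple_of_simple_roots:
  assumes ne: "\<And>j. j \<in> {1..N} \<Longrightarrow> mu_plus \<delta> (lam j) \<noteq> mu_minus \<delta> (lam j)"
  shows "semisimple_case \<delta> lam N"
proof -
  let ?f = "\<lambda>i. if i < N then - mu_plus \<delta> (lam (i + 1)) else - mu_minus \<delta> (lam (i - N + 1))"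
  have sim: "similar_mat (P_mat \<delta> lam N) (mat_diag (2 * N) ?f)"
    using P_mat_similar_D_mat[of N \<delta> lam] ne unfolding D_mat_def by simp
  have P: "P_mat \<delta> lam N \<in> carrier_mat (2 * N) (2 * N)" by (simp add: P_mat_diag_blocks)
  show ?thesis unfolding semisimple_case_def
  proof (intro ballI conjI)
    fix j assume j: "j \<in> {1..N}"
    show "semisimple_eigenvalue (P_mat \<delta> lam N) (- mu_plus \<delta> (lam j))"
      by (rule semisimple_eigenvalue_of_diagonalizable[OF P sim, of "j - 1"]) (use j in auto)
    show "semisimple_eigenvalue (P_mat \<delta> lam N) (- mu_minus \<delta> (lam j))"
      by (rule semisimple_eigenvalue_of_diagonalizable[OF P sim, of "N + j - 1"]) (use j in auto)
  qed
qed

text \<open>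
  Independence is a property of the set of columns, so repeated columns are excluded first; they
  would leave fewer than \<open>n\<close> candidates for a basis of the column space.
\<close>

lemma full_column_rank_injective:
  fixes K :: "complex mat"
  assumes K: "K \<in> carrier_mat r n" and rank: "vec_space.rank r K = n"
    and v: "v \<in> carrier_vec n" "K *\<^sub>v v = 0\<^sub>v r"
  shows "v = 0\<^sub>v n"
proof (rule ccontr)
  assume nz: "v \<noteq> 0\<^sub>v n"
  interpret vec_space "TYPE(complex)" r .
  show False
  proof (cases "distinct (cols K)")
    case True
    then show False using lin_depI[OF K v(1) nz v(2)] full_rank_lin_indpt[OF K rank] by blast
  next
    case False
    let ?P = "\<lambda>T. T \<subseteq> set (cols K) \<and> lin_indpt T"
    have "lin_indpt {}" using finite_lin_indpt2[of "{}"] by simp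
    then obtain S where S: "maximal S ?P"
      using maximal_exists_superset[of "set (cols K)" ?P "{}"] by auto
    then have "card S \<le> card (set (cols K))" by (simp add: card_mono maximal_def)
    also have "\<dots> < length (cols K)"
      using False card_distinct[of "cols K"] card_length[of "cols K"] by linarith
    also have "\<dots> = n" using K by simp
    finally show False using rank rank_card_indpt[OF K S] by simp
  qed
qed

lemma pick_atLeastLessThan:
  assumes "i < b - a"
  shows "pick {a..<b} i = a + i"
proof -
  have "{k \<in> {a..<b}. k < a + i} = {a..<a + i}" using assms by auto
  then have "card {k \<in> {a..<b}. k < a + i} = i" by simp
  then show ?thesis using pick_card_in_set[of "a + i" "{a..<b}"] assms by simp
qed

lemma column_block_adjoint:
  assumes X: "X \<in> carrier_mat n k" and ab: "b \<le> n"
  shows "column_block (mat_adjoint X) a b = Matrix.mat k (b - a) (\<lambda>(i, t). cnj (X $$ (a + t, i)))"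
proof -
  have dim: "dim_row (mat_adjoint X) = k" "dim_col (mat_adjoint X) = n"
    using X by (auto simp: mat_adjoint_def)
  have idx: "mat_adjoint X $$ (i, j) = cnj (X $$ (j, i))" if "i < k" "j < n" for i j
    using X that by (simp add: mat_adjoint_def mat_of_rows_def)
  have c1: "{i. i < k \<and> i \<in> UNIV} = {..<k}" and c2: "{j. j < n \<and> j \<in> {a..<b}} = {a..<b}"
    using ab by auto
  show ?thesis
    unfolding column_block_def submatrix_def dim c1 c2
    by (rule eq_matI) (use ab in \<open>auto simp: pick_UNIV pick_atLeastLessThan idx\<close>)
qed


text \<open>
  Since \<open>RP = DR\<close>, the row \<open>q\<close> of \<open>R\<close> is a left eigenvector of \<open>P\<^sub>2\<^sub>N\<close> for \<open>-\<mu>\<^sub>q\<^sup>+\<close>. The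
  entries of \<open>P\<^sub>2\<^sub>N\<close> couple only the components \<open>r\<close> and \<open>N + r\<close>, and a nonzero pair of them
  makes \<open>\<mu>\<^sub>q\<^sup>+\<close> a root for the eigenvalue of mode \<open>r\<close>.
\<close>

lemma left_eigenvector_entries:
  assumes \<delta>: "\<delta> > 0" and sim: "similar_mat_wit (P_mat \<delta> lam N) (D_mat \<delta> lam N) Rinv R"
    and q: "q < N" and r: "r < N" and nz: "R $$ (q, N + r) \<noteq> 0"
  shows "lam (Suc r) = lam (Suc q)"
proof -
  let ?P = "P_mat \<delta> lam N" and ?D = "D_mat \<delta> lam N"
  let ?\<mu> = "mu_plus \<delta> (lam (Suc q))" and ?x = "lam (Suc r)"
  have P: "?P \<in> carrier_mat (2 * N) (2 * N)" and D: "?D \<in> carrier_mat (2 * N) (2 * N)"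
    by (simp_all add: P_mat_diag_blocks D_mat_diag_blocks)
  from sim P have R: "R \<in> carrier_mat (2 * N) (2 * N)" and Ri: "Rinv \<in> carrier_mat (2 * N) (2 * N)"
    and inv: "R * Rinv = 1\<^sub>m (2 * N)" and PRD: "?P = Rinv * ?D * R"
    by (auto simp: similar_mat_wit_def Let_def)
  have "R * ?P = R * (Rinv * (?D * R))"
    using PRD assoc_mult_mat[OF Ri D R] by simp
  also have "\<dots> = (R * Rinv) * (?D * R)"
    by (rule assoc_mult_mat[OF R Ri mult_carrier_mat[OF D R], symmetric])
  also have "\<dots> = ?D * R" using inv D R by simp
  finally have RP: "R * ?P = ?D * R" .
  have Pidx: "?P $$ (k, c) = (if c < N then (if k = N + c then - complex_of_real (lam (Suc c) * (1 + \<delta>)) else 0)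
      else (if k = c - N then 1 else 0) + (if k = c then - complex_of_real (lam (Suc (c - N)) + \<delta>) else 0))"
    if "k < 2 * N" "c < 2 * N" for k c
    using that unfolding P_mat_diag_blocks diag_blocks_def by (auto simp: mat_diag_def)
  have RPidx: "(R * ?P) $$ (q, c) = (\<Sum>k=0..<2 * N. R $$ (q, k) * ?P $$ (k, c))" if "c < 2 * N" for c
    using R P q that by (simp add: scalar_prod_def)
  have DRidx: "(?D * R) $$ (q, c) = - ?\<mu> * R $$ (q, c)" if "c < 2 * N" for c
    using R q that by (simp add: D_mat_def mat_diag_mult_left[of R "2 * N" "2 * N"])
  have "(\<Sum>k=0..<2 * N. R $$ (q, k) * ?P $$ (k, r))
      = (\<Sum>k=0..<2 * N. if k = N + r then R $$ (q, k) * - complex_of_real (?x * (1 + \<delta>)) else 0)"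
    using r by (intro sum.cong) (auto simp: Pidx)
  also have "\<dots> = R $$ (q, N + r) * - complex_of_real (?x * (1 + \<delta>))"
    using r by (subst sum.delta) auto
  finally have 1: "R $$ (q, N + r) * complex_of_real (?x * (1 + \<delta>)) = ?\<mu> * R $$ (q, r)"
    using RPidx[of r] DRidx[of r] RP r by simp
  have "(\<Sum>k=0..<2 * N. R $$ (q, k) * ?P $$ (k, N + r))
      = (\<Sum>k=0..<2 * N. (if k = r then R $$ (q, k) else 0)
          + (if k = N + r then R $$ (q, k) * - complex_of_real (?x + \<delta>) else 0))"
    using r by (intro sum.cong) (auto simp: Pidx)
  also have "\<dots> = R $$ (q, r) + R $$ (q, N + r) * - complex_of_real (?x + \<delta>)"
    using r unfolding sum.distrib by (subst sum.delta, simp)+ simp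
  finally have "(R * ?P) $$ (q, N + r) = R $$ (q, r) + R $$ (q, N + r) * - complex_of_real (?x + \<delta>)"
    using RPidx[of "N + r"] r by simp
  then have "- ?\<mu> * R $$ (q, N + r) = R $$ (q, r) + R $$ (q, N + r) * - complex_of_real (?x + \<delta>)"
    unfolding RP using DRidx[of "N + r"] r by simp
  then have 2: "R $$ (q, r) = R $$ (q, N + r) * (complex_of_real (?x + \<delta>) - ?\<mu>)"
    by (simp add: algebra_simps)
  have "R $$ (q, N + r) * (?\<mu>\<^sup>2 + complex_of_real (?x * (1 + \<delta>)) - complex_of_real (?x + \<delta>) * ?\<mu>) = 0"
    using 1 unfolding 2 by (simp add: algebra_simps power2_eq_square)
  then have "?\<mu>\<^sup>2 + complex_of_real (?x * (1 + \<delta>)) = complex_of_real (?x + \<delta>) * ?\<mu>"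
    using nz by simp
  from root_is_mu[OF this] show ?thesis
    using mu_determines_eigenvalue[OF \<delta>, of ?\<mu> "lam (Suc q)" ?x] by simp
qed

text \<open>
  The block is the first one that ends beyond \<open>j\<close>.
\<close>

lemma multiplicity_blocks:
  assumes mult: "has_multiplicities lam N l m" and j: "j < N"
  obtains k where "k \<in> {1..l}" "partial_sum m (k - 1) \<le> j" "j < partial_sum m k"
    "partial_sum m k \<le> N" "m k = partial_sum m k - partial_sum m (k - 1)"
    "\<And>q r. q \<in> {partial_sum m (k - 1)..<partial_sum m k} \<Longrightarrow> r < N \<Longrightarrow>
       lam (Suc r) = lam (Suc q) \<longleftrightarrow> r \<in> {partial_sum m (k - 1)..<partial_sum m k}"
proof -
  have N: "partial_sum m l = N" using mult unfolding has_multiplicities_def by blast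
  define k where "k = (LEAST k. j < partial_sum m k)"
  have k: "j < partial_sum m k" "k \<le> l"
    unfolding k_def using j N by (auto intro: LeastI2[of _ l] Least_le)
  have "k \<noteq> 0" using k(1) by (cases k) (auto simp: partial_sum_def)
  then have k1: "k - 1 < k" by simp
  have le: "partial_sum m (k - 1) \<le> j"
    using not_less_Least[OF k1[unfolded k_def], folded k_def] by simp
  have mono: "partial_sum m k \<le> partial_sum m l"
    unfolding partial_sum_def using k(2) by (intro sum_mono2) auto
  have step: "m k = partial_sum m k - partial_sum m (k - 1)"
    using \<open>k \<noteq> 0\<close> by (cases k) (auto simp: partial_sum_def)
  have kl: "k \<in> {1..l}" using k(2) \<open>k \<noteq> 0\<close> by simp
  have "lam (Suc r) = lam (Suc q) \<longleftrightarrow> r \<in> {partial_sum m (k - 1)..<partial_sum m k}"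
    if q: "q \<in> {partial_sum m (k - 1)..<partial_sum m k}" and r: "r < N" for q r
  proof -
    have "Suc q \<in> {partial_sum m (k - 1) + 1..partial_sum m k}" "Suc r \<in> {1..N}" using q r by auto
    then have "lam (Suc r) = lam (Suc q) \<longleftrightarrow> Suc r \<in> {partial_sum m (k - 1) + 1..partial_sum m k}"
      using mult kl unfolding has_multiplicities_def by blast
    then show ?thesis by auto
  qed
  with that kl le k(1) mono N step show ?thesis by simp
qed

text \<open>
  Restricted to the modes of one eigenvalue, the rows of \<open>RQ\<close> are the rows of \<open>C\<close> multiplied from the
  left by a square matrix, and the rank condition makes them independent. Then the square matrix
  is injective, hence surjective, so that a relation between the rows of \<open>C\<close> would be one between
  the rows of \<open>RQ\<close>.
\<close>

lemma eigenspace_rows_independent: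
  assumes \<delta>: "\<delta> > 0" and sim: "similar_mat_wit (P_mat \<delta> lam N) (D_mat \<delta> lam N) Rinv R"
    and C: "C \<in> carrier_mat N M"
    and rank: "rank_condition (R * (0\<^sub>m N M @\<^sub>r C)) N M l m"
    and mult: "has_multiplicities lam N l m"
    and j: "j < N"
    and c: "\<And>i. i < M \<Longrightarrow> (\<Sum>r | r < N \<and> lam (Suc r) = lam (Suc j). c r * C $$ (r, i)) = 0"
  shows "c j = 0"
proof -
  obtain k where k: "k \<in> {1..l}" "partial_sum m (k - 1) \<le> j" "j < partial_sum m k"
    "partial_sum m k \<le> N" "m k = partial_sum m k - partial_sum m (k - 1)"
    and blk: "\<And>q r. q \<in> {partial_sum m (k - 1)..<partial_sum m k} \<Longrightarrow> r < N \<Longrightarrow>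
       lam (Suc r) = lam (Suc q) \<longleftrightarrow> r \<in> {partial_sum m (k - 1)..<partial_sum m k}"
    using multiplicity_blocks[OF mult j] by metis
  define a where "a = partial_sum m (k - 1)"
  define b where "b = partial_sum m k"
  have jab: "j \<in> {a..<b}" and bN: "b \<le> N" using k by (auto simp: a_def b_def)
  have P: "P_mat \<delta> lam N \<in> carrier_mat (2 * N) (2 * N)" by (simp add: P_mat_diag_blocks)
  with sim have R: "R \<in> carrier_mat (2 * N) (2 * N)" by (auto simp: similar_mat_wit_def Let_def)
  define Q where "Q = 0\<^sub>m N M @\<^sub>r C"
  have Q: "Q \<in> carrier_mat (2 * N) M"
    unfolding Q_def mult_2 by (rule carrier_append_rows[OF _ C]) simp
  have Qidx: "Q $$ (r, i) = (if r < N then 0 else C $$ (r - N, i))" if "r < 2 * N" "i < M" for r i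
    using that C unfolding Q_def append_rows_def by auto
  define X where "X = R * Q"
  have X: "X \<in> carrier_mat (2 * N) M" unfolding X_def by (rule mult_carrier_mat[OF R Q])
  have support: "R $$ (q, N + r) = 0" if "q \<in> {a..<b}" "r < N" "r \<notin> {a..<b}" for q r
    using left_eigenvector_entries[OF \<delta> sim _ that(2), of q] blk[of q r] that bN
    unfolding a_def b_def by force
  have Xidx: "X $$ (q, i) = (\<Sum>r=a..<b. R $$ (q, N + r) * C $$ (r, i))"
    if q: "q \<in> {a..<b}" and i: "i < M" for q i
  proof -
    have "X $$ (q, i) = (\<Sum>r=0..<2 * N. R $$ (q, r) * Q $$ (r, i))"
      unfolding X_def using R Q q i bN by (simp add: scalar_prod_def)
    also have "\<dots> = (\<Sum>r=0..<N. R $$ (q, r) * Q $$ (r, i)) + (\<Sum>r=N..<2 * N. R $$ (q, r) * Q $$ (r, i))"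
      by (simp add: sum.atLeastLessThan_concat)
    also have "(\<Sum>r=0..<N. R $$ (q, r) * Q $$ (r, i)) = 0"
      by (rule sum.neutral) (use i in \<open>auto simp: Qidx\<close>)
    also have "(\<Sum>r=N..<2 * N. R $$ (q, r) * Q $$ (r, i)) = (\<Sum>r=0..<N. R $$ (q, r + N) * Q $$ (r + N, i))"
      using sum.shift_bounds_nat_ivl[of "\<lambda>r. R $$ (q, r) * Q $$ (r, i)" 0 N N] by (simp add: mult_2)
    also have "\<dots> = (\<Sum>r=0..<N. R $$ (q, N + r) * C $$ (r, i))"
      by (rule sum.cong) (use i in \<open>auto simp: Qidx add.commute\<close>)
    also have "\<dots> = (\<Sum>r=a..<b. R $$ (q, N + r) * C $$ (r, i))"
      by (rule sum.mono_neutral_right) (use bN support[OF q] in auto)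
    finally show ?thesis by simp
  qed
  have rows: "d q = 0"
    if d: "\<And>i. i < M \<Longrightarrow> (\<Sum>q=a..<b. d q * X $$ (q, i)) = 0" and q: "q \<in> {a..<b}" for d q
  proof -
    let ?K = "column_block (mat_adjoint X) a b"
    have K: "?K = Matrix.mat M (b - a) (\<lambda>(i, t). cnj (X $$ (a + t, i)))"
      by (rule column_block_adjoint[OF X]) (use bN in simp)
    define v where "v = Matrix.vec (b - a) (\<lambda>t. cnj (d (a + t)))"
    have "v = 0\<^sub>v (b - a)"
    proof (rule full_column_rank_injective)
      show "?K \<in> carrier_mat M (b - a)" by (simp add: K)
      show "vec_space.rank M ?K = b - a"
        using rank k(1,5) unfolding rank_condition_def X_def Q_def a_def b_def by simp
      show "v \<in> carrier_vec (b - a)" by (simp add: v_def)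
      show "?K *\<^sub>v v = 0\<^sub>v M"
      proof (rule eq_vecI)
        fix i assume "i < dim_vec (0\<^sub>v M :: complex Matrix.vec)"
        then have i: "i < M" by simp
        have "(?K *\<^sub>v v) $ i = (\<Sum>t=0..<b - a. cnj (d (a + t) * X $$ (a + t, i)))"
          unfolding K v_def using i by (simp add: scalar_prod_def mult.commute)
        also have "\<dots> = cnj (\<Sum>q=a..<b. d q * X $$ (q, i))"
          using sum.shift_bounds_nat_ivl[of "\<lambda>q. d q * X $$ (q, i)" 0 a "b - a"] jab
          by (simp add: add.commute)
        finally show "(?K *\<^sub>v v) $ i = 0\<^sub>v M $ i" using d[OF i] i by simp
      qed (simp add: K)
    qed
    then have "v $ (q - a) = 0" using q by (simp add: diff_less_mono)
    then show ?thesis using q by (simp add: v_def diff_less_mono)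
  qed
  have swap: "(\<Sum>q=a..<b. d q * X $$ (q, i)) = (\<Sum>r=a..<b. (\<Sum>q=a..<b. R $$ (q, N + r) * d q) * C $$ (r, i))"
    if i: "i < M" for d i
  proof -
    have "(\<Sum>q=a..<b. d q * X $$ (q, i)) = (\<Sum>q=a..<b. \<Sum>r=a..<b. R $$ (q, N + r) * d q * C $$ (r, i))"
      using i by (intro sum.cong) (auto simp: Xidx sum_distrib_left mult_ac)
    also have "\<dots> = (\<Sum>r=a..<b. \<Sum>q=a..<b. R $$ (q, N + r) * d q * C $$ (r, i))" by (rule sum.swap)
    finally show ?thesis by (simp add: sum_distrib_right)
  qed
  \<comment> \<open>Surjectivity of the square matrix with entries \<open>R(q, N + r)\<close>, acting on the rows of \<open>C\<close>.\<close>
  have "\<exists>d. \<forall>r\<in>{a..<b}. (\<Sum>q=a..<b. R $$ (q, N + r) * d q) = c r"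
  proof (rule injective_system_solvable)
    fix d q
    assume z: "\<And>r. r \<in> {a..<b} \<Longrightarrow> (\<Sum>q=a..<b. R $$ (q, N + r) * d q) = 0" and q: "q \<in> {a..<b}"
    show "d q = 0" by (rule rows[OF _ q]) (simp add: swap z)
  qed simp
  then obtain d where d: "\<And>r. r \<in> {a..<b} \<Longrightarrow> (\<Sum>q=a..<b. R $$ (q, N + r) * d q) = c r" by blast
  have set_eq: "{r. r < N \<and> lam (Suc r) = lam (Suc j)} = {a..<b}"
  proof (rule Set.set_eqI)
    fix r
    show "r \<in> {r. r < N \<and> lam (Suc r) = lam (Suc j)} \<longleftrightarrow> r \<in> {a..<b}"
    proof (cases "r < N")
      case True
      then have "lam (Suc r) = lam (Suc j) \<longleftrightarrow> r \<in> {a..<b}"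
        using blk[of j r] jab unfolding a_def b_def by blast
      with True show ?thesis by blast
    qed (use bN in auto)
  qed
  have "d q = 0" if "q \<in> {a..<b}" for q
  proof (rule rows[OF _ that])
    fix i assume i: "i < M"
    have "(\<Sum>r=a..<b. (\<Sum>q=a..<b. R $$ (q, N + r) * d q) * C $$ (r, i)) = (\<Sum>r=a..<b. c r * C $$ (r, i))"
      by (rule sum.cong) (simp_all add: d)
    then show "(\<Sum>q=a..<b. d q * X $$ (q, i)) = 0" using swap[OF i] c[OF i] by (simp add: set_eq)
  qed
  then show "c j = 0" using d[OF jab] by simp
qed

section \<open>Control functions that annihilate finitely many modes\<close>

text \<open>
  Within the modes of one eigenvalue the rows of the input matrix have an injective Gram matrix; this
  yields input vectors dual to these rows. The real part of the complex solution is taken because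
  the input matrix is real.
\<close>

lemma block_right_inverse:
  fixes k :: "nat \<Rightarrow> nat \<Rightarrow> real" and L :: "nat \<Rightarrow> real"
  assumes indep: "\<And>c j. j < N \<Longrightarrow>
      (\<And>i. i < M \<Longrightarrow> (\<Sum>r | r < N \<and> L r = L j. c r * complex_of_real (k r i)) = 0) \<Longrightarrow> c j = 0"
    and n: "n < N"
  shows "\<exists>w :: nat \<Rightarrow> real. \<forall>r<N. L r = L n \<longrightarrow> (\<Sum>i<M. k r i * w i) = (if r = n then 1 else 0)"
proof -
  define I where "I = {r. r < N \<and> L r = L n}"
  have I: "finite I" by (simp add: I_def)
  define G where "G r s = complex_of_real (\<Sum>i<M. k r i * k s i)" for r s
  have G: "(\<Sum>s\<in>I. G r s * c s) = (\<Sum>i<M. of_real (k r i) * (\<Sum>s\<in>I. c s * of_real (k s i)))" for r c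
  proof -
    have "(\<Sum>s\<in>I. G r s * c s) = (\<Sum>s\<in>I. \<Sum>i<M. of_real (k r i) * (c s * of_real (k s i)))"
      by (simp add: G_def sum_distrib_left sum_distrib_right mult_ac)
    also have "\<dots> = (\<Sum>i<M. \<Sum>s\<in>I. of_real (k r i) * (c s * of_real (k s i)))" by (rule sum.swap)
    finally show ?thesis by (simp add: sum_distrib_left)
  qed
  have "\<exists>c. \<forall>r\<in>I. (\<Sum>s\<in>I. G r s * c s) = (if r = n then 1 else 0)"
  proof (rule injective_system_solvable[OF I])
    fix c j
    assume z: "\<And>r. r \<in> I \<Longrightarrow> (\<Sum>s\<in>I. G r s * c s) = 0" and j: "j \<in> I"
    define x where "x i = (\<Sum>s\<in>I. c s * complex_of_real (k s i))" for i
    have "0 = (\<Sum>r\<in>I. cnj (c r) * (\<Sum>s\<in>I. G r s * c s))" using z by simp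
    also have "\<dots> = (\<Sum>r\<in>I. \<Sum>i<M. cnj (c r) * of_real (k r i) * x i)"
      unfolding G x_def by (simp add: sum_distrib_left mult.assoc)
    also have "\<dots> = (\<Sum>i<M. \<Sum>r\<in>I. cnj (c r) * of_real (k r i) * x i)" by (rule sum.swap)
    also have "\<dots> = (\<Sum>i<M. cnj (x i) * x i)"
      by (simp add: x_def sum_distrib_right)
    also have "\<dots> = complex_of_real (\<Sum>i<M. (cmod (x i))\<^sup>2)"
      by (simp only: of_real_sum complex_norm_square mult.commute)
    finally have "(\<Sum>i<M. (cmod (x i))\<^sup>2) = 0" by (metis of_real_eq_0_iff)
    then have x: "x i = 0" if "i < M" for i
      using that by (subst (asm) sum_nonneg_eq_0_iff) auto
    have "I = {r. r < N \<and> L r = L j}" using j by (auto simp: I_def)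
    then show "c j = 0" using indep[of j c] x j by (simp add: I_def x_def)
  qed
  then obtain c where c: "\<And>r. r \<in> I \<Longrightarrow> (\<Sum>s\<in>I. G r s * c s) = (if r = n then 1 else 0)" by blast
  define w where "w i = Re (\<Sum>s\<in>I. c s * of_real (k s i))" for i
  have "(\<Sum>i<M. k r i * w i) = (if r = n then 1 else 0)" if r: "r < N" "L r = L n" for r
  proof -
    have "(\<Sum>i<M. k r i * w i) = Re (\<Sum>i<M. of_real (k r i) * (\<Sum>s\<in>I. c s * of_real (k s i)))"
      by (simp add: w_def)
    also have "\<dots> = Re (if r = n then 1 else 0)"
      unfolding G[symmetric] using c[of r] r by (simp only: I_def mem_Collect_eq)
    finally show ?thesis by simp
  qed
  then show ?thesis by blast
qed

lemma C2_bounded_of_vanishing: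
  fixes h h' h'' :: "real \<Rightarrow> real"
  assumes d: "\<And>s. (h has_real_derivative h' s) (at s)" "\<And>s. (h' has_real_derivative h'' s) (at s)"
    and c: "continuous_on UNIV h''" and z: "\<And>s. s \<ge> T \<Longrightarrow> h s = 0 \<and> h' s = 0 \<and> h'' s = 0"
  shows "\<exists>K\<ge>0. \<forall>t\<ge>0. \<bar>h t\<bar> + \<bar>h' t\<bar> + \<bar>h'' t\<bar> \<le> K"
proof -
  define q where "q t = \<bar>h t\<bar> + \<bar>h' t\<bar> + \<bar>h'' t\<bar>" for t
  have "continuous_on X h" "continuous_on X h'" for X
    by (rule DERIV_continuous_on, rule has_field_derivative_at_within[OF d(1)])
      (rule DERIV_continuous_on, rule has_field_derivative_at_within[OF d(2)])
  then have "continuous_on {0..T} q" unfolding q_def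
    using continuous_on_subset[OF c] by (intro continuous_intros) auto
  then have "bounded (q ` {0..T})"
    by (intro compact_imp_bounded compact_continuous_image) auto
  then obtain K where "\<forall>x\<in>q ` {0..T}. norm x \<le> K" unfolding bounded_iff by blast
  then have K: "\<And>t. t \<in> {0..T} \<Longrightarrow> norm (q t) \<le> K" by blast
  have "q t \<le> \<bar>K\<bar>" if "t \<ge> 0" for t
  proof (cases "t \<le> T")
    case True
    with K[of t] that show ?thesis by auto
  qed (use z[of t] in \<open>simp add: q_def\<close>)
  then show ?thesis unfolding q_def by (intro exI[of _ "\<bar>K\<bar>"]) auto
qed

definition C2_vanishing_after ::
    "real \<Rightarrow> (nat \<Rightarrow> real \<Rightarrow> real) \<Rightarrow> (nat \<Rightarrow> real \<Rightarrow> real) \<Rightarrow> (nat \<Rightarrow> real \<Rightarrow> real) \<Rightarrow> bool" where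
  "C2_vanishing_after T V V' V'' \<longleftrightarrow> (\<forall>i s. (V i has_real_derivative V' i s) (at s)) \<and>
     (\<forall>i s. (V' i has_real_derivative V'' i s) (at s)) \<and> (\<forall>i. continuous_on UNIV (V'' i)) \<and>
     (\<forall>i. \<forall>s\<ge>T. V i s = 0 \<and> V' i s = 0 \<and> V'' i s = 0)"

text \<open>
  The control is \<open>V\<^sub>i(s) = -\<Sum>\<^sub>n w\<^sub>n\<^sub>,\<^sub>i a\<^sub>n h\<^sub>n(s)\<close> with \<open>w\<^sub>n\<close> dual to the rows of the
  eigenvalue of mode \<open>n\<close>, and \<open>h\<^sub>n\<close> with moment 1 at the roots of that eigenvalue and 0 at the
  others: \<open>h\<^sub>n\<close> separates different eigenvalues, \<open>w\<^sub>n\<close> the modes within one eigenvalue.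
  It depends linearly on the data, which gives a constant \<open>\<kappa>\<close> independent of them.
\<close>

lemma null_control_functions:
  fixes k :: "nat \<Rightarrow> nat \<Rightarrow> real" and L :: "nat \<Rightarrow> real"
  assumes \<delta>: "\<delta> > 0" and T: "T > 0"
    and indep: "\<And>c j. j < N \<Longrightarrow>
      (\<And>i. i < M \<Longrightarrow> (\<Sum>r | r < N \<and> L r = L j. c r * complex_of_real (k r i)) = 0) \<Longrightarrow> c j = 0"
  shows "\<exists>\<kappa>\<ge>0. \<forall>a A. (\<forall>n<N. \<bar>a n\<bar> \<le> A) \<longrightarrow> (\<exists>V V' V''. C2_vanishing_after T V V' V'' \<and>
     (\<forall>i<M. \<forall>s\<ge>0. \<bar>V i s\<bar> + \<bar>V' i s\<bar> + \<bar>V'' i s\<bar> \<le> \<kappa> * A) \<and>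
     (\<forall>n<N. \<forall>\<mu>. \<mu> = mu_plus \<delta> (L n) \<or> \<mu> = mu_minus \<delta> (L n) \<longrightarrow>
       integral {0..T} (\<lambda>s. exp (\<mu> * of_real s) * of_real (\<Sum>i<M. V i s * k n i)) = - complex_of_real (a n)))"
proof -
  define root where "root \<mu> x \<longleftrightarrow> \<mu> = mu_plus \<delta> x \<or> \<mu> = mu_minus \<delta> x" for \<mu> x
  define S where "S = (\<Union>r\<in>{..<N}. {mu_plus \<delta> (L r), mu_minus \<delta> (L r)})"
  have S: "finite S" by (simp add: S_def)
  have S_iff: "\<mu> \<in> S \<longleftrightarrow> (\<exists>r<N. root \<mu> (L r))" for \<mu> by (auto simp: S_def root_def)
  have cnj_root: "root (cnj \<mu>) x \<longleftrightarrow> root \<mu> x" for \<mu> x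
    using cnj_mu[of \<mu> \<delta> x] cnj_mu[of "cnj \<mu>" \<delta> x] by (auto simp: root_def)
  define P where "P n h h' h'' \<longleftrightarrow>
     (\<forall>s. (h has_real_derivative h' s) (at s)) \<and> (\<forall>s. (h' has_real_derivative h'' s) (at s)) \<and>
     continuous_on UNIV h'' \<and> (\<forall>s\<ge>T. h s = 0 \<and> h' s = 0 \<and> h'' s = 0) \<and>
     (\<forall>\<mu>\<in>S. integral {0..T} (\<lambda>s. exp (\<mu> * of_real s) * of_real (h s)) = (if root \<mu> (L n) then 1 else 0))"
    for n and h h' h'' :: "real \<Rightarrow> real"
  have "\<exists>h h' h''. P n h h' h''" for n
    unfolding P_def by (rule real_exponential_moments[OF S T]) (auto simp: S_iff cnj_root)
  then obtain h h' h'' where P: "\<And>n. P n (h n) (h' n) (h'' n)" by metis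
  have h: "\<And>n s. (h n has_real_derivative h' n s) (at s)" "\<And>n s. (h' n has_real_derivative h'' n s) (at s)"
      "\<And>n. continuous_on UNIV (h'' n)" "\<And>n s. s \<ge> T \<Longrightarrow> h n s = 0 \<and> h' n s = 0 \<and> h'' n s = 0"
    and mom: "\<And>n \<mu>. \<mu> \<in> S \<Longrightarrow> integral {0..T} (\<lambda>s. exp (\<mu> * of_real s) * of_real (h n s)) = (if root \<mu> (L n) then 1 else 0)"
    using P unfolding P_def by blast+
  have h_cont: "continuous_on X (h n)" for X n
    by (rule DERIV_continuous_on) (rule has_field_derivative_at_within[OF h(1)])
  have "\<forall>n. \<exists>K\<ge>0. \<forall>t\<ge>0. \<bar>h n t\<bar> + \<bar>h' n t\<bar> + \<bar>h'' n t\<bar> \<le> K"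
    by (intro allI C2_bounded_of_vanishing[OF h])
  then obtain H where H: "\<And>n. H n \<ge> 0" "\<And>n t. t \<ge> 0 \<Longrightarrow> \<bar>h n t\<bar> + \<bar>h' n t\<bar> + \<bar>h'' n t\<bar> \<le> H n"
    by metis
  have "\<forall>n\<in>{..<N}. \<exists>w :: nat \<Rightarrow> real. \<forall>r<N. L r = L n \<longrightarrow> (\<Sum>i<M. k r i * w i) = (if r = n then 1 else 0)"
  proof
    fix n assume "n \<in> {..<N}"
    then have n: "n < N" by simp
    show "\<exists>w :: nat \<Rightarrow> real. \<forall>r<N. L r = L n \<longrightarrow> (\<Sum>i<M. k r i * w i) = (if r = n then 1 else 0)"
      by (rule block_right_inverse[OF _ n]) (rule indep)
  qed
  then obtain w :: "nat \<Rightarrow> nat \<Rightarrow> real" where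
    w: "\<And>n r. n < N \<Longrightarrow> r < N \<Longrightarrow> L r = L n \<Longrightarrow> (\<Sum>i<M. k r i * w n i) = (if r = n then 1 else 0)"
    by (metis lessThan_iff)
  define \<kappa> where "\<kappa> = (\<Sum>i<M. \<Sum>n<N. \<bar>w n i\<bar> * H n)"
  have \<kappa>: "\<kappa> \<ge> 0" unfolding \<kappa>_def by (intro sum_nonneg mult_nonneg_nonneg H) auto
  have "\<exists>V V' V''. C2_vanishing_after T V V' V'' \<and>
     (\<forall>i<M. \<forall>s\<ge>0. \<bar>V i s\<bar> + \<bar>V' i s\<bar> + \<bar>V'' i s\<bar> \<le> \<kappa> * A) \<and>
     (\<forall>n<N. \<forall>\<mu>. \<mu> = mu_plus \<delta> (L n) \<or> \<mu> = mu_minus \<delta> (L n) \<longrightarrow>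
       integral {0..T} (\<lambda>s. exp (\<mu> * of_real s) * of_real (\<Sum>i<M. V i s * k n i)) = - complex_of_real (a n))"
    if aA: "\<forall>n<N. \<bar>a n\<bar> \<le> A" for a A
  proof -
    define C where "C n i = - (w n i * a n)" for n i
    define V where "V i s = (\<Sum>n<N. C n i * h n s)" for i s
    define V' where "V' i s = (\<Sum>n<N. C n i * h' n s)" for i s
    define V'' where "V'' i s = (\<Sum>n<N. C n i * h'' n s)" for i s
    have "(V i has_real_derivative V' i s) (at s)" for i s
      unfolding V_def[abs_def] V'_def by (intro DERIV_sum DERIV_cmult h)
    moreover have "(V' i has_real_derivative V'' i s) (at s)" for i s
      unfolding V'_def[abs_def] V''_def by (intro DERIV_sum DERIV_cmult h)
    moreover have "continuous_on UNIV (V'' i)" for i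
      unfolding V''_def[abs_def] by (intro continuous_intros h)
    moreover have "V i s = 0 \<and> V' i s = 0 \<and> V'' i s = 0" if "s \<ge> T" for i s
      using h(4)[OF that] by (simp add: V_def V'_def V''_def)
    moreover have "\<bar>V i s\<bar> + \<bar>V' i s\<bar> + \<bar>V'' i s\<bar> \<le> \<kappa> * A" if i: "i < M" and s: "s \<ge> 0" for i s
    proof -
      have A: "A \<ge> 0 \<or> N = 0" using aA by (metis abs_ge_zero gr0I order_trans)
      have "\<bar>V i s\<bar> + \<bar>V' i s\<bar> + \<bar>V'' i s\<bar>
          \<le> (\<Sum>n<N. \<bar>C n i * h n s\<bar>) + (\<Sum>n<N. \<bar>C n i * h' n s\<bar>) + (\<Sum>n<N. \<bar>C n i * h'' n s\<bar>)"
        unfolding V_def V'_def V''_def by (intro add_mono sum_abs)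
      also have "\<dots> = (\<Sum>n<N. \<bar>C n i\<bar> * (\<bar>h n s\<bar> + \<bar>h' n s\<bar> + \<bar>h'' n s\<bar>))"
        by (simp add: sum.distrib abs_mult distrib_left)
      also have "\<dots> \<le> (\<Sum>n<N. (\<bar>w n i\<bar> * A) * H n)"
      proof (rule sum_mono)
        fix n assume "n \<in> {..<N}"
        then have "\<bar>C n i\<bar> \<le> \<bar>w n i\<bar> * A"
          unfolding C_def abs_minus_cancel abs_mult using aA by (intro mult_left_mono) auto
        then show "\<bar>C n i\<bar> * (\<bar>h n s\<bar> + \<bar>h' n s\<bar> + \<bar>h'' n s\<bar>) \<le> (\<bar>w n i\<bar> * A) * H n"
          using H(2)[OF s, of n] by (intro mult_mono') auto
      qed
      also have "\<dots> = (\<Sum>n<N. \<bar>w n i\<bar> * H n) * A"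
        by (simp add: sum_distrib_left sum_distrib_right mult_ac)
      also have "\<dots> \<le> \<kappa> * A"
      proof (cases "N = 0")
        case False
        have "(\<Sum>n<N. \<bar>w n i\<bar> * H n) \<le> \<kappa>" unfolding \<kappa>_def
          using i by (intro member_le_sum[of i "{..<M}" "\<lambda>i. \<Sum>n<N. \<bar>w n i\<bar> * H n"]
              sum_nonneg mult_nonneg_nonneg H) auto
        then show ?thesis using A False by (intro mult_right_mono) auto
      qed (simp add: \<kappa>_def)
      finally show ?thesis .
    qed
    moreover have "integral {0..T} (\<lambda>s. exp (\<mu> * of_real s) * of_real (\<Sum>i<M. V i s * k n i)) = - complex_of_real (a n)"
      if n: "n < N" and \<mu>: "\<mu> = mu_plus \<delta> (L n) \<or> \<mu> = mu_minus \<delta> (L n)" for n \<mu>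
    proof -
      have \<mu>S: "\<mu> \<in> S" using n \<mu> by (auto simp: S_iff root_def)
      have root_iff: "root \<mu> (L r) \<longleftrightarrow> L r = L n" for r
        using mu_determines_eigenvalue[OF \<delta>, of \<mu> "L r" "L n"] \<mu> by (auto simp: root_def)
      define \<theta> where "\<theta> r = (\<Sum>i<M. C r i * k n i)" for r
      have "(\<Sum>i<M. V i s * k n i) = (\<Sum>r<N. \<theta> r * h r s)" for s
      proof -
        have "(\<Sum>i<M. V i s * k n i) = (\<Sum>i<M. \<Sum>r<N. C r i * k n i * h r s)"
          unfolding V_def sum_distrib_right by (intro sum.cong refl) (simp add: mult_ac)
        also have "\<dots> = (\<Sum>r<N. \<Sum>i<M. C r i * k n i * h r s)" by (rule sum.swap)
        finally show ?thesis by (simp add: \<theta>_def sum_distrib_right)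
      qed
      then have "integral {0..T} (\<lambda>s. exp (\<mu> * of_real s) * of_real (\<Sum>i<M. V i s * k n i))
          = integral {0..T} (\<lambda>s. \<Sum>r<N. of_real (\<theta> r) * (exp (\<mu> * of_real s) * of_real (h r s)))"
        by (simp only: of_real_sum of_real_mult sum_distrib_left mult_ac)
      also have "\<dots> = (\<Sum>r<N. integral {0..T} (\<lambda>s. of_real (\<theta> r) * (exp (\<mu> * of_real s) * of_real (h r s))))"
        by (intro integral_sum integrable_continuous_real continuous_intros h_cont) auto
      also have "\<dots> = (\<Sum>r<N. of_real (\<theta> r) * (if L r = L n then 1 else 0))"
        using mom[OF \<mu>S] root_iff by simp
      also have "\<dots> = (\<Sum>r<N. if r = n then - complex_of_real (a n) else 0)"
      proof (rule sum.cong[OF refl])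
        fix r assume r: "r \<in> {..<N}"
        show "of_real (\<theta> r) * (if L r = L n then 1 else 0) = (if r = n then - complex_of_real (a n) else 0)"
        proof (cases "L r = L n")
          case True
          have "\<theta> r = - a r * (\<Sum>i<M. k n i * w r i)"
            unfolding \<theta>_def C_def sum_distrib_left by (intro sum.cong refl) (simp add: mult_ac)
          then show ?thesis using w[of r n] r n True by simp
        qed auto
      qed
      also have "\<dots> = - complex_of_real (a n)" using n by simp
      finally show ?thesis .
    qed
    ultimately show ?thesis unfolding C2_vanishing_after_def by blast
  qed
  then show ?thesis using \<kappa> by blast
qed

section \<open>Solutions as series of modes, and uniqueness\<close>

text \<open>
  With \<open>q\<close> the memory term, the energy \<open>a\<^sup>2 + L q\<^sup>2\<close> has derivative
  \<open>-2L(a\<^sup>2 + \<delta> q\<^sup>2) \<le> 0\<close>.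
\<close>

lemma memory_mode_unique:
  assumes L: "L > 0" and \<delta>: "\<delta> > 0"
    and cont: "continuous_on {0..} a" and init: "a 0 = 0"
    and deriv: "\<And>t. t > 0 \<Longrightarrow> (a has_real_derivative a' t) (at t)"
    and eq: "\<And>t. t > 0 \<Longrightarrow> a' t + L * a t + L * integral {0..t} (\<lambda>s. memory_kernel \<delta> (t - s) * a s) = 0"
    and t: "t \<ge> 0"
  shows "a t = 0"
proof (cases "t = 0")
  case False
  with t have t: "t > 0" by simp
  define q where "q u = Re (duhamel (of_real \<delta>) 0 a u)" for u
  have q_int: "q u = integral {0..u} (\<lambda>s. memory_kernel \<delta> (u - s) * a s)" for u
  proof -
    have "duhamel (of_real \<delta>) 0 a u = integral {0..u} (\<lambda>s. complex_of_real (memory_kernel \<delta> (u - s) * a s))"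
    proof -
      have k: "exp (- (of_real \<delta> * complex_of_real (u - s))) * of_real (a s)
          = complex_of_real (memory_kernel \<delta> (u - s) * a s)" for s
        by (simp add: memory_kernel_def exp_of_real[symmetric])
      show ?thesis unfolding duhamel_alt k by simp
    qed
    moreover have "(\<lambda>s. memory_kernel \<delta> (u - s) * a s) integrable_on {0..u}"
      unfolding memory_kernel_def
      by (intro integrable_continuous_real continuous_intros continuous_on_subset[OF cont]) auto
    ultimately have "duhamel (of_real \<delta>) 0 a u
        = complex_of_real (integral {0..u} (\<lambda>s. memory_kernel \<delta> (u - s) * a s))"
      by (simp only: integral_unique[OF has_integral_of_real[OF integrable_integral]])
    then show ?thesis by (simp add: q_def)
  qed
  have dq: "(q has_real_derivative (a u - \<delta> * q u)) (at u within {0..})" if "u \<ge> 0" for u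
    using bounded_linear.has_vector_derivative[OF bounded_linear_Re duhamel_deriv[OF cont that, of "of_real \<delta>" 0]]
    unfolding has_real_derivative_iff_has_vector_derivative q_def by simp
  define E where "E u = (a u)\<^sup>2 + L * (q u)\<^sup>2" for u
  have "continuous_on {0..} q"
    using dq by (intro DERIV_continuous_on) auto
  then have "continuous_on {0..t} E" unfolding E_def[abs_def]
    by (intro continuous_intros) (use cont continuous_on_subset in \<open>auto intro: continuous_on_subset\<close>)
  moreover have "\<exists>y. (E has_real_derivative y) (at u) \<and> y \<le> 0" if u: "0 < u" "u < t" for u
  proof -
    have "at u within {0<..} = at u" using u by (intro at_within_open) auto
    then have "(q has_real_derivative (a u - \<delta> * q u)) (at u)"
      using DERIV_subset[OF dq[of u], of "{0<..}"] u by (simp add: subset_iff)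
    then have "(E has_real_derivative (2 * a u * a' u + L * (2 * q u * (a u - \<delta> * q u)))) (at u)"
      unfolding E_def[abs_def] by (auto intro!: derivative_eq_intros deriv[OF u(1)])
    moreover have "2 * a u * a' u + L * (2 * q u * (a u - \<delta> * q u)) = - (2 * L * ((a u)\<^sup>2 + \<delta> * (q u)\<^sup>2))"
    proof -
      have "a' u = - L * a u - L * q u" using eq[OF u(1)] q_int[of u] by simp
      show ?thesis unfolding \<open>a' u = _\<close> by (simp add: algebra_simps power2_eq_square)
    qed
    moreover have "2 * L * ((a u)\<^sup>2 + \<delta> * (q u)\<^sup>2) \<ge> 0" using L \<delta> by simp
    ultimately show ?thesis by force
  qed
  ultimately have "E t \<le> E 0" using DERIV_nonpos_imp_decreasing_open[OF less_imp_le[OF t], of E] by blast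
  then have "(a t)\<^sup>2 + L * (q t)\<^sup>2 \<le> 0" using init by (simp add: E_def q_int)
  moreover have "L * (q t)\<^sup>2 \<ge> 0" using L by simp
  ultimately have "(a t)\<^sup>2 \<le> 0" by linarith
  then show ?thesis by simp
qed (simp add: init)

text \<open>
  Any functional that turns the operator into multiplication by a positive number sends solutions of
  the evolution equation to solutions of the scalar equation. The lemma is applied to the
  coefficients of the real and of the imaginary part.
\<close>

lemma memory_solution_functional_unique:
  assumes L: "L > 0" and \<delta>: "\<delta> > 0"
    and ell: "bounded_linear (ell :: _ \<Rightarrow> real)" and ellA: "\<And>x. x \<in> D \<times> D \<Longrightarrow> ell (map_prod A A x) = L * ell x"
    and y: "memory_solution D A B \<delta> u y0 y" and z: "memory_solution D A B \<delta> u y0 z" and t: "t \<ge> 0"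
  shows "ell (z t) = ell (y t)"
proof -
  interpret ell: bounded_linear ell by (rule ell)
  let ?I = "\<lambda>y t. integral {0..t} (\<lambda>s. memory_kernel \<delta> (t - s) *\<^sub>R map_prod A A (y s))"
  have modal: "\<exists>w'. continuous_on {0..} (\<lambda>t. ell (w t)) \<and> ell (w 0) = ell (real_part_embed y0) \<and>
      (\<forall>t>0. ((\<lambda>t. ell (w t)) has_real_derivative w' t) (at t) \<and>
        w' t + L * ell (w t) + L * integral {0..t} (\<lambda>s. memory_kernel \<delta> (t - s) * ell (w s)) = ell (map_prod B B (u t)))"
    if w: "memory_solution D A B \<delta> u y0 w" for w
  proof -
    from w obtain w' where w0: "w 0 = real_part_embed y0" and cw: "continuous_on {0..} w"
      and C1: "has_C1_derivative_on w w' {0<..}"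
      and eq: "\<And>t. t > 0 \<Longrightarrow> w t \<in> D \<times> D \<and>
          (\<lambda>s. memory_kernel \<delta> (t - s) *\<^sub>R map_prod A A (w s)) integrable_on {0..t} \<and>
          w' t + map_prod A A (w t) + ?I w t = map_prod B B (u t)"
      unfolding memory_solution_def by blast
    have "((\<lambda>t. ell (w t)) has_real_derivative ell (w' t)) (at t) \<and>
        ell (w' t) + L * ell (w t) + L * integral {0..t} (\<lambda>s. memory_kernel \<delta> (t - s) * ell (w s))
          = ell (map_prod B B (u t))" if t: "t > 0" for t
    proof
      have "at t within {0<..} = at t" using t by (intro at_within_open) auto
      then have "(w has_vector_derivative w' t) (at t)"
        using C1 t unfolding has_C1_derivative_on_def by force
      from ell.has_vector_derivative[OF this]
      show "((\<lambda>t. ell (w t)) has_real_derivative ell (w' t)) (at t)"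
        unfolding has_real_derivative_iff_has_vector_derivative .
      have "ell (?I w t) = integral {0..t} (ell \<circ> (\<lambda>s. memory_kernel \<delta> (t - s) *\<^sub>R map_prod A A (w s)))"
        using eq[OF t] by (intro integral_linear[symmetric] ell) blast
      \<comment> \<open>The point 0 is exempt: the initial value may lie outside the domain.\<close>
      also have "\<dots> = integral {0..t} (\<lambda>s. L * (memory_kernel \<delta> (t - s) * ell (w s)))"
        by (rule integral_spike[where S = "{0}"]) (use eq in \<open>auto simp: ell.scaleR ellA\<close>)
      also have "\<dots> = L * integral {0..t} (\<lambda>s. memory_kernel \<delta> (t - s) * ell (w s))"
        by (rule integral_mult_right)
      finally have I: "ell (?I w t) = L * integral {0..t} (\<lambda>s. memory_kernel \<delta> (t - s) * ell (w s))" .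
      have "ell (w' t) + ell (map_prod A A (w t)) + ell (?I w t) = ell (map_prod B B (u t))"
        using eq[OF t] by (simp only: ell.add[symmetric])
      then show "ell (w' t) + L * ell (w t) + L * integral {0..t} (\<lambda>s. memory_kernel \<delta> (t - s) * ell (w s))
          = ell (map_prod B B (u t))"
        unfolding I using ellA[OF conjunct1[OF eq[OF t]]] by (simp only:)
    qed
    moreover have "continuous_on {0..} (\<lambda>t. ell (w t))"
      by (rule ell.continuous_on[OF cw])
    ultimately show ?thesis using w0 by (intro exI[of _ "\<lambda>t. ell (w' t)"]) simp
  qed
  from modal[OF y] obtain y' where cy: "continuous_on {0..} (\<lambda>t. ell (y t))" and iy: "ell (y 0) = ell (real_part_embed y0)"
    and y': "\<And>t. t > 0 \<Longrightarrow> ((\<lambda>t. ell (y t)) has_real_derivative y' t) (at t) \<and>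
        y' t + L * ell (y t) + L * integral {0..t} (\<lambda>s. memory_kernel \<delta> (t - s) * ell (y s)) = ell (map_prod B B (u t))"
    by blast
  from modal[OF z] obtain z' where cz: "continuous_on {0..} (\<lambda>t. ell (z t))" and iz: "ell (z 0) = ell (real_part_embed y0)"
    and z': "\<And>t. t > 0 \<Longrightarrow> ((\<lambda>t. ell (z t)) has_real_derivative z' t) (at t) \<and>
        z' t + L * ell (z t) + L * integral {0..t} (\<lambda>s. memory_kernel \<delta> (t - s) * ell (z s)) = ell (map_prod B B (u t))"
    by blast
  have int: "(\<lambda>s. memory_kernel \<delta> (t - s) * c s) integrable_on {0..t}"
    if "continuous_on {0..} c" for c :: "real \<Rightarrow> real" and t
    unfolding memory_kernel_def
    by (intro integrable_continuous_real continuous_intros continuous_on_subset[OF that]) auto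
  have "ell (z t) - ell (y t) = 0"
  proof (rule memory_mode_unique[OF L \<delta> _ _ _ _ t, where a = "\<lambda>t. ell (z t) - ell (y t)" and a' = "\<lambda>t. z' t - y' t"])
    show "continuous_on {0..} (\<lambda>t. ell (z t) - ell (y t))" by (intro continuous_on_diff cz cy)
    show "ell (z 0) - ell (y 0) = 0" using iy iz by simp
    fix t :: real assume t: "t > 0"
    show "((\<lambda>t. ell (z t) - ell (y t)) has_real_derivative z' t - y' t) (at t)"
      using y'[OF t] z'[OF t] by (intro DERIV_diff) auto
    have "integral {0..t} (\<lambda>s. memory_kernel \<delta> (t - s) * (ell (z s) - ell (y s)))
       = integral {0..t} (\<lambda>s. memory_kernel \<delta> (t - s) * ell (z s))
       - integral {0..t} (\<lambda>s. memory_kernel \<delta> (t - s) * ell (y s))"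
      using integral_diff[OF int[OF cz] int[OF cy]] by (simp add: right_diff_distrib)
    then show "z' t - y' t + L * (ell (z t) - ell (y t))
        + L * integral {0..t} (\<lambda>s. memory_kernel \<delta> (t - s) * (ell (z s) - ell (y s))) = 0"
      using y'[OF t] z'[OF t] by (simp add: right_diff_distrib)
  qed
  then show ?thesis by simp
qed

lemma (in diagonal_operator) memory_solution_unique:
  assumes \<delta>: "\<delta> > 0"
    and y: "memory_solution D A B \<delta> u y0 y" and z: "memory_solution D A B \<delta> u y0 z" and t: "t \<ge> 0"
  shows "z t = y t"
proof -
  have "inner (p (z t)) (e n) = inner (p (y t)) (e n)" if p: "p = fst \<or> p = snd" for p n
  proof (rule memory_solution_functional_unique[OF L_pos[of n] \<delta> _ _ y z t])
    have "bounded_linear p" using p bounded_linear_fst bounded_linear_snd by blast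
    then show "bounded_linear (\<lambda>x. inner (p x) (e n))"
      by (rule bounded_linear_compose[OF bounded_linear_inner_left])
    show "inner (p (map_prod A A x)) (e n) = L n * inner (p x) (e n)" if "x \<in> D \<times> D" for x
      using that p by (auto simp: inner_operator)
  qed
  then have "inner (fst (z t) - fst (y t)) (e n) = 0" "inner (snd (z t) - snd (y t)) (e n) = 0" for n
    by (simp_all add: inner_diff_left)
  then have "fst (z t) - fst (y t) = 0" "snd (z t) - snd (y t) = 0"
    using orthogonal_to_basis_zero by blast+
  then show ?thesis by (simp add: prod_eq_iff)
qed

lemma summable_square_add:
  fixes f g :: "nat \<Rightarrow> real"
  assumes f: "summable (\<lambda>n. (f n)\<^sup>2)" and g: "summable (\<lambda>n. (g n)\<^sup>2)"
  shows "summable (\<lambda>n. (f n + g n)\<^sup>2)" "(\<Sum>n. (f n + g n)\<^sup>2) \<le> 2 * (\<Sum>n. (f n)\<^sup>2) + 2 * (\<Sum>n. (g n)\<^sup>2)"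
proof -
  have le: "(f n + g n)\<^sup>2 \<le> 2 * (f n)\<^sup>2 + 2 * (g n)\<^sup>2" for n
    using zero_le_power2[of "f n - g n"] by (simp add: power2_eq_square algebra_simps)
  have s: "summable (\<lambda>n. 2 * (f n)\<^sup>2 + 2 * (g n)\<^sup>2)"
    using f g by (intro summable_add summable_mult)
  show S: "summable (\<lambda>n. (f n + g n)\<^sup>2)"
    by (rule summable_comparison_test'[OF s, of 0]) (use le in auto)
  have "(\<Sum>n. (f n + g n)\<^sup>2) \<le> (\<Sum>n. 2 * (f n)\<^sup>2 + 2 * (g n)\<^sup>2)"
    by (rule suminf_le[OF le S s])
  also have "\<dots> = 2 * (\<Sum>n. (f n)\<^sup>2) + 2 * (\<Sum>n. (g n)\<^sup>2)"
    using f g by (simp add: suminf_add[symmetric] suminf_mult summable_mult)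
  finally show "(\<Sum>n. (f n + g n)\<^sup>2) \<le> 2 * (\<Sum>n. (f n)\<^sup>2) + 2 * (\<Sum>n. (g n)\<^sup>2)" .
qed

lemma summable_square_mult:
  fixes g :: "nat \<Rightarrow> real"
  assumes g: "summable (\<lambda>n. (g n)\<^sup>2)"
  shows "summable (\<lambda>n. (c * g n)\<^sup>2)" "(\<Sum>n. (c * g n)\<^sup>2) = c\<^sup>2 * (\<Sum>n. (g n)\<^sup>2)"
  using g by (simp_all add: power_mult_distrib summable_mult suminf_mult)

context diagonal_operator
begin

text \<open>
  The modal equations together with square-summable bounds make the series a solution. The bound on
  \<open>L n * a n t\<close> may degenerate as \<open>t\<close> tends to 0, where the solution is in the domain of the
  operator only if the initial value is; under a uniform bound the solution is \<open>C\<^sup>1\<close> up to \<open>t = 0\<close>.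
\<close>

lemma series_solution:
  fixes a z b :: "nat \<Rightarrow> real \<Rightarrow> real" and f :: "real \<Rightarrow> 'h"
  defines "y \<equiv> \<lambda>t. \<Sum>n. a n t *\<^sub>R e n"
  assumes init: "\<And>n. a n 0 = inner y0 (e n)" "\<And>n. z n 0 = 0"
    and da: "\<And>n t. t \<ge> 0 \<Longrightarrow> (a n has_real_derivative (b n t - L n * (a n t + z n t))) (at t within {0..})"
    and dz: "\<And>n t. t \<ge> 0 \<Longrightarrow> (z n has_real_derivative (a n t - \<delta> * z n t)) (at t within {0..})"
    and f: "\<And>n t. t \<ge> 0 \<Longrightarrow> inner (f t) (e n) = b n t" and b_cont: "\<And>n. continuous_on {0..} (b n)"
    and g: "summable (\<lambda>n. (g n)\<^sup>2)"
    and a_le: "\<And>n t. t \<ge> 0 \<Longrightarrow> \<bar>a n t\<bar> \<le> g n"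
    and z_le: "\<And>n t. t \<ge> 0 \<Longrightarrow> \<bar>L n * z n t\<bar> \<le> g n"
    and b_le: "\<And>n t. t \<ge> 0 \<Longrightarrow> \<bar>b n t\<bar> \<le> g n"
    and La_le: "\<And>n t \<epsilon>. \<epsilon> > 0 \<Longrightarrow> t \<ge> \<epsilon> \<Longrightarrow> \<bar>L n * a n t\<bar> \<le> c \<epsilon> * g n"
  shows "y 0 = y0"
    and "continuous_on {0..} y"
    and "\<exists>y'. has_C1_derivative_on y y' {0<..} \<and> (\<forall>t>0. y t \<in> D \<and>
        (\<exists>I. ((\<lambda>s. memory_kernel \<delta> (t - s) *\<^sub>R A (y s)) has_integral I) {0..t} \<and> y' t + A (y t) + I = f t))"
    and "\<And>g1. summable (\<lambda>n. (g1 n)\<^sup>2) \<Longrightarrow> (\<And>n t. t \<ge> 0 \<Longrightarrow> \<bar>L n * a n t\<bar> \<le> g1 n)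
        \<Longrightarrow> \<exists>y'. has_C1_derivative_on y y' {0..}"
proof -
  have a_cont: "continuous_on {0..} (a n)" and z_cont: "continuous_on {0..} (z n)" for n
    using da dz by (auto intro!: DERIV_continuous_on)
  show "y 0 = y0" unfolding y_def by (rule series_of_coefficients) (simp add: init)
  show "continuous_on {0..} y" unfolding y_def
    by (rule series_continuous[OF g]) (auto intro: a_le a_cont)
  define a' where "a' n t = b n t - L n * (a n t + z n t)" for n t
  have a'_cont: "continuous_on {0..} (a' n)" for n
    unfolding a'_def by (intro continuous_intros a_cont z_cont b_cont)
  define y' where "y' t = (\<Sum>n. a' n t *\<^sub>R e n)" for t
  have a'_le: "\<bar>a' n t\<bar> \<le> 2 * g n + h" if "t \<ge> 0" "\<bar>L n * a n t\<bar> \<le> h" for n t h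
  proof -
    have "a' n t = b n t - L n * a n t - L n * z n t" by (simp add: a'_def algebra_simps)
    then show ?thesis using that b_le[of t n] z_le[of t n] by linarith
  qed
  \<comment> \<open>\<open>W\<close> is the operator applied to the memory variable; it will be the value of the memory integral.\<close>
  define W where "W t = (\<Sum>n. (L n * z n t) *\<^sub>R e n)" for t
  have W_cont: "continuous_on {0..} W" unfolding W_def
    by (rule series_continuous[OF g]) (auto intro: z_le intro!: continuous_intros z_cont)
  have W0: "W 0 = 0" unfolding W_def by (simp add: init)
  have sg: "summable (\<lambda>n. (c \<epsilon> * g n)\<^sup>2)" "summable (\<lambda>n. (2 * g n + c \<epsilon> * g n)\<^sup>2)"
    "summable (\<lambda>n. (c \<epsilon> * g n + \<bar>\<delta>\<bar> * g n)\<^sup>2)" for \<epsilon>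
    by (intro summable_square_add summable_square_mult g)+
  have pos: "t \<in> {t/2<..}" "{t/2<..} \<subseteq> {0..}" "open {t/2<..}" "at t within {t/2<..} = at t"
    "\<And>s. s \<in> {t/2<..} \<Longrightarrow> s \<ge> t / 2" if "t > 0" for t :: real
    using that by (auto intro!: at_within_open)
  have yA: "y t \<in> D" "A (y t) = (\<Sum>n. (L n * a n t) *\<^sub>R e n)" if t: "t > 0" for t
    using domain_series[OF dominated_summable[OF g a_le] dominated_summable[OF sg(1) La_le[of t t]]] t
    unfolding y_def by auto
  have dy: "(y has_vector_derivative y' t) (at t)" if t: "t > 0" for t
    unfolding y_def y'_def pos(4)[OF t, symmetric]
  proof (rule series_vector_derivative[OF _ pos(1)[OF t] g _ sg(2)[of "t/2"]])
    fix n s assume s: "s \<in> {t/2<..}"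
    then have s0: "s \<ge> 0" using t by auto
    show "\<bar>a n s\<bar> \<le> g n" by (rule a_le[OF s0])
    show "\<bar>a' n s\<bar> \<le> 2 * g n + c (t/2) * g n"
      by (rule a'_le[OF s0 La_le]) (use s t in auto)
    show "(a n has_real_derivative a' n s) (at s within {t/2<..})"
      unfolding a'_def by (rule DERIV_subset[OF da[OF s0]]) (use t in auto)
  qed simp
  have y'_cont: "continuous_on {0<..} y'"
  proof -
    have "isCont y' t" if t: "t > 0" for t
    proof -
      have "continuous_on {t/2<..} y'" unfolding y'_def
        by (rule series_continuous[OF sg(2)[of "t/2"]])
          (use t in \<open>auto intro!: a'_le La_le continuous_on_subset[OF a'_cont pos(2)[OF t]]\<close>)
      then show ?thesis using pos(1,3)[OF t] by (simp add: continuous_on_eq_continuous_at)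
    qed
    then show ?thesis by (simp add: continuous_on_eq_continuous_at)
  qed
  have dW: "(W has_vector_derivative (A (y t) - \<delta> *\<^sub>R W t)) (at t)" if t: "t > 0" for t
  proof -
    have "(W has_vector_derivative (\<Sum>n. (L n * a n t - \<delta> * (L n * z n t)) *\<^sub>R e n)) (at t)"
      unfolding W_def pos(4)[OF t, symmetric]
    proof (rule series_vector_derivative[OF _ pos(1)[OF t] g _ sg(3)[of "t/2"]])
      fix n s assume s: "s \<in> {t/2<..}"
      then have s0: "s \<ge> 0" using t by auto
      show "\<bar>L n * z n s\<bar> \<le> g n" by (rule z_le[OF s0])
      have "\<bar>\<delta> * (L n * z n s)\<bar> \<le> \<bar>\<delta>\<bar> * g n"
        unfolding abs_mult[of \<delta>] by (intro mult_left_mono z_le s0) simp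
      moreover have "\<bar>L n * a n s\<bar> \<le> c (t/2) * g n" by (rule La_le) (use s t in auto)
      ultimately show "\<bar>L n * a n s - \<delta> * (L n * z n s)\<bar> \<le> c (t/2) * g n + \<bar>\<delta>\<bar> * g n"
        by linarith
      have "((\<lambda>s. L n * z n s) has_real_derivative L n * (a n s - \<delta> * z n s)) (at s within {t/2<..})"
        by (rule DERIV_cmult, rule DERIV_subset[OF dz[OF s0]]) (use t in auto)
      then show "((\<lambda>s. L n * z n s) has_real_derivative L n * a n s - \<delta> * (L n * z n s)) (at s within {t/2<..})"
        by (simp add: algebra_simps)
    qed simp
    moreover have "(\<Sum>n. (L n * a n t - \<delta> * (L n * z n t)) *\<^sub>R e n) = A (y t) - \<delta> *\<^sub>R W t"
    proof (rule series_of_coefficients)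
      fix n
      have "summable (\<lambda>n. (L n * a n t)\<^sup>2)" "summable (\<lambda>n. (L n * z n t)\<^sup>2)"
        using dominated_summable[OF sg(1) La_le[of t t]] dominated_summable[OF g z_le[of t]] t by auto
      then show "inner (A (y t) - \<delta> *\<^sub>R W t) (e n) = L n * a n t - \<delta> * (L n * z n t)"
        unfolding yA(2)[OF t] W_def by (simp add: inner_diff_left series_inner)
    qed
    ultimately show ?thesis by simp
  qed
  have memory: "((\<lambda>s. memory_kernel \<delta> (t - s) *\<^sub>R A (y s)) has_integral W t) {0..t}" if t: "t > 0" for t
  proof -
    have "((\<lambda>s. exp (\<delta> * s) *\<^sub>R A (y s)) has_integral (exp (\<delta> * t) *\<^sub>R W t - exp (\<delta> * 0) *\<^sub>R W 0)) {0..t}"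
    proof (rule fundamental_theorem_of_calculus_interior)
      show "continuous_on {0..t} (\<lambda>s. exp (\<delta> * s) *\<^sub>R W s)"
        by (intro continuous_intros continuous_on_subset[OF W_cont]) auto
      fix s assume s: "s \<in> {0<..<t}"
      have "((\<lambda>s. exp (\<delta> * s)) has_real_derivative \<delta> * exp (\<delta> * s)) (at s)"
        by (auto intro!: derivative_eq_intros)
      from has_vector_derivative_scaleR[OF this dW[of s]]
      show "((\<lambda>s. exp (\<delta> * s) *\<^sub>R W s) has_vector_derivative exp (\<delta> * s) *\<^sub>R A (y s)) (at s)"
        using s by (simp add: algebra_simps)
    qed (use t in simp)
    from has_integral_cmul[OF this, of "exp (- (\<delta> * t))"]
    show ?thesis using W0
      by (simp add: memory_kernel_def exp_add[symmetric] right_diff_distrib add.commute)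
  qed
  have equation: "y' t + A (y t) + W t = f t" if t: "t > 0" for t
  proof -
    have "inner (y' t + A (y t) + W t - f t) (e n) = 0" for n
    proof -
      have "\<bar>a' n t\<bar> \<le> 2 * g n + c t * g n" for n by (rule a'_le[OF _ La_le]) (use t in auto)
      from dominated_summable[OF sg(2) this]
      have "summable (\<lambda>n. (a' n t)\<^sup>2)" "summable (\<lambda>n. (L n * a n t)\<^sup>2)" "summable (\<lambda>n. (L n * z n t)\<^sup>2)"
        using dominated_summable[OF sg(1) La_le[of t t]] dominated_summable[OF g z_le[of t]] t by auto
      then have "inner (y' t) (e n) = a' n t" "inner (A (y t)) (e n) = L n * a n t"
        "inner (W t) (e n) = L n * z n t"
        unfolding y'_def yA(2)[OF t] W_def by (simp_all only: series_inner)
      then show ?thesis using f[of t n] t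
        by (simp add: inner_diff_left inner_add_left a'_def algebra_simps)
    qed
    then show ?thesis using orthogonal_to_basis_zero by fastforce
  qed
  show "\<exists>y'. has_C1_derivative_on y y' {0<..} \<and> (\<forall>t>0. y t \<in> D \<and>
        (\<exists>I. ((\<lambda>s. memory_kernel \<delta> (t - s) *\<^sub>R A (y s)) has_integral I) {0..t} \<and> y' t + A (y t) + I = f t))"
  proof (intro exI[of _ y'] conjI allI impI)
    show "has_C1_derivative_on y y' {0<..}"
      using y'_cont dy by (auto simp: has_C1_derivative_on_def intro: has_vector_derivative_at_within)
    fix t :: real assume t: "t > 0"
    show "y t \<in> D" by (rule yA(1)[OF t])
    show "\<exists>I. ((\<lambda>s. memory_kernel \<delta> (t - s) *\<^sub>R A (y s)) has_integral I) {0..t} \<and> y' t + A (y t) + I = f t"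
      using memory[OF t] equation[OF t] by blast
  qed
  show "\<exists>y'. has_C1_derivative_on y y' {0..}"
    if g1: "summable (\<lambda>n. (g1 n)\<^sup>2)" and le: "\<And>n t. t \<ge> 0 \<Longrightarrow> \<bar>L n * a n t\<bar> \<le> g1 n" for g1
  proof -
    have s: "summable (\<lambda>n. (2 * g n + g1 n)\<^sup>2)" by (intro summable_square_add summable_square_mult g g1)
    have "continuous_on {0..} y'" unfolding y'_def
      by (rule series_continuous[OF s]) (auto intro!: a'_le le a'_cont)
    moreover have "(y has_vector_derivative y' t) (at t within {0..})" if "t \<in> {0..}" for t
      unfolding y_def y'_def
      by (rule series_vector_derivative[OF _ that g _ s])
        (auto intro!: a_le a'_le le da[folded a'_def])
    ultimately show ?thesis unfolding has_C1_derivative_on_def by blast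
  qed
qed

end

section \<open>Decay of the controlled solution\<close>

text \<open>
  The factors with which \<open>\<xi>\<^sub>+\<close> and \<open>\<xi>\<^sub>-\<close> enter the mode are bounded uniformly in \<open>n\<close>. All except
  \<open>(\<lambda>\<^sub>n - \<mu>\<^sub>n\<^sup>-) / (\<mu>\<^sub>n\<^sup>+ - \<mu>\<^sub>n\<^sup>-)\<close> remain so after multiplication by \<open>\<lambda>\<^sub>n\<close>, since the gap in the
  denominator grows linearly.
\<close>

lemma modal_coefficient_bound:
  fixes L :: "nat \<Rightarrow> real"
  assumes \<delta>: "\<delta> > 0" and L: "\<And>n. L n > 0" and lim: "filterlim L at_top sequentially"
    and ne: "\<And>n. mu_plus \<delta> (L n) \<noteq> mu_minus \<delta> (L n)"
  shows "\<exists>K\<ge>0. \<forall>n. cmod (of_real (L n) - mu_minus \<delta> (L n)) + (1 + L n) * cmod (of_real \<delta> - mu_minus \<delta> (L n)) + L n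
      \<le> K * cmod (mu_plus \<delta> (L n) - mu_minus \<delta> (L n))"
proof -
  define d where "d n = cmod (mu_plus \<delta> (L n) - mu_minus \<delta> (L n))" for n
  have d: "d n > 0" for n using ne[of n] by (simp add: d_def)
  from lim obtain n0 where n0: "\<And>n. n \<ge> n0 \<Longrightarrow> L n \<ge> 4 * \<delta> + 8"
    unfolding filterlim_at_top eventually_sequentially by blast
  \<comment> \<open>4 works for the large eigenvalues, and the sum dominates each of the finitely many others.\<close>
  define K0 where "K0 = 4 + (\<Sum>n<n0. (1 + L n) / d n)"
  have pos: "(1 + L n) / d n \<ge> 0" for n using d[of n] L[of n] by simp
  have K0: "1 + L n \<le> K0 * d n" for n
  proof -
    have "(1 + L n) / d n \<le> K0"
    proof (cases "n < n0")
      case True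
      then have "(1 + L n) / d n \<le> (\<Sum>n<n0. (1 + L n) / d n)"
        using pos by (intro member_le_sum) auto
      then show ?thesis by (simp add: K0_def)
    next
      case False
      then have big: "L n \<ge> 4 * \<delta> + 8" using n0 by simp
      have "d n \<ge> L n / 2" unfolding d_def by (rule cmod_mu_diff_ge[OF \<delta> big])
      moreover have "4 * (L n / 2) \<ge> 1 + L n" using big \<delta> by simp
      ultimately have "(1 + L n) / d n \<le> 4" using d[of n] by (simp add: divide_le_eq)
      also have "4 \<le> K0" unfolding K0_def using pos by (simp add: sum_nonneg)
      finally show ?thesis .
    qed
    then show ?thesis using d[of n] by (simp add: divide_le_eq)
  qed
  define c where "c = 2 * (1 + \<delta>)"
  have c: "c \<ge> 0" using \<delta> by (simp add: c_def)
  have "cmod (of_real (L n) - mu_minus \<delta> (L n)) + (1 + L n) * cmod (of_real \<delta> - mu_minus \<delta> (L n)) + L n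
      \<le> (2 + 2 * c + \<delta>) * K0 * d n" for n
  proof -
    have m: "cmod (mu_minus \<delta> (L n)) \<le> c" unfolding c_def by (rule cmod_mu_minus_le[OF \<delta> L])
    have "cmod (of_real (L n) - mu_minus \<delta> (L n)) \<le> L n + c"
      using norm_triangle_ineq4[of "complex_of_real (L n)" "mu_minus \<delta> (L n)"] m L[of n] by simp
    moreover have "cmod (of_real \<delta> - mu_minus \<delta> (L n)) \<le> \<delta> + c"
      using norm_triangle_ineq4[of "complex_of_real \<delta>" "mu_minus \<delta> (L n)"] m \<delta> by simp
    then have "(1 + L n) * cmod (of_real \<delta> - mu_minus \<delta> (L n)) \<le> (1 + L n) * (\<delta> + c)"
      using L[of n] by (intro mult_left_mono) auto
    moreover have "c \<le> c * (1 + L n)" using mult_left_mono[of 1 "1 + L n" c] c L[of n] by simp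
    ultimately have "cmod (of_real (L n) - mu_minus \<delta> (L n)) + (1 + L n) * cmod (of_real \<delta> - mu_minus \<delta> (L n)) + L n
       \<le> (2 + 2 * c + \<delta>) * (1 + L n)" by (simp add: algebra_simps)
    also have "\<dots> \<le> (2 + 2 * c + \<delta>) * (K0 * d n)"
      using K0[of n] c \<delta> by (intro mult_left_mono) auto
    finally show ?thesis by (simp add: mult.assoc)
  qed
  moreover have "(2 + 2 * c + \<delta>) * K0 \<ge> 0"
    using c \<delta> pos by (intro mult_nonneg_nonneg) (auto simp: K0_def intro!: add_nonneg_nonneg sum_nonneg)
  ultimately show ?thesis unfolding d_def by blast
qed

lemma mode_bounds:
  assumes x: "x > 0" and ne: "mu_plus \<delta> x \<noteq> mu_minus \<delta> x"
    and K: "cmod (of_real x - mu_minus \<delta> x) + (1 + x) * cmod (of_real \<delta> - mu_minus \<delta> x) + x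
      \<le> K * cmod (mu_plus \<delta> x - mu_minus \<delta> x)"
    and P: "cmod (duhamel (mu_plus \<delta> x) a b t) \<le> p" and Q: "cmod (duhamel (mu_minus \<delta> x) a b t) \<le> p"
  shows "\<bar>mode_y \<delta> x a b t\<bar> \<le> K * p"
    and "\<bar>x * mode_z \<delta> x a b t\<bar> \<le> 2 * K * p"
    and "x * cmod (duhamel (mu_plus \<delta> x) a b t) \<le> p' \<Longrightarrow> \<bar>x * mode_y \<delta> x a b t\<bar> \<le> K * (p' + p)"
proof -
  let ?P = "duhamel (mu_plus \<delta> x) a b t" and ?Q = "duhamel (mu_minus \<delta> x) a b t"
  define d where "d = cmod (mu_plus \<delta> x - mu_minus \<delta> x)"
  define u where "u = cmod (of_real x - mu_minus \<delta> x)"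
  define v where "v = cmod (of_real \<delta> - mu_minus \<delta> x)"
  have d: "d > 0" using ne by (simp add: d_def)
  have uv: "u \<ge> 0" "v \<ge> 0" "x * v \<ge> 0" using x by (simp_all add: u_def v_def)
  have K': "u + (v + x * v) + x \<le> K * d" using K unfolding u_def v_def d_def by (simp add: algebra_simps)
  have p: "p \<ge> 0" using P norm_ge_zero order_trans by blast
  have Y: "\<bar>mode_y \<delta> x a b t\<bar> \<le> (u * cmod ?P + v * cmod ?Q) / d"
  proof -
    have "\<bar>mode_y \<delta> x a b t\<bar> \<le> cmod ((of_real x - mu_minus \<delta> x) * ?P + (of_real \<delta> - mu_minus \<delta> x) * ?Q) / d"
      unfolding mode_y_def d_def norm_divide[symmetric] by (rule abs_Re_le_cmod)
    also have "\<dots> \<le> (u * cmod ?P + v * cmod ?Q) / d"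
      unfolding u_def v_def norm_mult[symmetric] using d
      by (intro divide_right_mono norm_triangle_ineq) simp
    finally show ?thesis .
  qed
  have "u * cmod ?P + v * cmod ?Q \<le> u * p + v * p" using P Q uv by (intro add_mono mult_left_mono) auto
  also have "\<dots> \<le> (K * d) * p" unfolding distrib_right[symmetric] using K' uv x p by (intro mult_right_mono; linarith)
  finally have "u * cmod ?P + v * cmod ?Q \<le> (K * p) * d" by (simp add: mult_ac)
  then show "\<bar>mode_y \<delta> x a b t\<bar> \<le> K * p" using Y d by (meson divide_le_eq order_trans)
  have "\<bar>mode_z \<delta> x a b t\<bar> \<le> cmod (?Q - ?P) / d"
    unfolding mode_z_def d_def norm_divide[symmetric] by (rule abs_Re_le_cmod)
  also have "\<dots> \<le> 2 * p / d"
    using norm_triangle_ineq4[of ?Q ?P] P Q d by (intro divide_right_mono) auto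
  finally have "x * \<bar>mode_z \<delta> x a b t\<bar> \<le> x * (2 * p / d)" using x by (intro mult_left_mono) auto
  moreover have "x * (2 * p) \<le> (K * d) * (2 * p)" using K' uv p by (intro mult_right_mono; linarith)
  then have "x * (2 * p / d) \<le> 2 * K * p" using d by (simp add: divide_le_eq mult_ac)
  ultimately show "\<bar>x * mode_z \<delta> x a b t\<bar> \<le> 2 * K * p" using x by (simp add: abs_mult)
  assume p': "x * cmod ?P \<le> p'"
  have p'0: "p' \<ge> 0" using p' x by (meson less_imp_le mult_nonneg_nonneg norm_ge_zero order_trans)
  have "x * (u * cmod ?P + v * cmod ?Q) = u * (x * cmod ?P) + (x * v) * cmod ?Q" by (simp add: algebra_simps)
  also have "\<dots> \<le> u * p' + (x * v) * p" using p' Q uv by (intro add_mono mult_left_mono) auto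
  also have "\<dots> \<le> (K * d) * p' + (K * d) * p"
    using K' uv x p p'0 by (intro add_mono mult_right_mono; linarith)
  finally have "x * ((u * cmod ?P + v * cmod ?Q) / d) \<le> K * (p' + p)"
    using d by (simp add: divide_le_eq algebra_simps)
  moreover have "\<bar>x * mode_y \<delta> x a b t\<bar> \<le> x * ((u * cmod ?P + v * cmod ?Q) / d)"
    using mult_left_mono[OF Y, of x] x by (simp add: abs_mult)
  ultimately show "\<bar>x * mode_y \<delta> x a b t\<bar> \<le> K * (p' + p)" by linarith
qed

text \<open>
  Smoothing: at positive times the decay of a mode absorbs a factor \<open>\<lambda>\<^sub>n\<close>.
\<close>

lemma mult_exp_neg_le:
  fixes x t :: real
  assumes "x > 0" "t > 0"
  shows "x * exp (- (x / 2 * t)) \<le> 2 / t"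
proof -
  have "x / 2 * t \<le> exp (x / 2 * t)" using exp_ge_add_one_self[of "x / 2 * t"] by linarith
  then show ?thesis using assms by (simp add: exp_minus field_simps)
qed

context diagonal_operator
begin

text \<open>
  A solution with real values, regarded as one in the complexification.
\<close>

lemma embed_solution:
  assumes init: "y 0 = y0" and cont: "continuous_on {0..} y"
    and sol: "\<exists>y'. has_C1_derivative_on y y' {0<..} \<and> (\<forall>t>0. y t \<in> D \<and>
        (\<exists>I. ((\<lambda>s. memory_kernel \<delta> (t - s) *\<^sub>R A (y s)) has_integral I) {0..t} \<and> y' t + A (y t) + I = f t))"
    and u: "\<And>t. map_prod B B (u t) = (f t, 0)"
  shows "memory_solution D A B \<delta> u y0 (\<lambda>t. (y t, 0))"
proof -
  from sol obtain y' where C1: "has_C1_derivative_on y y' {0<..}"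
    and eq: "\<And>t. t > 0 \<Longrightarrow> y t \<in> D \<and>
        (\<exists>I. ((\<lambda>s. memory_kernel \<delta> (t - s) *\<^sub>R A (y s)) has_integral I) {0..t} \<and> y' t + A (y t) + I = f t)"
    by blast
  have "has_C1_derivative_on (\<lambda>t. (y t, 0 :: 'h)) (\<lambda>t. (y' t, 0)) {0<..}"
    using C1 unfolding has_C1_derivative_on_def
    by (auto intro!: continuous_on_Pair has_vector_derivative_Pair)
  moreover have "(y t, 0) \<in> D \<times> D \<and>
          (\<lambda>s. memory_kernel \<delta> (t - s) *\<^sub>R map_prod A A (y s, 0)) integrable_on {0..t} \<and>
          (y' t, 0) + map_prod A A (y t, 0)
            + integral {0..t} (\<lambda>s. memory_kernel \<delta> (t - s) *\<^sub>R map_prod A A (y s, 0))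
          = map_prod B B (u t)" if t: "t > 0" for t
  proof -
    from eq[OF t] obtain I where yD: "y t \<in> D"
      and I: "((\<lambda>s. memory_kernel \<delta> (t - s) *\<^sub>R A (y s)) has_integral I) {0..t}"
      and e: "y' t + A (y t) + I = f t" by blast
    have "bounded_linear (\<lambda>x :: 'h. (x, 0 :: 'h))"
      by (intro bounded_linear_Pair bounded_linear_ident bounded_linear_zero)
    from has_integral_linear[OF I this]
    have I2: "((\<lambda>s. memory_kernel \<delta> (t - s) *\<^sub>R map_prod A A (y s, 0)) has_integral (I, 0)) {0..t}"
      by (simp add: o_def zero_in_domain)
    show ?thesis
    proof (intro conjI)
      show "(y t, 0) \<in> D \<times> D" using yD zero_in_domain by simp
      show "(\<lambda>s. memory_kernel \<delta> (t - s) *\<^sub>R map_prod A A (y s, 0)) integrable_on {0..t}"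
        by (rule has_integral_integrable[OF I2])
      show "(y' t, 0) + map_prod A A (y t, 0)
          + integral {0..t} (\<lambda>s. memory_kernel \<delta> (t - s) *\<^sub>R map_prod A A (y s, 0)) = map_prod B B (u t)"
        unfolding integral_unique[OF I2] u using e zero_in_domain by simp
    qed
  qed
  ultimately show ?thesis using init cont unfolding memory_solution_def
    by (intro conjI exI[of _ "\<lambda>t. (y' t, 0)"]) (auto simp: real_part_embed_def intro!: continuous_on_Pair)
qed

text \<open>
  The square root collects the coefficients of the initial value and of the vectors \<open>h i\<close> through
  which the controls act; the factor \<open>exp(\<gamma> T)\<close> accounts for the time before the controls
  stop.
\<close>

definition decay_const :: "real \<Rightarrow> real \<Rightarrow> real \<Rightarrow> real \<Rightarrow> nat \<Rightarrow> (nat \<Rightarrow> 'h) \<Rightarrow> real" where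
  "decay_const K \<gamma> T \<kappa> M h = K * (exp (\<gamma> * T) *
     sqrt (2 + 2 * ((T + 1) * \<kappa>)\<^sup>2 * (\<Sum>n. (\<Sum>i<M. \<bar>inner (h i) (e n)\<bar>)\<^sup>2)))"

text \<open>
  Modes beyond \<open>N\<close> decay by themselves; modes below \<open>N\<close> are bounded up to time \<open>T\<close> and vanish
  afterwards. Both are covered by the bound \<open>exp(-\<gamma> t) g\<^sub>n\<close>, with \<open>g\<close> square-summable and
  its norm proportional to that of the initial value.
\<close>

lemma stabilized_by_null_control:
  fixes V :: "nat \<Rightarrow> real \<Rightarrow> real" and h :: "nat \<Rightarrow> 'h"
  assumes \<delta>: "\<delta> > 0" and \<gamma>: "\<gamma> \<ge> 0" and T: "T \<ge> 0" and K: "K \<ge> 0" and \<kappa>: "\<kappa> \<ge> 0"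
    and ne: "\<And>n. mu_plus \<delta> (L n) \<noteq> mu_minus \<delta> (L n)"
    and K_bound: "\<And>n. cmod (of_real (L n) - mu_minus \<delta> (L n)) + (1 + L n) * cmod (of_real \<delta> - mu_minus \<delta> (L n)) + L n
      \<le> K * cmod (mu_plus \<delta> (L n) - mu_minus \<delta> (L n))"
    and stable: "\<And>n. n \<ge> N \<Longrightarrow> \<gamma> \<le> Re (mu_plus \<delta> (L n)) \<and> \<gamma> \<le> Re (mu_minus \<delta> (L n))"
    and V_cont: "\<And>i. continuous_on {0..} (V i)" and V_zero: "\<And>i s. s \<ge> T \<Longrightarrow> V i s = 0"
    and V_bound: "\<And>i s. i < M \<Longrightarrow> s \<ge> 0 \<Longrightarrow> \<bar>V i s\<bar> \<le> \<kappa> * norm y0"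
    and moments: "\<And>n \<mu>. n < N \<Longrightarrow> \<mu> = mu_plus \<delta> (L n) \<or> \<mu> = mu_minus \<delta> (L n) \<Longrightarrow>
      integral {0..T} (\<lambda>s. exp (\<mu> * of_real s) * of_real (\<Sum>i<M. V i s * inner (h i) (e n)))
        = - complex_of_real (inner y0 (e n))"
    and u: "\<And>t. map_prod B B (u t) = (\<Sum>i<M. V i t *\<^sub>R h i, 0)"
  shows "stabilized_by D A B \<delta> \<gamma> (decay_const K \<gamma> T \<kappa> M h) y0 u"
proof -
  define x where "x n = inner y0 (e n)" for n
  define b where "b n t = (\<Sum>i<M. V i t * inner (h i) (e n))" for n t
  define \<rho> where "\<rho> n = (\<Sum>i<M. \<bar>inner (h i) (e n)\<bar>)" for n
  define \<beta> where "\<beta> n = \<kappa> * norm y0 * \<rho> n" for n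
  define g where "g n = exp (\<gamma> * T) * (\<bar>x n\<bar> + (T + 1) * \<beta> n)" for n
  have \<rho>0: "\<rho> n \<ge> 0" for n unfolding \<rho>_def by (rule sum_nonneg) simp
  have \<beta>0: "\<beta> n \<ge> 0" for n unfolding \<beta>_def using \<rho>0 \<kappa> by simp
  have \<rho>_sum: "summable (\<lambda>n. (\<rho> n)\<^sup>2)"
    unfolding \<rho>_def
  proof (induction M)
    case (Suc k)
    then show ?case
      using summable_square_add(1)[of "\<lambda>n. \<Sum>i<k. \<bar>inner (h i) (e n)\<bar>" "\<lambda>n. \<bar>inner (h k) (e n)\<bar>"]
        bessel_summable[of "h k"] by simp
  qed simp
  have x_sum: "summable (\<lambda>n. \<bar>x n\<bar>\<^sup>2)" unfolding x_def using bessel_summable[of y0] by simp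
  have g_alt: "g n = exp (\<gamma> * T) * (\<bar>x n\<bar> + (T + 1) * \<kappa> * norm y0 * \<rho> n)" for n
    by (simp add: g_def \<beta>_def)
  have g_sum: "summable (\<lambda>n. (g n)\<^sup>2)"
    unfolding g_alt by (intro summable_square_mult summable_square_add x_sum \<rho>_sum)
  have g_total: "(\<Sum>n. (g n)\<^sup>2) \<le> (exp (\<gamma> * T))\<^sup>2 * ((norm y0)\<^sup>2 * (2 + 2 * ((T + 1) * \<kappa>)\<^sup>2 * (\<Sum>n. (\<rho> n)\<^sup>2)))"
  proof -
    have s: "summable (\<lambda>n. ((T + 1) * \<kappa> * norm y0 * \<rho> n)\<^sup>2)" by (intro summable_square_mult \<rho>_sum)
    have "(\<Sum>n. (g n)\<^sup>2) = (exp (\<gamma> * T))\<^sup>2 * (\<Sum>n. (\<bar>x n\<bar> + (T + 1) * \<kappa> * norm y0 * \<rho> n)\<^sup>2)"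
      unfolding g_alt by (rule summable_square_mult(2)[OF summable_square_add(1)[OF x_sum s]])
    also have "\<dots> \<le> (exp (\<gamma> * T))\<^sup>2 * (2 * (\<Sum>n. \<bar>x n\<bar>\<^sup>2) + 2 * (\<Sum>n. ((T + 1) * \<kappa> * norm y0 * \<rho> n)\<^sup>2))"
      by (intro mult_left_mono summable_square_add(2)[OF x_sum s]) simp
    also have "(\<Sum>n. ((T + 1) * \<kappa> * norm y0 * \<rho> n)\<^sup>2) = ((T + 1) * \<kappa> * norm y0)\<^sup>2 * (\<Sum>n. (\<rho> n)\<^sup>2)"
      by (rule summable_square_mult(2)[OF \<rho>_sum])
    also have "(exp (\<gamma> * T))\<^sup>2 * (2 * (\<Sum>n. \<bar>x n\<bar>\<^sup>2) + 2 * (((T + 1) * \<kappa> * norm y0)\<^sup>2 * (\<Sum>n. (\<rho> n)\<^sup>2)))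
      \<le> (exp (\<gamma> * T))\<^sup>2 * (2 * (norm y0)\<^sup>2 + 2 * (((T + 1) * \<kappa> * norm y0)\<^sup>2 * (\<Sum>n. (\<rho> n)\<^sup>2)))"
      using bessel[of y0] by (intro mult_left_mono add_right_mono) (simp_all add: x_def)
    also have "\<dots> = (exp (\<gamma> * T))\<^sup>2 * ((norm y0)\<^sup>2 * (2 + 2 * ((T + 1) * \<kappa>)\<^sup>2 * (\<Sum>n. (\<rho> n)\<^sup>2)))"
      unfolding power_mult_distrib[of "(T + 1) * \<kappa>" "norm y0"] by (simp add: algebra_simps)
    finally show ?thesis .
  qed
  have e1: "1 \<le> exp (\<gamma> * T)" using \<gamma> T by simp
  have g0: "\<bar>x n\<bar> + (T + 1) * \<beta> n \<le> g n" for n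
    using mult_right_mono[OF e1, of "\<bar>x n\<bar> + (T + 1) * \<beta> n"] T \<beta>0[of n] by (simp add: g_def)
  have Tb: "T * \<beta> n \<ge> 0" for n using T \<beta>0[of n] by simp
  have xg: "\<bar>x n\<bar> \<le> g n" and \<beta>g: "\<beta> n \<le> g n" and g_nonneg: "g n \<ge> 0" for n
    using g0[of n] Tb[of n] \<beta>0[of n] abs_ge_zero[of "x n"] unfolding distrib_right by linarith+
  have b_cont: "continuous_on {0..} (b n)" for n
    unfolding b_def by (intro continuous_intros V_cont)
  have b_zero: "b n s = 0" if "s \<ge> T" for n s using V_zero[OF that] by (simp add: b_def)
  have b_le: "\<bar>b n s\<bar> \<le> \<beta> n" if "s \<ge> 0" for n s
  proof -
    have "\<bar>b n s\<bar> \<le> (\<Sum>i<M. \<bar>V i s * inner (h i) (e n)\<bar>)" unfolding b_def by (rule sum_abs)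
    also have "\<dots> \<le> (\<Sum>i<M. \<kappa> * norm y0 * \<bar>inner (h i) (e n)\<bar>)"
      unfolding abs_mult using V_bound that by (intro sum_mono mult_right_mono) auto
    also have "\<dots> = \<beta> n" by (simp add: \<beta>_def \<rho>_def sum_distrib_left)
    finally show ?thesis .
  qed
  have decay: "cmod (duhamel \<mu> (x n) (b n) t) \<le> exp (- (\<gamma> * t)) * g n"
    if t: "t \<ge> 0" and \<mu>: "\<mu> = mu_plus \<delta> (L n) \<or> \<mu> = mu_minus \<delta> (L n)" for \<mu> n t
  proof (cases "n < N")
    case False
    then have "\<gamma> \<le> Re \<mu>" using stable[of n] \<mu> by auto
    from duhamel_bound_decay[OF b_cont[of n] t \<gamma> this b_le T b_zero]
    have "cmod (duhamel \<mu> (x n) (b n) t) \<le> exp (- (\<gamma> * t)) * (\<bar>x n\<bar> + exp (\<gamma> * T) * T * \<beta> n)" by blast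
    also have "\<bar>x n\<bar> + exp (\<gamma> * T) * T * \<beta> n \<le> g n"
    proof -
      have "\<bar>x n\<bar> \<le> exp (\<gamma> * T) * \<bar>x n\<bar>" using mult_right_mono[OF e1, of "\<bar>x n\<bar>"] by simp
      moreover have "exp (\<gamma> * T) * \<beta> n \<ge> 0" using \<beta>0 by simp
      ultimately show ?thesis by (simp add: g_def algebra_simps)
    qed
    finally show ?thesis by (simp add: mult_left_mono)
  next
    case True
    show ?thesis
    proof (cases "T \<le> t")
      case True
      have "duhamel \<mu> (x n) (b n) t = 0"
        by (rule duhamel_null[OF b_cont T True b_zero])
          (use moments[OF \<open>n < N\<close> \<mu>] in \<open>simp_all add: b_def x_def\<close>)
      then show ?thesis using g_nonneg[of n] by simp
    next
      case False
      have "0 \<le> Re \<mu>"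
        using \<mu> Re_mu_minus_pos[OF \<delta> L_pos[of n]] Re_mu_plus_ge[of "L n" \<delta>] \<delta> L_pos[of n] by auto
      from duhamel_bound_decay[OF b_cont[of n] t order_refl this b_le T b_zero, where a = "x n"]
      have "cmod (duhamel \<mu> (x n) (b n) t) \<le> \<bar>x n\<bar> + T * \<beta> n" by simp
      also have "\<dots> \<le> \<bar>x n\<bar> + (T + 1) * \<beta> n" using \<beta>0[of n] by (simp add: algebra_simps)
      also have "\<dots> \<le> exp (- (\<gamma> * t)) * g n"
      proof -
        have "\<gamma> * t \<le> \<gamma> * T" using False \<gamma> by (intro mult_left_mono) auto
        then have "1 \<le> exp (- (\<gamma> * t)) * exp (\<gamma> * T)" by (simp add: exp_add[symmetric])
        from mult_right_mono[OF this, of "\<bar>x n\<bar> + (T + 1) * \<beta> n"]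
        show ?thesis using T \<beta>0[of n] by (simp add: g_def mult.assoc)
      qed
      finally show ?thesis .
    qed
  qed
  have exp_le1: "exp (- (\<gamma> * t)) * g n \<le> g n" if "t \<ge> 0" for t n
    using mult_right_mono[of "exp (- (\<gamma> * t))" 1 "g n"] that \<gamma> g_nonneg[of n] by simp
  have bound: "cmod (duhamel \<mu> (x n) (b n) t) \<le> g n"
    if t: "t \<ge> 0" and \<mu>: "\<mu> = mu_plus \<delta> (L n) \<or> \<mu> = mu_minus \<delta> (L n)" for \<mu> n t
    using decay[OF t \<mu>] exp_le1[OF t] by (rule order_trans)
  have decay': "cmod (duhamel (mu_plus \<delta> (L n)) (x n) (b n) t) \<le> exp (- (\<gamma> * t)) * g n"
      "cmod (duhamel (mu_minus \<delta> (L n)) (x n) (b n) t) \<le> exp (- (\<gamma> * t)) * g n"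
    and bound': "cmod (duhamel (mu_plus \<delta> (L n)) (x n) (b n) t) \<le> g n"
      "cmod (duhamel (mu_minus \<delta> (L n)) (x n) (b n) t) \<le> g n" if "t \<ge> 0" for n t
    using decay[OF that] bound[OF that] by blast+
  have parabolic: "L n * cmod (duhamel (mu_plus \<delta> (L n)) (x n) (b n) t)
      \<le> L n * exp (- (L n / 2 * t)) * \<bar>x n\<bar> + 2 * \<beta> n" if t: "t \<ge> 0" for n t
  proof -
    have "L n / 2 \<le> Re (mu_plus \<delta> (L n))" using Re_mu_plus_ge[of "L n" \<delta>] \<delta> by simp
    from duhamel_bound_parabolic[OF b_cont[of n] t _ this b_le]
    have "cmod (duhamel (mu_plus \<delta> (L n)) (x n) (b n) t) \<le> exp (- (L n / 2 * t)) * \<bar>x n\<bar> + \<beta> n / (L n / 2)"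
      using L_pos[of n] by simp
    then have "L n * cmod (duhamel (mu_plus \<delta> (L n)) (x n) (b n) t)
        \<le> L n * (exp (- (L n / 2 * t)) * \<bar>x n\<bar> + \<beta> n / (L n / 2))"
      using L_pos[of n] by (intro mult_left_mono) auto
    also have "\<dots> = L n * exp (- (L n / 2 * t)) * \<bar>x n\<bar> + 2 * \<beta> n"
      using L_pos[of n] by (simp add: field_simps)
    finally show ?thesis .
  qed
  define ym where "ym n = mode_y \<delta> (L n) (x n) (b n)" for n
  define zm where "zm n = mode_z \<delta> (L n) (x n) (b n)" for n
  note mb = mode_bounds[OF L_pos ne K_bound]
  define f where "f t = (\<Sum>i<M. V i t *\<^sub>R h i)" for t
  \<comment> \<open>A common bound for \<open>y\<^sub>n\<close>, \<open>\<lambda>\<^sub>n z\<^sub>n\<close> and \<open>b\<^sub>n\<close>.\<close>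
  define G where "G n = (2 * K + 1) * g n" for n
  have G_sum: "summable (\<lambda>n. (G n)\<^sup>2)" unfolding G_def by (rule summable_square_mult(1)[OF g_sum])
  have G1: "K * g n \<le> G n" "2 * K * g n \<le> G n" "g n \<le> G n" for n
    using K g_nonneg[of n] mult_nonneg_nonneg[OF K g_nonneg[of n]] unfolding G_def by (auto simp: algebra_simps)
  define y where "y t = (\<Sum>n. ym n t *\<^sub>R e n)" for t
  have init: "ym n 0 = inner y0 (e n)" "zm n 0 = 0" for n
    using mode_initial[OF ne[of n]] by (simp_all add: ym_def zm_def x_def)
  have dym: "(ym n has_real_derivative (b n t - L n * (ym n t + zm n t))) (at t within {0..})"
    and dzm: "(zm n has_real_derivative (ym n t - \<delta> * zm n t)) (at t within {0..})" if "t \<ge> 0" for n t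
    unfolding ym_def zm_def using mode_deriv[OF ne[of n] b_cont that] by auto
  have fb: "inner (f t) (e n) = b n t" for n t by (simp add: f_def b_def inner_sum_left)
  have ym_le: "\<bar>ym n t\<bar> \<le> G n" if "t \<ge> 0" for n t
    unfolding ym_def using mb(1)[OF bound'[OF that, of n]] G1(1)[of n] by (rule order_trans)
  have zm_le: "\<bar>L n * zm n t\<bar> \<le> G n" if "t \<ge> 0" for n t
    unfolding zm_def using mb(2)[OF bound'[OF that, of n]] G1(2)[of n] by (rule order_trans)
  have b_le': "\<bar>b n t\<bar> \<le> G n" if "t \<ge> 0" for n t
    using b_le[OF that, of n] \<beta>g[of n] G1(3)[of n] by linarith
  have Lym: "\<bar>L n * ym n t\<bar> \<le> K * (p' + g n)"
    if "t \<ge> 0" "L n * cmod (duhamel (mu_plus \<delta> (L n)) (x n) (b n) t) \<le> p'" for n t p'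
    unfolding ym_def by (rule mb(3)[OF bound'[OF that(1)] that(2)])
  have Lym_le: "\<bar>L n * ym n t\<bar> \<le> (2 / \<epsilon> + 3) * G n" if \<epsilon>: "\<epsilon> > 0" and t: "t \<ge> \<epsilon>" for n t \<epsilon>
  proof -
    have t0: "t > 0" using \<epsilon> t by simp
    have "L n * exp (- (L n / 2 * t)) \<le> 2 / t" by (rule mult_exp_neg_le[OF L_pos t0])
    also have "\<dots> \<le> 2 / \<epsilon>" using \<epsilon> t by (intro divide_left_mono) auto
    finally have "L n * exp (- (L n / 2 * t)) * \<bar>x n\<bar> \<le> 2 / \<epsilon> * g n"
      using xg[of n] \<epsilon> by (intro mult_mono) auto
    then have "L n * cmod (duhamel (mu_plus \<delta> (L n)) (x n) (b n) t) \<le> 2 / \<epsilon> * g n + 2 * g n"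
      using parabolic[of t n] t0 \<beta>g[of n] by simp
    from Lym[OF _ this] have "\<bar>L n * ym n t\<bar> \<le> (2 / \<epsilon> + 3) * (K * g n)"
      using t0 by (simp add: algebra_simps)
    also have "\<dots> \<le> (2 / \<epsilon> + 3) * G n" using G1(1)[of n] \<epsilon> by (intro mult_left_mono) auto
    finally show ?thesis .
  qed
  note sol = series_solution[where a = ym and z = zm and b = b and f = f and g = G and \<delta> = \<delta>
      and c = "\<lambda>\<epsilon>. 2 / \<epsilon> + 3" and ?y0.0 = y0, folded y_def,
      OF init dym dzm fb b_cont G_sum ym_le zm_le b_le' Lym_le]
  have ms: "memory_solution D A B \<delta> u y0 (\<lambda>t. (y t, 0))"
    by (rule embed_solution[OF sol(1) sol(2) sol(3)]) (simp_all add: u f_def)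
  have regular: "\<exists>y'. has_C1_derivative_on (\<lambda>t. (y t, 0 :: 'h)) y' {0..}" if y0: "y0 \<in> D"
  proof -
    define g1 where "g1 n = K * (\<bar>inner (A y0) (e n)\<bar> + 3 * g n)" for n
    have "summable (\<lambda>n. (g1 n)\<^sup>2)" unfolding g1_def
      by (intro summable_square_mult summable_square_add g_sum) (simp add: bessel_summable)
    moreover have "\<bar>L n * ym n t\<bar> \<le> g1 n" if t: "t \<ge> 0" for n t
    proof -
      have "L n * exp (- (L n / 2 * t)) \<le> L n * 1"
        using L_pos[of n] t by (intro mult_left_mono) (auto intro: mult_nonneg_nonneg less_imp_le)
      then have "L n * exp (- (L n / 2 * t)) * \<bar>x n\<bar> \<le> L n * \<bar>x n\<bar>"
        using mult_right_mono[of "L n * exp (- (L n / 2 * t))" "L n" "\<bar>x n\<bar>"] by simp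
      also have "\<dots> = \<bar>inner (A y0) (e n)\<bar>"
        using L_pos[of n] by (simp add: inner_operator[OF y0] x_def abs_mult)
      finally have "L n * cmod (duhamel (mu_plus \<delta> (L n)) (x n) (b n) t) \<le> \<bar>inner (A y0) (e n)\<bar> + 2 * g n"
        using parabolic[OF t, of n] \<beta>g[of n] by simp
      from Lym[OF t this] show ?thesis by (simp add: g1_def algebra_simps)
    qed
    ultimately obtain y' where "has_C1_derivative_on y y' {0..}" using sol(4) by blast
    then have "has_C1_derivative_on (\<lambda>t. (y t, 0 :: 'h)) (\<lambda>t. (y' t, 0)) {0..}"
      unfolding has_C1_derivative_on_def
      by (auto intro!: continuous_on_Pair has_vector_derivative_Pair)
    then show ?thesis by blast
  qed
  have norm_y: "norm (y t) \<le> decay_const K \<gamma> T \<kappa> M h * exp (- (\<gamma> * t)) * norm y0" if t: "t \<ge> 0" for t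
  proof -
    let ?S = "2 + 2 * ((T + 1) * \<kappa>)\<^sup>2 * (\<Sum>n. (\<rho> n)\<^sup>2)"
    have S0: "?S \<ge> 0" using \<rho>_sum by (simp add: suminf_nonneg)
    have le: "\<bar>ym n t\<bar> \<le> K * exp (- (\<gamma> * t)) * g n" for n
      unfolding ym_def using mb(1)[OF decay'[OF t, of n]] by (simp add: mult.assoc)
    have "(norm (y t))\<^sup>2 = (\<Sum>n. (ym n t)\<^sup>2)"
      unfolding y_def by (rule series_norm[OF dominated_summable[OF G_sum ym_le[OF t]]])
    also have "\<dots> \<le> (\<Sum>n. (K * exp (- (\<gamma> * t)) * g n)\<^sup>2)"
    proof (rule suminf_le)
      show "(ym n t)\<^sup>2 \<le> (K * exp (- (\<gamma> * t)) * g n)\<^sup>2" for n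
        using power_mono[OF le[of n] abs_ge_zero, of 2] by simp
    qed (intro dominated_summable[OF G_sum ym_le[OF t]] summable_square_mult g_sum)+
    also have "\<dots> = (K * exp (- (\<gamma> * t)))\<^sup>2 * (\<Sum>n. (g n)\<^sup>2)"
      by (rule summable_square_mult(2)[OF g_sum])
    also have "\<dots> \<le> (K * exp (- (\<gamma> * t)))\<^sup>2 * ((exp (\<gamma> * T))\<^sup>2 * ((norm y0)\<^sup>2 * ?S))"
      by (intro mult_left_mono g_total) simp
    also have "\<dots> = (K * exp (- (\<gamma> * t)))\<^sup>2 * ((exp (\<gamma> * T))\<^sup>2 * ((norm y0)\<^sup>2 * (sqrt ?S)\<^sup>2))"
      by (simp only: real_sqrt_pow2[OF S0])
    also have "\<dots> = (decay_const K \<gamma> T \<kappa> M h * exp (- (\<gamma> * t)) * norm y0)\<^sup>2"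
      unfolding decay_const_def \<rho>_def[symmetric] by (simp only: power_mult_distrib mult_ac)
    finally show ?thesis
      by (rule power2_le_imp_le) (use K S0 in \<open>simp add: decay_const_def \<rho>_def\<close>)
  qed
  show ?thesis unfolding stabilized_by_def
  proof (rule exI[of _ "\<lambda>t. (y t, 0)"], intro conjI allI impI)
    show "memory_solution D A B \<delta> u y0 (\<lambda>t. (y t, 0))" by (rule ms)
    show "z t = (y t, 0)" if "memory_solution D A B \<delta> u y0 z" "0 \<le> t" for z t
      by (rule memory_solution_unique[OF \<delta> ms that])
    show "\<exists>y'. has_C1_derivative_on (\<lambda>t. (y t, 0 :: 'h)) y' {0..}" if "y0 \<in> D"
      by (rule regular[OF that])
    show "norm (y t, 0 :: 'h) \<le> decay_const K \<gamma> T \<kappa> M h * exp (- (\<gamma> * t)) * norm (real_part_embed y0)"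
      if "0 \<le> t" for t
      using norm_y[OF that] by (simp add: real_part_embed_def norm_Pair)
  qed
qed

end

section \<open>The stabilization theorem\<close>

lemma cinner_diff:
  "cinner (z - z') w = cinner z w - cinner z' w" "cinner z (w - w') = cinner z w - cinner z w'"
  by (simp_all add: cinner_def complex_eq_iff inner_diff_left inner_diff_right)

lemma cinner_self_eq_zero:
  assumes "cinner z z = 0"
  shows "z = 0"
proof -
  have "(norm (fst z))\<^sup>2 + (norm (snd z))\<^sup>2 = 0"
    using assms by (simp add: cinner_def complex_eq_iff power2_norm_eq_inner)
  then have "fst z = 0 \<and> snd z = 0" by (simp add: sum_power2_eq_zero_iff)
  then show ?thesis by (simp add: prod_eq_iff)
qed

text \<open>
  The adjoint of an orthogonal projection is the projection itself on its range: with
  \<open>d = P\<^sup>*s - s\<close> one gets \<open>(d, d) = (Pd, s) - (d, s) = 0\<close>.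
\<close>

lemma adjoint_projection_fixes:
  assumes P: "orthogonal_projection_onto S P" and adj: "adjoint_operators P P'" and s: "s \<in> S"
  shows "P' s = s"
proof -
  define d where "d = P' s - s"
  have "cinner (d - P d) s = 0" using P s unfolding orthogonal_projection_onto_def by blast
  then have "cinner d s = cinner (P d) s" by (simp add: cinner_diff)
  also have "\<dots> = cinner d (P' s)" using adj unfolding adjoint_operators_def by metis
  finally have "cinner d d = 0" unfolding d_def by (simp add: cinner_diff)
  then show ?thesis using cinner_self_eq_zero[of d] by (simp add: d_def)
qed

lemma embedded_basis_combination:
  "(\<Sum>k=1..N. c k *\<^sub>C real_part_embed (\<phi> k))
    = (\<Sum>k=1..N. Re (c k) *\<^sub>R \<phi> k, \<Sum>k=1..N. Im (c k) *\<^sub>R \<phi> k)"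
  by (simp add: cscale_def real_part_embed_def prod_eq_iff fst_sum snd_sum)

lemma biorthogonal_orthonormal:
  fixes \<phi> :: "nat \<Rightarrow> 'h::real_inner"
  assumes on: "\<And>i j. i \<in> {1..N} \<Longrightarrow> j \<in> {1..N} \<Longrightarrow> inner (\<phi> i) (\<phi> j) = (if i = j then 1 else 0)"
    and span: "z \<in> cspan_upto N \<phi>" and j: "j \<in> {1..N}"
    and bi: "\<And>i. i \<in> {1..N} \<Longrightarrow> cinner (real_part_embed (\<phi> i)) z = (if i = j then 1 else 0)"
  shows "z = real_part_embed (\<phi> j)"
proof -
  obtain c where z: "z = (\<Sum>k=1..N. Re (c k) *\<^sub>R \<phi> k, \<Sum>k=1..N. Im (c k) *\<^sub>R \<phi> k)"
    using span unfolding cspan_upto_def embedded_basis_combination by blast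
  have coef: "inner (\<phi> i) (\<Sum>k=1..N. r k *\<^sub>R \<phi> k) = r i" if "i \<in> {1..N}" for i and r :: "nat \<Rightarrow> real"
  proof -
    have "inner (\<phi> i) (\<Sum>k=1..N. r k *\<^sub>R \<phi> k) = (\<Sum>k=1..N. if k = i then r k else 0)"
      unfolding inner_sum_right using on[OF that] by (intro sum.cong) auto
    then show ?thesis using that by simp
  qed
  have c: "Re (c i) = (if i = j then 1 else 0)" "Im (c i) = 0" if "i \<in> {1..N}" for i
    using bi[OF that] coef[OF that, of "\<lambda>k. Re (c k)"] coef[OF that, of "\<lambda>k. Im (c k)"]
    unfolding z by (auto simp: cinner_def real_part_embed_def complex_eq_iff split: if_splits)
  have "(\<Sum>k=1..N. Re (c k) *\<^sub>R \<phi> k) = (\<Sum>k=1..N. if k = j then \<phi> k else 0)"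
    using c(1) by (intro sum.cong) auto
  also have "\<dots> = \<phi> j" using j by simp
  finally have "(\<Sum>k=1..N. Re (c k) *\<^sub>R \<phi> k) = \<phi> j" .
  moreover have "(\<Sum>k=1..N. Im (c k) *\<^sub>R \<phi> k) = 0"
    using c(2) by (intro sum.neutral) auto
  ultimately show ?thesis unfolding z real_part_embed_def by simp
qed

text \<open>
  For large eigenvalues \<open>Re \<mu>\<^sup>+ \<ge> (\<lambda> + \<delta>)/2\<close> and
  \<open>Re \<mu>\<^sup>- \<ge> 1 + \<delta> > \<gamma>\<close>, so the suprema that define \<open>N\<close> are taken
  over bounded sets and are upper bounds of them.
\<close>

lemma beyond_unstable_dim:
  assumes \<delta>: "\<delta> > 0" and \<gamma>: "\<gamma> < 1 + \<delta>" and lim: "filterlim lam at_top sequentially"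
    and n: "unstable_dim \<delta> lam \<gamma> < n"
  shows "\<gamma> < Re (mu_plus \<delta> (lam n))" "\<gamma> < Re (mu_minus \<delta> (lam n))"
proof -
  from lim have "eventually (\<lambda>j. max (4 * \<delta> + 8) (2 * \<gamma>) \<le> lam j) sequentially"
    unfolding filterlim_at_top by blast
  then obtain n0 where n0: "\<And>j. j \<ge> n0 \<Longrightarrow> lam j \<ge> 4 * \<delta> + 8 \<and> lam j \<ge> 2 * \<gamma>"
    unfolding eventually_sequentially by force
  let ?Sp = "{j. 1 \<le> j \<and> Re (mu_plus \<delta> (lam j)) \<le> \<gamma>}"
  let ?Sm = "{j. 1 \<le> j \<and> Re (mu_minus \<delta> (lam j)) \<le> \<gamma>}"
  have "j < n0" if "j \<in> ?Sp" for j
  proof (rule ccontr)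
    assume "\<not> j < n0"
    then show False using n0[of j] Re_mu_plus_ge[of "lam j" \<delta>] that \<delta> by auto
  qed
  then have bp: "bdd_above ?Sp" by (meson bdd_above.I less_imp_le)
  have "j < n0" if "j \<in> ?Sm" for j
  proof (rule ccontr)
    assume "\<not> j < n0"
    then show False using n0[of j] Re_mu_minus_ge[OF \<delta>, of "lam j"] that \<gamma> by auto
  qed
  then have bm: "bdd_above ?Sm" by (meson bdd_above.I less_imp_le)
  have "n \<notin> ?Sp" using cSup_upper[OF _ bp, of n] n unfolding unstable_dim_def by auto
  then show "\<gamma> < Re (mu_plus \<delta> (lam n))" using n by auto
  have "n \<notin> ?Sm" using cSup_upper[OF _ bm, of n] n unfolding unstable_dim_def by auto
  then show "\<gamma> < Re (mu_minus \<delta> (lam n))" using n by auto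
qed

lemma multiplicity_le:
  assumes "has_multiplicities lam N l m"
  shows "Sup (m ` {1..l}) \<le> N"
proof (cases "l = 0")
  case False
  have "m k \<le> N" if "k \<in> {1..l}" for k
  proof -
    have "m k \<le> (\<Sum>i=1..l. m i)" using that by (intro member_le_sum) auto
    also have "\<dots> = N" using assms unfolding has_multiplicities_def partial_sum_def by blast
    finally show ?thesis .
  qed
  then show ?thesis using False by (intro cSup_least) auto
qed simp

lemma control_image:
  fixes B :: "'u::real_inner \<Rightarrow> 'h::real_inner"
  assumes B: "bounded_linear B" and emb: "Real_Vector_Spaces.linear emb"
  shows "map_prod B B (control emb M (\<lambda>i. real_part_embed (\<phi> i)) (\<lambda>i t. complex_of_real (V (i - 1) t)) t)
    = (\<Sum>i<M. V i t *\<^sub>R B (emb (\<phi> (Suc i))), 0)"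
proof -
  interpret B: bounded_linear B by (rule B)
  have e0: "emb 0 = 0" by (rule linear_0[OF emb])
  have "control emb M (\<lambda>i. real_part_embed (\<phi> i)) (\<lambda>i t. complex_of_real (V (i - 1) t)) t
     = (\<Sum>i=1..M. V (i - 1) t *\<^sub>R emb (\<phi> i), 0)"
    by (simp add: control_def cscale_def real_part_embed_def prod_eq_iff fst_sum snd_sum e0)
  also have "(\<Sum>i=1..M. V (i - 1) t *\<^sub>R emb (\<phi> i)) = (\<Sum>i<M. V i t *\<^sub>R emb (\<phi> (Suc i)))"
    by (simp add: sum.atLeast1_atMost_eq)
  finally show ?thesis by (simp add: B.sum B.scaleR B.zero)
qed

lemma stabilized_by_mono:
  assumes s: "stabilized_by D A B \<delta> \<gamma> C y0 u" and C: "C \<le> C'"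
  shows "stabilized_by D A B \<delta> \<gamma> C' y0 u"
proof -
  have "C * exp (- (\<gamma> * t)) * norm (real_part_embed y0) \<le> C' * exp (- (\<gamma> * t)) * norm (real_part_embed y0)" for t
    using C by (intro mult_right_mono) auto
  then have "norm (y t) \<le> C' * exp (- (\<gamma> * t)) * norm (real_part_embed y0)"
    if "norm (y t) \<le> C * exp (- (\<gamma> * t)) * norm (real_part_embed y0)" for y :: "real \<Rightarrow> 'a \<times> 'a" and t
    using that order_trans by blast
  then show ?thesis using s unfolding stabilized_by_def by blast
qed

text \<open>
  \<open>exp(\<delta> s) (V' + \<delta> V)\<close> is the derivative of \<open>exp(\<delta> s) V\<close>, and \<open>V\<close> vanishes at \<open>T\<close>.
\<close>

lemma terminal_integral_representation:
  fixes V V' :: "real \<Rightarrow> real"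
  assumes V: "\<And>s. (V has_real_derivative V' s) (at s)" and VT: "V T = 0" and t: "t \<le> T"
  shows "((\<lambda>s. complex_of_real (memory_kernel \<delta> (t - s)) * complex_of_real (V' s + \<delta> * V s))
      has_integral - complex_of_real (V t)) {t..T}"
proof -
  have "((\<lambda>s. memory_kernel \<delta> (t - s) * (V' s + \<delta> * V s)) has_integral
      (memory_kernel \<delta> (t - T) * V T - memory_kernel \<delta> (t - t) * V t)) {t..T}"
  proof (rule fundamental_theorem_of_calculus[OF t])
    fix s
    have k: "((\<lambda>s. memory_kernel \<delta> (t - s)) has_real_derivative \<delta> * memory_kernel \<delta> (t - s)) (at s)"
      unfolding memory_kernel_def by (auto intro!: derivative_eq_intros)
    have "((\<lambda>s. memory_kernel \<delta> (t - s) * V s) has_real_derivative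
        memory_kernel \<delta> (t - s) * (V' s + \<delta> * V s)) (at s)"
      by (rule DERIV_cong[OF DERIV_mult[OF k V]]) (simp add: algebra_simps)
    then show "((\<lambda>s. memory_kernel \<delta> (t - s) * V s) has_vector_derivative
        memory_kernel \<delta> (t - s) * (V' s + \<delta> * V s)) (at s within {t..T})"
      unfolding has_real_derivative_iff_has_vector_derivative[symmetric]
      by (rule has_field_derivative_at_within)
  qed
  from has_integral_of_real[OF this, where 'b = complex]
  show ?thesis using VT by (simp add: memory_kernel_def del: of_real_add)
qed

lemma square_integral_bound:
  fixes w :: "real \<Rightarrow> complex"
  assumes T: "T \<ge> 0" and w: "continuous_on UNIV w" and le: "\<And>t. t \<ge> 0 \<Longrightarrow> cmod (w t) \<le> c"
  shows "set_borel_measurable lborel {0..T} w"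
    and "set_integrable lborel {0..T} (\<lambda>t. (cmod (w t))\<^sup>2)"
    and "(LINT t:{0..T}|lborel. (cmod (w t))\<^sup>2) \<le> T * c\<^sup>2"
proof -
  have "w \<in> borel_measurable lborel" using borel_measurable_continuous_onI[OF w] by simp
  then show "set_borel_measurable lborel {0..T} w"
    unfolding set_borel_measurable_def by measurable
  show i: "set_integrable lborel {0..T} (\<lambda>t. (cmod (w t))\<^sup>2)"
    by (rule borel_integrable_atLeastAtMost')
      (intro continuous_intros continuous_on_subset[OF w] subset_UNIV)
  have "(LINT t:{0..T}|lborel. (cmod (w t))\<^sup>2) = integral {0..T} (\<lambda>t. (cmod (w t))\<^sup>2)"
    by (rule set_borel_integral_eq_integral(2)[OF i])
  also have "\<dots> \<le> integral {0..T} (\<lambda>t. c\<^sup>2)"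
    by (rule integral_le[OF set_borel_integral_eq_integral(1)[OF i]])
      (use le in \<open>auto intro: power_mono\<close>)
  also have "\<dots> = T * c\<^sup>2" using T by simp
  finally show "(LINT t:{0..T}|lborel. (cmod (w t))\<^sup>2) \<le> T * c\<^sup>2" .
qed

theorem theorem4p2:
  fixes D :: "'h::{real_inner, complete_space} set"
    and A :: "'h \<Rightarrow> 'h"
    and B :: "'u::{real_inner, complete_space} \<Rightarrow> 'h"
    and emb :: "'h \<Rightarrow> 'u"
    and \<delta> \<gamma> :: real
    and lam :: "nat \<Rightarrow> real"
    and \<phi> :: "nat \<Rightarrow> 'h"
    and \<phi>s :: "nat \<Rightarrow> 'h \<times> 'h"
    and Pu Pus :: "'h \<times> 'h \<Rightarrow> 'h \<times> 'h"
    and N M l :: nat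
    and m :: "nat \<Rightarrow> nat"
    and R Rinv R' R'inv :: "complex mat"
    and p q :: "nat \<Rightarrow> nat list"
  assumes "linear_operator_on D A" and "closure D = UNIV" and "closed_operator D A"
    and "self_adjoint_operator D A" and "positive_definite_operator D A"
    and "compact_resolvent D A"
    and "bounded_linear B" and "Real_Vector_Spaces.linear emb"
    and "\<delta> > 0"
    and "orthonormal_eigenbasis D A lam \<phi>" and "equal_ones_consecutive lam"
    and "filterlim lam at_top sequentially"
    and "\<forall>j\<ge>1. \<delta> \<noteq> lam j + 2 * sqrt (lam j) \<and> \<delta> \<noteq> lam j - 2 * sqrt (lam j)"
    and "\<forall>j\<ge>1. \<forall>i\<ge>1. j \<noteq> i \<longrightarrow> mu_plus \<delta> (lam j) \<noteq> mu_minus \<delta> (lam i)"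
    and "0 < \<gamma>" and "\<gamma> < 1 + \<delta>"
    and "N = unstable_dim \<delta> lam \<gamma>"
    and "has_multiplicities lam N l m"
    and "M = Sup (m ` {1..l})"
    and "orthogonal_projection_onto (cspan_upto N \<phi>) Pu" and "adjoint_operators Pu Pus"
    and "\<forall>j\<in>{1..N}. \<phi>s j \<in> cspan_upto N \<phi>"
    and "\<forall>i\<in>{1..N}. \<forall>j\<in>{1..N}.
           cinner (real_part_embed (\<phi> i)) (\<phi>s j) = (if i = j then 1 else 0)"
    and "semisimple_case \<delta> lam N \<Longrightarrow>
           similar_mat_wit (P_mat \<delta> lam N) (D_mat \<delta> lam N) Rinv R \<and>
           rank_condition (R * Q_mat B emb \<phi>s N M) N M l m"
    and "\<not> semisimple_case \<delta> lam N \<Longrightarrow>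
           jordan_sizes l m p \<and> jordan_sizes l m q \<and>
           similar_mat_wit (P_mat \<delta> lam N) (J_mat \<delta> lam N l m p q) R'inv R' \<and>
           rank_condition (R' * Q_mat B emb \<phi>s N M) N M l m"
  shows "\<exists>\<Phi> :: nat \<Rightarrow> 'h \<times> 'h.
    (\<forall>i\<in>{1..M}. \<Phi> i \<in> D \<times> D) \<and>
    (semisimple_case \<delta> lam N \<longrightarrow> (\<forall>i\<in>{1..M}. \<Phi> i = \<phi>s i)) \<and>
    (\<exists>c :: nat \<Rightarrow> nat \<Rightarrow> complex.
       \<forall>i\<in>{1..M}. \<Phi> i = (\<Sum>k=1..N. c i k *\<^sub>C Pus (real_part_embed (\<phi> k)))) \<and>
    (\<forall>T>0. \<exists>C. \<forall>y0. \<exists>v w :: nat \<Rightarrow> real \<Rightarrow> complex.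
       stabilized_by D A B \<delta> \<gamma> C y0 (control emb M \<Phi> v) \<and>
       (\<forall>i\<in>{1..M}.
          continuous_on {0..<T} (v i) \<and>
          (\<forall>t\<in>{0<..<T}.
             (v i has_vector_derivative (w i t - complex_of_real \<delta> * v i t)) (at t)) \<and>
          (\<forall>t\<in>{0..T}.
             (\<lambda>s. complex_of_real (memory_kernel \<delta> (t - s)) * w i s) integrable_on {t..T} \<and>
             v i t = - integral {t..T} (\<lambda>s. complex_of_real (memory_kernel \<delta> (t - s)) * w i s)) \<and>
          set_borel_measurable lborel {0..T} (w i) \<and>
          set_integrable lborel {0..T} (\<lambda>t. (cmod (w i t))\<^sup>2) \<and>
          (LINT t:{0..T}|lborel. (cmod (w i t))\<^sup>2) \<le> C * (norm (real_part_embed y0))\<^sup>2 \<and>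
          (\<forall>t\<ge>T. v i t = 0 \<and> w i t = 0))) \<and>
    (\<exists>C. \<forall>y0. \<exists>v v' v'' :: nat \<Rightarrow> real \<Rightarrow> complex.
       stabilized_by D A B \<delta> \<gamma> C y0 (control emb M \<Phi> v) \<and>
       (\<forall>j\<in>{1..M}.
          has_C1_derivative_on (v j) (v' j) {0..} \<and> has_C1_derivative_on (v' j) (v'' j) {0..} \<and>
          (\<forall>t>0. cmod (v j t) + cmod (v' j t) + cmod (v'' j t)
                  \<le> C * exp (- (\<gamma> * t)) * norm (real_part_embed y0))))"
proof -
  note lin = assms(1) and closed = assms(3) and sa = assms(4) and pos = assms(5)
    and B = assms(7) and emb = assms(8) and \<delta> = assms(9) and eig = assms(10) and lim = assms(12)
    and disc = assms(13) and \<gamma>0 = assms(15) and \<gamma>1 = assms(16) and N = assms(17)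
    and mult = assms(18) and M = assms(19) and Pu = assms(20) and Pus = assms(21)
    and span = assms(22) and bi = assms(23) and semi = assms(24)
  \<comment> \<open>Matrix indices start at 0, and the modes are renumbered accordingly.\<close>
  define e where "e n = \<phi> (Suc n)" for n
  define L where "L n = lam (Suc n)" for n
  define h where "h i = B (emb (e i))" for i
  have on: "inner (\<phi> i) (\<phi> j) = (if i = j then 1 else 0)" if "i \<ge> 1" "j \<ge> 1" for i j
    using eig that unfolding orthonormal_eigenbasis_def by blast
  have ev: "\<phi> n \<in> D" "A (\<phi> n) = lam n *\<^sub>R \<phi> n" if "n \<ge> 1" for n
    using eig that unfolding orthonormal_eigenbasis_def by blast+
  have lam_pos: "lam n > 0" if "n \<ge> 1" for n
  proof -
    have n1: "inner (\<phi> n) (\<phi> n) = 1" using on[OF that that] by simp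
    then have "\<phi> n \<noteq> 0" by auto
    then have "inner (A (\<phi> n)) (\<phi> n) > 0"
      using pos ev(1)[OF that] unfolding positive_definite_operator_def by blast
    then show ?thesis using n1 by (simp add: ev(2)[OF that])
  qed
  have "range e = \<phi> ` {1..}"
  proof -
    have "range Suc = {1..}" by (auto simp: image_iff Suc_le_eq gr0_conv_Suc)
    then show ?thesis unfolding e_def by (metis image_image)
  qed
  then have total: "closure (Real_Vector_Spaces.span (range e)) = UNIV"
    using eig unfolding orthonormal_eigenbasis_def by simp
  interpret diagonal_operator e D A L
  proof
    show "inner (e i) (e j) = (if i = j then 1 else 0)" for i j
      using on[of "Suc i" "Suc j"] by (simp add: e_def)
    show "e n \<in> D" "A (e n) = L n *\<^sub>R e n" "L n > 0" for n
      using ev[of "Suc n"] lam_pos[of "Suc n"] by (simp_all add: e_def L_def)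
  qed (fact total lin closed sa)+
  have ne: "mu_plus \<delta> (lam j) \<noteq> mu_minus \<delta> (lam j)" if "j \<ge> 1" for j
    using mu_distinct[OF lam_pos[OF that]] disc that by blast
  have semisimple: "semisimple_case \<delta> lam N"
    by (rule semisimple_of_simple_roots) (use ne in simp)
  define C where "C = C_mat B emb \<phi>s N M"
  have sim: "similar_mat_wit (P_mat \<delta> lam N) (D_mat \<delta> lam N) Rinv R"
    and rank: "rank_condition (R * (0\<^sub>m N M @\<^sub>r C)) N M l m"
    using semi[OF semisimple] by (simp_all add: Q_mat_def C_def)
  have MN: "M \<le> N" unfolding M by (rule multiplicity_le[OF mult])
  have \<phi>s: "\<phi>s j = real_part_embed (\<phi> j)" if j: "j \<in> {1..N}" for j
    by (rule biorthogonal_orthonormal[where N = N]) (use on span bi j in auto)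
  have emb0: "emb 0 = 0" and B0: "B 0 = 0"
    by (rule linear_0[OF emb], rule linear_0[OF bounded_linear.linear[OF B]])
  have C: "C \<in> carrier_mat N M" by (simp add: C_def C_mat_def)
  have C_entry: "C $$ (r, i) = complex_of_real (inner (h i) (e r))" if "r < N" "i < M" for r i
  proof -
    have "\<phi>s (i + 1) = (e i, 0)" "\<phi>s (r + 1) = (e r, 0)"
      using \<phi>s[of "i + 1"] \<phi>s[of "r + 1"] that MN by (auto simp: e_def real_part_embed_def)
    then show ?thesis using that
      by (simp add: C_def C_mat_def cinner_def emb0 B0 h_def complex_eq_iff)
  qed
  have indep: "c j = 0"
    if j: "j < N" and c: "\<And>i. i < M \<Longrightarrow>
      (\<Sum>r | r < N \<and> L r = L j. c r * complex_of_real (inner (h i) (e r))) = 0" for c j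
  proof (rule eigenspace_rows_independent[OF \<delta> sim C rank mult j])
    fix i assume i: "i < M"
    show "(\<Sum>r | r < N \<and> lam (Suc r) = lam (Suc j). c r * C $$ (r, i)) = 0"
      using c[OF i] by (simp add: C_entry i L_def)
  qed
  have neL: "mu_plus \<delta> (L n) \<noteq> mu_minus \<delta> (L n)" for n unfolding L_def by (rule ne) simp
  have "filterlim L at_top sequentially"
    unfolding L_def using lim by (rule filterlim_compose) (rule filterlim_Suc)
  from modal_coefficient_bound[OF \<delta> L_pos this neL]
  obtain K where K: "K \<ge> 0" and K_bound: "\<And>n. cmod (of_real (L n) - mu_minus \<delta> (L n))
      + (1 + L n) * cmod (of_real \<delta> - mu_minus \<delta> (L n)) + L n
      \<le> K * cmod (mu_plus \<delta> (L n) - mu_minus \<delta> (L n))" by blast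
  have stable: "\<gamma> \<le> Re (mu_plus \<delta> (L n)) \<and> \<gamma> \<le> Re (mu_minus \<delta> (L n))" if "n \<ge> N" for n
    using beyond_unstable_dim[OF \<delta> \<gamma>1 lim, of "Suc n"] that unfolding N L_def by (simp add: less_imp_le)
  define \<Phi> where "\<Phi> i = real_part_embed (\<phi> i)" for i
  define v where "v V i t = complex_of_real (V (i - 1) t)" for V :: "nat \<Rightarrow> real \<Rightarrow> real" and i t
  let ?ctrl = "\<lambda>T \<kappa> C y0. \<exists>V V' V''. C2_vanishing_after T V V' V'' \<and>
     (\<forall>i<M. \<forall>s\<ge>0. \<bar>V i s\<bar> + \<bar>V' i s\<bar> + \<bar>V'' i s\<bar> \<le> \<kappa> * norm y0) \<and>
     stabilized_by D A B \<delta> \<gamma> C y0 (control emb M \<Phi> (v V))"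
  have main: "\<exists>\<kappa>\<ge>0. \<exists>C. \<forall>y0. ?ctrl T \<kappa> C y0" if T: "T > 0" for T
  proof -
    obtain \<kappa> where \<kappa>: "\<kappa> \<ge> 0" and ctrl: "\<And>a A. \<forall>n<N. \<bar>a n\<bar> \<le> A \<Longrightarrow>
      \<exists>V V' V''. C2_vanishing_after T V V' V'' \<and>
       (\<forall>i<M. \<forall>s\<ge>0. \<bar>V i s\<bar> + \<bar>V' i s\<bar> + \<bar>V'' i s\<bar> \<le> \<kappa> * A) \<and>
       (\<forall>n<N. \<forall>\<mu>. \<mu> = mu_plus \<delta> (L n) \<or> \<mu> = mu_minus \<delta> (L n) \<longrightarrow>
         integral {0..T} (\<lambda>s. exp (\<mu> * of_real s) * of_real (\<Sum>i<M. V i s * inner (h i) (e n)))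
           = - complex_of_real (a n))"
      using null_control_functions[OF \<delta> T, where N = N and M = M and L = L and k = "\<lambda>n i. inner (h i) (e n)"]
        indep by blast
    show ?thesis
    proof (rule exI[of _ \<kappa>], rule conjI[OF \<kappa>], rule exI[of _ "decay_const K \<gamma> T \<kappa> M h"], rule allI)
      fix y0 :: 'h
      have "\<forall>n<N. \<bar>inner y0 (e n)\<bar> \<le> norm y0"
      proof (intro allI impI)
        fix n
        have "norm (e n) = 1" using orthonormal[of n n] by (simp add: norm_eq_sqrt_inner)
        then show "\<bar>inner y0 (e n)\<bar> \<le> norm y0" using Cauchy_Schwarz_ineq2[of y0 "e n"] by simp
      qed
      from ctrl[OF this] obtain V V' V'' where V: "C2_vanishing_after T V V' V''"
        and bV: "\<forall>i<M. \<forall>s\<ge>0. \<bar>V i s\<bar> + \<bar>V' i s\<bar> + \<bar>V'' i s\<bar> \<le> \<kappa> * norm y0"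
        and moments: "\<forall>n<N. \<forall>\<mu>. \<mu> = mu_plus \<delta> (L n) \<or> \<mu> = mu_minus \<delta> (L n) \<longrightarrow>
          integral {0..T} (\<lambda>s. exp (\<mu> * of_real s) * of_real (\<Sum>i<M. V i s * inner (h i) (e n)))
            = - complex_of_real (inner y0 (e n))" by blast
      note V' = V[unfolded C2_vanishing_after_def]
      have "stabilized_by D A B \<delta> \<gamma> (decay_const K \<gamma> T \<kappa> M h) y0 (control emb M \<Phi> (v V))"
      proof (rule stabilized_by_null_control[where V = V and N = N])
        show "continuous_on {0..} (V i)" for i
          by (rule DERIV_continuous_on, rule has_field_derivative_at_within) (use V' in blast)
        show "\<bar>V i s\<bar> \<le> \<kappa> * norm y0" if "i < M" "s \<ge> 0" for i s
          using bV that by (smt (verit) abs_ge_zero)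
        show "map_prod B B (control emb M \<Phi> (v V) t) = (\<Sum>i<M. V i t *\<^sub>R h i, 0)" for t
          using control_image[OF B emb, of M \<phi> V t] unfolding \<Phi>_def[abs_def] v_def[abs_def] h_def e_def .
        show "V i s = 0" if "s \<ge> T" for i s using V' that by blast
        show "integral {0..T} (\<lambda>s. exp (\<mu> * of_real s) * of_real (\<Sum>i<M. V i s * inner (h i) (e n)))
            = - complex_of_real (inner y0 (e n))"
          if "n < N" "\<mu> = mu_plus \<delta> (L n) \<or> \<mu> = mu_minus \<delta> (L n)" for n \<mu>
          using moments that by blast
        show "\<gamma> \<ge> 0" "T \<ge> 0" using \<gamma>0 T by simp_all
      qed (fact \<delta> K \<kappa> neL K_bound stable)+
      with V bV show "?ctrl T \<kappa> (decay_const K \<gamma> T \<kappa> M h) y0" by blast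
    qed
  qed
  have nemb: "norm (real_part_embed y0) = norm y0" for y0 :: 'h
    by (simp add: real_part_embed_def norm_Pair)
  let ?finite_time = "\<lambda>T C y0 (v :: nat \<Rightarrow> real \<Rightarrow> complex) (w :: nat \<Rightarrow> real \<Rightarrow> complex).
       stabilized_by D A B \<delta> \<gamma> C y0 (control emb M \<Phi> v) \<and>
       (\<forall>i\<in>{1..M}.
          continuous_on {0..<T} (v i) \<and>
          (\<forall>t\<in>{0<..<T}.
             (v i has_vector_derivative (w i t - complex_of_real \<delta> * v i t)) (at t)) \<and>
          (\<forall>t\<in>{0..T}.
             (\<lambda>s. complex_of_real (memory_kernel \<delta> (t - s)) * w i s) integrable_on {t..T} \<and>
             v i t = - integral {t..T} (\<lambda>s. complex_of_real (memory_kernel \<delta> (t - s)) * w i s)) \<and>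
          set_borel_measurable lborel {0..T} (w i) \<and>
          set_integrable lborel {0..T} (\<lambda>t. (cmod (w i t))\<^sup>2) \<and>
          (LINT t:{0..T}|lborel. (cmod (w i t))\<^sup>2) \<le> C * (norm (real_part_embed y0))\<^sup>2 \<and>
          (\<forall>t\<ge>T. v i t = 0 \<and> w i t = 0))"
  let ?smooth = "\<lambda>C y0 (v :: nat \<Rightarrow> real \<Rightarrow> complex) (v' :: nat \<Rightarrow> real \<Rightarrow> complex)
      (v'' :: nat \<Rightarrow> real \<Rightarrow> complex).
       stabilized_by D A B \<delta> \<gamma> C y0 (control emb M \<Phi> v) \<and>
       (\<forall>j\<in>{1..M}.
          has_C1_derivative_on (v j) (v' j) {0..} \<and> has_C1_derivative_on (v' j) (v'' j) {0..} \<and>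
          (\<forall>t>0. cmod (v j t) + cmod (v' j t) + cmod (v'' j t)
                  \<le> C * exp (- (\<gamma> * t)) * norm (real_part_embed y0)))"
  show ?thesis
  proof (intro exI[of _ \<Phi>] conjI)
    show "\<forall>i\<in>{1..M}. \<Phi> i \<in> D \<times> D"
      using ev(1) zero_in_domain(1) by (simp add: \<Phi>_def real_part_embed_def)
    show "semisimple_case \<delta> lam N \<longrightarrow> (\<forall>i\<in>{1..M}. \<Phi> i = \<phi>s i)"
      using \<phi>s MN by (simp add: \<Phi>_def)
    show "\<exists>c :: nat \<Rightarrow> nat \<Rightarrow> complex.
       \<forall>i\<in>{1..M}. \<Phi> i = (\<Sum>k=1..N. c i k *\<^sub>C Pus (real_part_embed (\<phi> k)))"
    proof (intro exI[of _ "\<lambda>i k. if i = k then 1 else 0"] ballI)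
      fix i assume i: "i \<in> {1..M}"
      have Pus_fix: "Pus (real_part_embed (\<phi> k)) = real_part_embed (\<phi> k)" if k: "k \<in> {1..N}" for k
      proof (rule adjoint_projection_fixes[OF Pu Pus])
        have "\<phi>s k \<in> cspan_upto N \<phi>" using span k by blast
        then show "real_part_embed (\<phi> k) \<in> cspan_upto N \<phi>" using \<phi>s[OF k] by simp
      qed
      have "(\<Sum>k=1..N. (if i = k then 1 else 0) *\<^sub>C Pus (real_part_embed (\<phi> k)))
          = (\<Sum>k=1..N. if k = i then real_part_embed (\<phi> k) else 0)"
        by (intro sum.cong) (auto simp: Pus_fix cscale_def prod_eq_iff)
      then show "\<Phi> i = (\<Sum>k=1..N. (if i = k then 1 else 0) *\<^sub>C Pus (real_part_embed (\<phi> k)))"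
        using i MN by (simp add: \<Phi>_def)
    qed
    show "\<forall>T>0. \<exists>C. \<forall>y0. \<exists>v w. ?finite_time T C y0 v w"
    proof (intro allI impI)
      fix T :: real assume T: "T > 0"
      from main[OF T] obtain \<kappa> C0 where \<kappa>: "\<kappa> \<ge> 0" and ex: "\<And>y0. ?ctrl T \<kappa> C0 y0" by blast
      \<comment> \<open>The second entry bounds the square integral of \<open>w = v' + \<delta> v\<close> over \<open>[0, T]\<close>.\<close>
      define C1 where "C1 = max C0 (T * (\<kappa> * (1 + \<delta>))\<^sup>2)"
      show "\<exists>C. \<forall>y0. \<exists>v w. ?finite_time T C y0 v w"
      proof (intro exI[of _ C1] allI)
        fix y0 :: 'h
        from ex[of y0] obtain V V' V'' where V: "C2_vanishing_after T V V' V''"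
          and bV: "\<And>i s. i < M \<Longrightarrow> s \<ge> 0 \<Longrightarrow> \<bar>V i s\<bar> + \<bar>V' i s\<bar> + \<bar>V'' i s\<bar> \<le> \<kappa> * norm y0"
          and stab: "stabilized_by D A B \<delta> \<gamma> C0 y0 (control emb M \<Phi> (v V))" by blast
        from V have dV: "\<And>i s. (V i has_real_derivative V' i s) (at s)" "\<And>i s. (V' i has_real_derivative V'' i s) (at s)"
          and cV'': "\<And>i. continuous_on UNIV (V'' i)"
          and zV: "\<And>i s. s \<ge> T \<Longrightarrow> V i s = 0 \<and> V' i s = 0 \<and> V'' i s = 0"
          unfolding C2_vanishing_after_def by blast+
        define w where "w i t = complex_of_real (V' (i - 1) t + \<delta> * V (i - 1) t)" for i t
        have cV: "continuous_on X (V i)" "continuous_on X (V' i)" for i X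
          by (rule DERIV_continuous_on, rule has_field_derivative_at_within[OF dV(1)])
            (rule DERIV_continuous_on, rule has_field_derivative_at_within[OF dV(2)])
        have w_cont: "continuous_on UNIV (w i)" for i
          unfolding w_def by (intro continuous_intros cV)
        have w_le: "cmod (w i t) \<le> \<kappa> * (1 + \<delta>) * norm y0" if "i \<in> {1..M}" "t \<ge> 0" for i t
        proof -
          have i: "i - 1 < M" using that by auto
          have "cmod (w i t) \<le> \<bar>V' (i - 1) t\<bar> + \<delta> * \<bar>V (i - 1) t\<bar>"
            unfolding w_def norm_of_real using \<delta> abs_triangle_ineq[of "V' (i - 1) t" "\<delta> * V (i - 1) t"]
            by (simp add: abs_mult)
          also have "\<dots> \<le> (1 + \<delta>) * (\<bar>V (i - 1) t\<bar> + \<bar>V' (i - 1) t\<bar> + \<bar>V'' (i - 1) t\<bar>)"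
            using \<delta> by (simp add: algebra_simps)
          also have "\<dots> \<le> (1 + \<delta>) * (\<kappa> * norm y0)"
            using bV[OF i that(2)] \<delta> by (intro mult_left_mono) auto
          finally show ?thesis by (simp add: mult_ac)
        qed
        show "\<exists>v w. ?finite_time T C1 y0 v w"
        proof (rule exI[of _ "v V"], rule exI[of _ w], intro conjI ballI allI impI)
          show "stabilized_by D A B \<delta> \<gamma> C1 y0 (control emb M \<Phi> (v V))"
            by (rule stabilized_by_mono[OF stab]) (simp add: C1_def)
          fix i assume i: "i \<in> {1..M}"
          show "continuous_on {0..<T} (v V i)" unfolding v_def by (intro continuous_intros cV)
          show "(v V i has_vector_derivative w i t - complex_of_real \<delta> * v V i t) (at t)" for t
          proof -
            have "(v V i has_vector_derivative complex_of_real (V' (i - 1) t)) (at t)"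
              unfolding v_def
              by (rule has_vector_derivative_of_real)
                (use dV(1)[of "i - 1" t] in \<open>simp add: has_real_derivative_iff_has_vector_derivative\<close>)
            then show ?thesis by (simp add: w_def v_def)
          qed
          have rep: "((\<lambda>s. complex_of_real (memory_kernel \<delta> (t - s)) * w i s) has_integral - v V i t) {t..T}"
            if "t \<in> {0..T}" for t
            unfolding w_def v_def
            by (rule terminal_integral_representation[OF dV(1)]) (use zV that in auto)
          show "(\<lambda>s. complex_of_real (memory_kernel \<delta> (t - s)) * w i s) integrable_on {t..T}"
            if "t \<in> {0..T}" for t by (rule has_integral_integrable[OF rep[OF that]])
          show "v V i t = - integral {t..T} (\<lambda>s. complex_of_real (memory_kernel \<delta> (t - s)) * w i s)"
            if "t \<in> {0..T}" for t using integral_unique[OF rep[OF that]] by simp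
          note sq = square_integral_bound[OF less_imp_le[OF T] w_cont w_le[OF i]]
          show "set_borel_measurable lborel {0..T} (w i)" by (rule sq(1))
          show "set_integrable lborel {0..T} (\<lambda>t. (cmod (w i t))\<^sup>2)" by (rule sq(2))
          have "T * (\<kappa> * (1 + \<delta>) * norm y0)\<^sup>2 \<le> C1 * (norm (real_part_embed y0))\<^sup>2"
            unfolding nemb power_mult_distrib[of "\<kappa> * (1 + \<delta>)"] mult.assoc[symmetric]
            by (intro mult_right_mono) (simp_all add: C1_def power_mult_distrib)
          with sq(3) show "(LINT t:{0..T}|lborel. (cmod (w i t))\<^sup>2) \<le> C1 * (norm (real_part_embed y0))\<^sup>2"
            by (rule order_trans)
          show "v V i t = 0" "w i t = 0" if "T \<le> t" for t
            using zV[OF that] by (simp_all add: v_def w_def)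
        qed
      qed
    qed
    show "\<exists>C. \<forall>y0. \<exists>v v' v''. ?smooth C y0 v v' v''"
    proof -
      from main[of 1] obtain \<kappa> C0 where \<kappa>: "\<kappa> \<ge> 0" and ex: "\<And>y0. ?ctrl 1 \<kappa> C0 y0" by auto
      \<comment> \<open>The control stops at time 1, so that \<open>exp \<gamma>\<close> compensates the weight \<open>exp (- \<gamma> t)\<close>.\<close>
      define C1 where "C1 = max C0 (\<kappa> * exp \<gamma>)"
      show ?thesis
      proof (intro exI[of _ C1] allI)
        fix y0 :: 'h
        from ex[of y0] obtain V V' V'' where V: "C2_vanishing_after 1 V V' V''"
          and bV: "\<And>i s. i < M \<Longrightarrow> s \<ge> 0 \<Longrightarrow> \<bar>V i s\<bar> + \<bar>V' i s\<bar> + \<bar>V'' i s\<bar> \<le> \<kappa> * norm y0"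
          and stab: "stabilized_by D A B \<delta> \<gamma> C0 y0 (control emb M \<Phi> (v V))" by blast
        from V have dV: "\<And>i s. (V i has_real_derivative V' i s) (at s)" "\<And>i s. (V' i has_real_derivative V'' i s) (at s)"
          and cV'': "\<And>i. continuous_on UNIV (V'' i)"
          and zV: "\<And>i s. s \<ge> 1 \<Longrightarrow> V i s = 0 \<and> V' i s = 0 \<and> V'' i s = 0"
          unfolding C2_vanishing_after_def by blast+
        have cV': "continuous_on X (V' i)" for i X
          by (rule DERIV_continuous_on, rule has_field_derivative_at_within[OF dV(2)])
        have C1_deriv: "has_C1_derivative_on (v F i) (v F' i) {0..}"
          if "\<And>i s. (F i has_real_derivative F' i s) (at s)" "\<And>i. continuous_on UNIV (F' i)"
          for F F' :: "nat \<Rightarrow> real \<Rightarrow> real" and i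
          unfolding has_C1_derivative_on_def
        proof (intro conjI ballI)
          show "continuous_on {0..} (v F' i)"
            unfolding v_def by (intro continuous_intros continuous_on_subset[OF that(2)] subset_UNIV)
          show "(v F i has_vector_derivative v F' i t) (at t within {0..})" for t
            unfolding v_def
            by (rule has_vector_derivative_of_real)
              (use has_field_derivative_at_within[OF that(1)[of "i - 1" t]] in
                \<open>simp add: has_real_derivative_iff_has_vector_derivative\<close>)
        qed
        show "\<exists>v v' v''. ?smooth C1 y0 v v' v''"
        proof (rule exI[of _ "v V"], rule exI[of _ "v V'"], rule exI[of _ "v V''"], intro conjI ballI allI impI)
          show "stabilized_by D A B \<delta> \<gamma> C1 y0 (control emb M \<Phi> (v V))"
            by (rule stabilized_by_mono[OF stab]) (simp add: C1_def)
          fix j assume j: "j \<in> {1..M}"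
          show "has_C1_derivative_on (v V j) (v V' j) {0..}" by (rule C1_deriv[OF dV(1) cV'])
          show "has_C1_derivative_on (v V' j) (v V'' j) {0..}" by (rule C1_deriv[OF dV(2) cV''])
          fix t :: real assume t: "t > 0"
          have C1: "\<kappa> * exp \<gamma> \<le> C1" "C1 \<ge> 0"
            using \<kappa> mult_nonneg_nonneg[OF \<kappa> exp_ge_zero[of \<gamma>]] by (auto simp: C1_def le_max_iff_disj)
          show "cmod (v V j t) + cmod (v V' j t) + cmod (v V'' j t)
              \<le> C1 * exp (- (\<gamma> * t)) * norm (real_part_embed y0)"
          proof (cases "t \<ge> 1")
            case True
            then show ?thesis using zV[OF True] C1(2) by (simp add: v_def)
          next
            case False
            have "\<gamma> * t \<le> \<gamma> * 1" using False \<gamma>0 by (intro mult_left_mono) auto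
            then have "1 \<le> exp \<gamma> * exp (- (\<gamma> * t))" by (simp add: exp_add[symmetric])
            then have "\<kappa> * 1 \<le> \<kappa> * (exp \<gamma> * exp (- (\<gamma> * t)))" using \<kappa> by (intro mult_left_mono)
            also have "\<dots> \<le> C1 * exp (- (\<gamma> * t))"
              unfolding mult.assoc[symmetric] using C1(1) by (intro mult_right_mono) auto
            finally have "\<kappa> * norm y0 \<le> C1 * exp (- (\<gamma> * t)) * norm y0" by (intro mult_right_mono) auto
            moreover have "j - 1 < M" using j by auto
            from bV[OF this, of t] t have "cmod (v V j t) + cmod (v V' j t) + cmod (v V'' j t) \<le> \<kappa> * norm y0"
              by (simp add: v_def)
            ultimately show ?thesis unfolding nemb by linarith
          qed
        qed
      qed
    qed
  qed
qed

end
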